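(* Let $(\Omega,\Sigma,\mu)$ be a non-atomic $\sigma$-finite complete measure space and let $\varphi$ and $\psi$ be complementary Orlicz functions. The following statements are equivalent. (i) $L_\varphi$ has the Daugavet property. (ii) $L_\varphi=L_{1,a_\psi}$ or $L_\varphi=L_{\infty,1/b_\varphi}$. (iii) $L_\psi^o=L_{\infty,1/a_\psi}$ or $L_\psi^o=L_{1,b_\varphi}$. (iv) $L_\psi^o$ has the Daugavet property.
   Context: All Banach spaces are real. A Banach space $X$ has the Daugavet property if $\|I+T\|=1+\|T\|$ for every rank one bounded linear operator $T:X\to X$. $L_0=L_0(\Omega)$ is the set of ($\mu$-a.e. equivalence classes of) measurable extended-real valued functions on $\Omega$. An Orlicz function is $\varphi:[0,\infty)\to[0,\infty]$, not identically $0$, with $\lim_{u\to0^+}\varphi(u)=\varphi(0)=0$, left continuous and convex on $(0,b_\varphi]$, where $b_\varphi=\sup\{u>0:\varphi(u)<\infty\}\in(0,\infty]$; $a_\varphi=\sup\{u\ge0:\varphi(u)=0\}\in[0,\infty)$. The complementary Orlicz function is $\psi(u)=\sup\{uv-\varphi(v):v>0\}$, and $a_\psi,b_\psi$ are defined analogously. $\rho_\varphi(x)=\int_\Omega\varphi(|x(t)|)\,d\mu$; $L_\varphi=\{x\in L_0:\rho_\varphi(\lambda x)<\infty\text{ for some }\lambda>0\}$ with the Luxemburg norm $\|x\|_\varphi=\inf\{\lambda>0:\rho_\varphi(x/\lambda)\le1\}$. $L_\psi^o$ is the space $L_\psi$ with the Orlicz norm $\|x\|_\psi^o=\sup\{\int_\Omega|xy|\,d\mu:\rho_\varphi(y)\le1\}$.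 For a constant $c\in(0,\infty)$, $L_{1,c}$ is $L_1(\Omega)$ with norm $\|x\|_{1,c}=\int_\Omega c|x|\,d\mu$, and $L_{\infty,c}$ is $L_\infty(\Omega)$ with norm $\|x\|_{\infty,c}=\operatorname{ess\,sup}_\Omega c|x|$. Equalities of spaces mean equality as sets with equality of norms, and include that the constant serving as a weight lies in $(0,\infty)$. *)

theory Defs
  imports "HOL-Probability.Essential_Supremum"
begin

section \<open>Real normed spaces with an explicit carrier and the Daugavet property\<close>

text \<open>
  The underlying set of an Orlicz space depends on the term variables for the measure space and the
  Orlicz function, so these spaces are not types and the class \<open>real_normed_vector\<close> does not apply.
\<close>

record 'v normed_space =
  vecs :: "'v set"
  vzero :: 'v
  vadd :: "'v \<Rightarrow> 'v \<Rightarrow> 'v"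
  vscale :: "real \<Rightarrow> 'v \<Rightarrow> 'v"
  vnorm :: "'v \<Rightarrow> real"

text \<open>
  Equality as sets with equality of norms. All function spaces below take their linear operations
  from \<open>L0\<close>, so these need not be compared.
\<close>

definition same_space :: "'v normed_space \<Rightarrow> 'v normed_space \<Rightarrow> bool" where
  "same_space X Y \<longleftrightarrow> vecs X = vecs Y \<and> (\<forall>x\<in>vecs X. vnorm X x = vnorm Y x)"

definition linear_operator :: "'v normed_space \<Rightarrow> ('v \<Rightarrow> 'v) \<Rightarrow> bool" where
  "linear_operator X T \<longleftrightarrow>
     (\<forall>x\<in>vecs X. T x \<in> vecs X) \<and>
     (\<forall>x\<in>vecs X. \<forall>y\<in>vecs X. T (vadd X x y) = vadd X (T x) (T y)) \<and>
     (\<forall>c. \<forall>x\<in>vecs X. T (vscale X c x) = vscale X c (T x))"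

definition bounded_operator :: "'v normed_space \<Rightarrow> ('v \<Rightarrow> 'v) \<Rightarrow> bool" where
  "bounded_operator X T \<longleftrightarrow> linear_operator X T \<and> (\<exists>K. \<forall>x\<in>vecs X. vnorm X (T x) \<le> K * vnorm X x)"

definition rank_one :: "'v normed_space \<Rightarrow> ('v \<Rightarrow> 'v) \<Rightarrow> bool" where
  "rank_one X T \<longleftrightarrow> (\<exists>e\<in>vecs X. e \<noteq> vzero X \<and> T ` vecs X = range (\<lambda>c. vscale X c e))"

definition operator_norm :: "'v normed_space \<Rightarrow> ('v \<Rightarrow> 'v) \<Rightarrow> real" where
  "operator_norm X T = (SUP x\<in>{x \<in> vecs X. vnorm X x \<le> 1}. vnorm X (T x))"

definition daugavet_property :: "'v normed_space \<Rightarrow> bool" where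
  "daugavet_property X \<longleftrightarrow>
     (\<forall>T. bounded_operator X T \<and> rank_one X T \<longrightarrow>
        operator_norm X (\<lambda>x. vadd X x (T x)) = 1 + operator_norm X T)"


section \<open>Non-atomic measures and spaces of almost everywhere equivalence classes\<close>

definition nonatomic :: "'a measure \<Rightarrow> bool" where
  "nonatomic M \<longleftrightarrow>
     (\<forall>A\<in>sets M. 0 < emeasure M A \<longrightarrow>
        (\<exists>B\<in>sets M. B \<subseteq> A \<and> 0 < emeasure M B \<and> emeasure M B < emeasure M A))"

definition ae_rel :: "'a measure \<Rightarrow> (('a \<Rightarrow> ereal) \<times> ('a \<Rightarrow> ereal)) set" where
  "ae_rel M = {(f, g). f \<in> borel_measurable M \<and> g \<in> borel_measurable M \<and> (AE t in M. f t = g t)}"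

definition L0 :: "'a measure \<Rightarrow> ('a \<Rightarrow> ereal) set set" where
  "L0 M = borel_measurable M // ae_rel M"

text \<open>
  The normed space of the classes of functions in \<open>F\<close>, a set of measurable functions closed under
  almost everywhere equality, where \<open>N\<close> gives the norm of a class in terms of any representative.
  In the spaces below the functions are finite almost everywhere, so the value of
  \<open>\<infinity> + (- \<infinity>)\<close> does not affect sums of classes.
\<close>

definition class_space ::
  "'a measure \<Rightarrow> ('a \<Rightarrow> ereal) set \<Rightarrow> (('a \<Rightarrow> ereal) \<Rightarrow> real) \<Rightarrow> ('a \<Rightarrow> ereal) set normed_space" where
  "class_space M F N =
     \<lparr> vecs = F // ae_rel M,
       vzero = ae_rel M `` {\<lambda>_. 0},
       vadd = (\<lambda>X Y. \<Union>f\<in>X. \<Union>g\<in>Y. ae_rel M `` {\<lambda>t. f t + g t}),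
       vscale = (\<lambda>c X. \<Union>f\<in>X. ae_rel M `` {\<lambda>t. ereal c * f t}),
       vnorm = (\<lambda>X. the_elem (N ` X)) \<rparr>"

text \<open>The spaces \<open>L\<^sub>1\<close> and \<open>L\<^sub>\<infinity>\<close> with a constant weight \<open>c\<close>, meant for \<open>0 < c < \<infinity>\<close>.\<close>

definition L1_weighted :: "'a measure \<Rightarrow> ennreal \<Rightarrow> ('a \<Rightarrow> ereal) set normed_space" where
  "L1_weighted M c =
     class_space M
       {f \<in> borel_measurable M. (\<integral>\<^sup>+t. e2ennreal \<bar>f t\<bar> \<partial>M) < \<infinity>}
       (\<lambda>f. enn2real (\<integral>\<^sup>+t. c * e2ennreal \<bar>f t\<bar> \<partial>M))"

definition Linf_weighted :: "'a measure \<Rightarrow> ennreal \<Rightarrow> ('a \<Rightarrow> ereal) set normed_space" where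
  "Linf_weighted M c =
     class_space M
       {f \<in> borel_measurable M. esssup M (\<lambda>t. e2ennreal \<bar>f t\<bar>) < \<infinity>}
       (\<lambda>f. enn2real (esssup M (\<lambda>t. c * e2ennreal \<bar>f t\<bar>)))"


section \<open>Orlicz functions\<close>

text \<open>
  A function \<open>[0,\<infinity>) \<rightarrow> [0,\<infinity>]\<close> is represented by a function on all reals whose values at negative
  arguments are irrelevant.
\<close>

definition a_of :: "(real \<Rightarrow> ennreal) \<Rightarrow> ennreal" where
  "a_of \<phi> = Sup {ennreal u | u. 0 \<le> u \<and> \<phi> u = 0}"

definition b_of :: "(real \<Rightarrow> ennreal) \<Rightarrow> ennreal" where
  "b_of \<phi> = Sup {ennreal u | u. 0 < u \<and> \<phi> u < \<infinity>}"

definition orlicz_function :: "(real \<Rightarrow> ennreal) \<Rightarrow> bool" where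
  "orlicz_function \<phi> \<longleftrightarrow>
     (\<exists>u\<ge>0. \<phi> u \<noteq> 0) \<and>
     \<phi> 0 = 0 \<and> (\<phi> \<longlongrightarrow> 0) (at_right 0) \<and>
     (\<forall>u. 0 < u \<and> ennreal u \<le> b_of \<phi> \<longrightarrow> continuous (at_left u) \<phi>) \<and>
     (\<forall>u v s. 0 < u \<and> ennreal u \<le> b_of \<phi> \<and> 0 < v \<and> ennreal v \<le> b_of \<phi> \<and> 0 \<le> s \<and> s \<le> 1 \<longrightarrow>
        \<phi> ((1 - s) * u + s * v) \<le> ennreal (1 - s) * \<phi> u + ennreal s * \<phi> v)"

text \<open>The supremum is never negative, because \<open>\<phi> v\<close> tends to \<open>0\<close> as \<open>v\<close> decreases to \<open>0\<close>.\<close>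

definition complementary :: "(real \<Rightarrow> ennreal) \<Rightarrow> real \<Rightarrow> ennreal" where
  "complementary \<phi> u = e2ennreal (SUP v\<in>{0<..}. ereal (u * v) - enn2ereal (\<phi> v))"


section \<open>Orlicz spaces\<close>

text \<open>An Orlicz function tends to \<open>\<infinity>\<close> at \<open>\<infinity>\<close>, whence the value of the modular's integrand there.\<close>

definition modular :: "'a measure \<Rightarrow> (real \<Rightarrow> ennreal) \<Rightarrow> ('a \<Rightarrow> ereal) \<Rightarrow> ennreal" where
  "modular M \<phi> f = (\<integral>\<^sup>+t. (if \<bar>f t\<bar> = \<infinity> then \<infinity> else \<phi> (real_of_ereal \<bar>f t\<bar>)) \<partial>M)"

definition orlicz_class :: "'a measure \<Rightarrow> (real \<Rightarrow> ennreal) \<Rightarrow> ('a \<Rightarrow> ereal) set" where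
  "orlicz_class M \<phi> =
     {f \<in> borel_measurable M. \<exists>l::real. 0 < l \<and> modular M \<phi> (\<lambda>t. ereal l * f t) < \<infinity>}"

definition luxemburg_norm :: "'a measure \<Rightarrow> (real \<Rightarrow> ennreal) \<Rightarrow> ('a \<Rightarrow> ereal) \<Rightarrow> real" where
  "luxemburg_norm M \<phi> f = Inf {l::real. 0 < l \<and> modular M \<phi> (\<lambda>t. f t / ereal l) \<le> 1}"

text \<open>The Orlicz norm on \<open>L\<^sub>\<psi>\<close> is formed from the modular of the complementary function \<open>\<phi>\<close>.\<close>

definition orlicz_norm :: "'a measure \<Rightarrow> (real \<Rightarrow> ennreal) \<Rightarrow> ('a \<Rightarrow> ereal) \<Rightarrow> real" where
  "orlicz_norm M \<phi> f =
     enn2real (SUP g\<in>{g \<in> borel_measurable M. modular M \<phi> g \<le> 1}. \<integral>\<^sup>+t. e2ennreal \<bar>f t * g t\<bar> \<partial>M)"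

definition L_luxemburg :: "'a measure \<Rightarrow> (real \<Rightarrow> ennreal) \<Rightarrow> ('a \<Rightarrow> ereal) set normed_space" where
  "L_luxemburg M \<phi> = class_space M (orlicz_class M \<phi>) (luxemburg_norm M \<phi>)"

definition L_orlicz ::
  "'a measure \<Rightarrow> (real \<Rightarrow> ennreal) \<Rightarrow> (real \<Rightarrow> ennreal) \<Rightarrow> ('a \<Rightarrow> ereal) set normed_space" where
  "L_orlicz M \<phi> \<psi> = class_space M (orlicz_class M \<psi>) (orlicz_norm M \<phi>)"

end

theory Submission
  imports Defs
begin

text \<open>
  Both function spaces have the Daugavet property exactly when \<open>\<phi>\<close> has one of two shapes. Either
  \<open>\<phi>\<close> is linear, \<open>\<phi> u = c * u\<close> (\<open>linear_type\<close>), so that the unit ball of the modular is that of a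
  weighted \<open>L\<^sub>1\<close>; or \<open>\<phi>\<close> jumps to \<open>\<infinity>\<close> behind \<open>\<beta> = b_of \<phi>\<close> before its modular can exceed \<open>1\<close>,
  i.e. \<open>\<phi> \<beta> * \<mu>(\<Omega>) \<le> 1\<close> (\<open>bounded_type\<close>), so that the unit ball is that of a weighted
  \<open>L\<^sub>\<infinity>\<close>. All four conditions of the theorem are compared with this dichotomy.

  Necessity. Let \<open>P\<close> be the averaging projection \<open>u \<mapsto> avg\<^sub>A u * \<one>\<^sub>A\<close> over a set \<open>A\<close> of finite
  measure. Since \<open>P\<close> has norm at least one, the Daugavet equation for \<open>- P\<close> gives \<open>u\<close> in the unit
  ball for which \<open>u - P u\<close> has norm almost \<open>2\<close> (\<open>daugavet_averaging\<close>). For the Luxemburg norm this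
  says that some \<open>y\<close> with modular at most \<open>1\<close> has \<open>(y - P y) / (2 - e)\<close> with modular above \<open>1\<close>. For the
  Orlicz norm the same holds, because \<open>P\<close> is self-adjoint and hence the norm of \<open>u - P u\<close> is
  tested against \<open>y - P y\<close> (\<open>orl_daugavet_imp_linear\<close>). If \<open>\<phi>\<close> is not of bounded type, \<open>A\<close> and \<open>k\<close>
  can be chosen with \<open>k < b_of \<phi>\<close> and \<open>\<phi> k * \<mu>(A) = 1\<close> (\<open>level_set_exists\<close>). Convexity then
  makes the modular of \<open>(y - P y) / (2 - e)\<close> lose a definite amount wherever \<open>y\<close> is positive; so
  \<open>y\<close>, whose average is almost \<open>k\<close>, must carry it by huge values on a tiny set. There \<open>\<phi>\<close> costs
  as much as its slope at infinity, while the budget is \<open>1\<close>: the slope at infinity does not exceed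
  \<open>\<phi> k / k\<close>, and a convex function vanishing at \<open>0\<close> with this property is linear
  (\<open>deviation_from_average\<close>, \<open>linear_if_deviation_large\<close>).

  Sufficiency. The Daugavet property of \<open>L\<^sub>1\<close> and \<open>L\<^sub>\<infinity>\<close> is proved for an arbitrary bounded
  functional, without a representation of the dual. In \<open>L\<^sub>1\<close> a function can be replaced by a
  normalized restriction to a smaller set on which the functional is at least as large, and
  repeated halving makes it almost disjoint from the given direction \<open>e\<close> (\<open>daugavet_L1\<close>). In
  \<open>L\<^sub>\<infinity>\<close> one changes the function to a constant of norm one on a small set where \<open>\<bar>e\<bar>\<close> is nearly
  maximal; the functional hardly notices, since it cannot be large on many disjoint pieces
  (\<open>daugavet_Linf\<close>).

  Equalities of spaces. Equality with a weighted \<open>L\<^sub>1\<close> or \<open>L\<^sub>\<infinity>\<close> determines the norms of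
  indicator functions, and these already force the shape of \<open>\<phi>\<close>
  (\<open>linear_typeI_pointwise\<close>, \<open>bounded_typeI_pointwise\<close>).

  Classes of extended-real functions are handled through real-valued representatives, which exist
  because members of the spaces are finite almost everywhere (locale \<open>ae_space\<close>).
\<close>

section \<open>Preliminaries\<close>

lemma ennreal_mult_le_1_iff:
  fixes x y :: ennreal
  assumes "y \<noteq> 0"
  shows "x * y \<le> 1 \<longleftrightarrow> x \<le> 1 / y"
proof (cases y)
  case (real r)
  with assms have r: "0 < r" by (cases "r = 0") auto
  then have y: "1 / y = ennreal (1 / r)"
    unfolding real(2) ennreal_1[symmetric] by (intro divide_ennreal) auto
  show ?thesis
  proof (cases x)
    case (real a)
    then have "x * y = ennreal (a * r)" using \<open>y = ennreal r\<close> r by (simp add: ennreal_mult)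
    then have "x * y \<le> 1 \<longleftrightarrow> a * r \<le> 1" using real r by simp
    also have "\<dots> \<longleftrightarrow> a \<le> 1 / r" using r by (simp add: field_simps)
    also have "\<dots> \<longleftrightarrow> x \<le> 1 / y" unfolding y using real r by simp
    finally show ?thesis .
  qed (use assms in \<open>auto simp: y ennreal_top_mult top_unique\<close>)
next
  case top
  then show ?thesis by (cases "x = 0") (auto simp: ennreal_mult_top top_unique)
qed

lemma set_integral_bounds:
  assumes A [measurable]: "A \<in> sets M" and y [measurable]: "y \<in> borel_measurable M"
    and le: "(\<integral>\<^sup>+t. ennreal \<bar>y t\<bar> * indicator A t \<partial>M) \<le> ennreal B" and B: "0 \<le> B"
  shows "set_integrable M A y" "\<bar>LINT t:A|M. y t\<bar> \<le> B"
    "ennreal (LINT t:A|M. y t) \<le> (\<integral>\<^sup>+t. ennreal (y t) * indicator A t \<partial>M)"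
proof -
  let ?f = "\<lambda>t. indicator A t * y t"
  have eq: "(\<integral>\<^sup>+t. ennreal \<bar>?f t\<bar> \<partial>M) = (\<integral>\<^sup>+t. ennreal \<bar>y t\<bar> * indicator A t \<partial>M)"
    by (intro nn_integral_cong) (auto simp: indicator_def)
  have "(\<integral>\<^sup>+t. ennreal \<bar>?f t\<bar> \<partial>M) < \<infinity>"
    unfolding eq using le by (auto intro: le_less_trans)
  then have int: "integrable M ?f"
    by (intro integrableI_bounded) auto
  then show "set_integrable M A y" by (simp add: set_integrable_def)
  have "ennreal \<bar>LINT t:A|M. y t\<bar> \<le> (\<integral>\<^sup>+t. ennreal \<bar>?f t\<bar> \<partial>M)"
    using integral_norm_bound_ennreal[OF int] by (simp add: set_lebesgue_integral_def)
  also have "\<dots> \<le> ennreal B" unfolding eq by (rule le)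
  finally show "\<bar>LINT t:A|M. y t\<bar> \<le> B" using B by simp
  have "(LINT t:A|M. y t) \<le> (\<integral>t. max 0 (?f t) \<partial>M)"
    unfolding set_lebesgue_integral_def using int by (intro integral_mono) auto
  then have "ennreal (LINT t:A|M. y t) \<le> ennreal (\<integral>t. max 0 (?f t) \<partial>M)" by (rule ennreal_leI)
  also have "\<dots> = (\<integral>\<^sup>+t. ennreal (max 0 (?f t)) \<partial>M)"
    using int by (intro nn_integral_eq_integral[symmetric]) auto
  also have "\<dots> = (\<integral>\<^sup>+t. ennreal (y t) * indicator A t \<partial>M)"
    by (intro nn_integral_cong) (auto simp: indicator_def max_def ennreal_neg)
  finally show "ennreal (LINT t:A|M. y t) \<le> (\<integral>\<^sup>+t. ennreal (y t) * indicator A t \<partial>M)" .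
qed

lemma (in sigma_finite_measure) finite_subset_large:
  assumes B: "B \<in> sets M" "r < emeasure M B"
  obtains A where "A \<in> sets M" "A \<subseteq> B" "emeasure M A < \<infinity>" "r < emeasure M A"
proof -
  obtain S :: "nat \<Rightarrow> 'a set" where S: "range S \<subseteq> sets M" "(\<Union>i. S i) = space M"
    "\<And>i. emeasure M (S i) \<noteq> \<infinity>" "incseq S"
    using sigma_finite_incseq by blast
  have "(SUP i. emeasure M (B \<inter> S i)) = emeasure M (\<Union>i. B \<inter> S i)"
  proof (rule SUP_emeasure_incseq)
    show "incseq (\<lambda>i. B \<inter> S i)" using S(4) by (fastforce simp: incseq_def)
  qed (use S(1) B(1) in auto)
  also have "(\<Union>i. B \<inter> S i) = B" using S(2) sets.sets_into_space[OF B(1)] by blast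
  finally have "r < (SUP i. emeasure M (B \<inter> S i))" using B by simp
  then obtain i where "r < emeasure M (B \<inter> S i)" by (auto simp: less_SUP_iff)
  moreover have "emeasure M (B \<inter> S i) \<le> emeasure M (S i)"
    using S(1) B(1) by (intro emeasure_mono) auto
  moreover have "emeasure M (S i) < \<infinity>" using S(3) by (simp add: less_top)
  moreover have "B \<inter> S i \<in> sets M" using S(1) B(1) by auto
  ultimately show ?thesis by (intro that[of "B \<inter> S i"]) auto
qed

lemma one_divide_ennreal: "0 < x \<Longrightarrow> 1 / ennreal x = ennreal (1 / x)"
  unfolding ennreal_1[symmetric] by (intro divide_ennreal) auto

lemma ennreal_pos_finite_cases:
  assumes "0 < x" "x < (\<infinity>::ennreal)"
  obtains c where "x = ennreal c" "0 < c"
  using assms by (cases x) auto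

lemma one_divide_pos_finite_cases:
  assumes "0 < 1 / x" "1 / x < (\<infinity>::ennreal)"
  obtains c where "x = ennreal c" "0 < c"
proof (cases x)
  case (real c)
  then have "c \<noteq> 0" using assms(2) by auto
  then show ?thesis using that real by auto
next
  case top
  then show ?thesis using assms(1) by simp
qed

lemma eq_if_same_upper_bounds:
  fixes x y :: real
  assumes "0 \<le> x" "0 \<le> y" "\<And>C. 0 \<le> C \<Longrightarrow> x \<le> C \<longleftrightarrow> y \<le> C"
  shows "x = y"
  using assms(3)[of x] assms(3)[of y] assms(1,2) by simp

lemma Inf_positive_above:
  fixes x :: real
  assumes "0 \<le> x"
  shows "Inf {l. 0 < l \<and> x \<le> l} = x"
proof (cases "x = 0")
  case True
  then have "{l. 0 < l \<and> x \<le> l} = {0<..}" by auto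
  then show ?thesis using True by simp
next
  case False
  with assms have "{l. 0 < l \<and> x \<le> l} = {x..}" by (auto intro: less_le_trans)
  then show ?thesis by (simp only:) simp
qed

lemma AE_le_if_all_above:
  fixes f :: "'a \<Rightarrow> real"
  assumes "\<And>d. 0 < d \<Longrightarrow> AE t in M. f t \<le> C + d"
  shows "AE t in M. f t \<le> C"
proof -
  have "AE t in M. \<forall>n. f t \<le> C + 1 / real (Suc n)"
    unfolding AE_all_countable using assms by simp
  then show ?thesis
  proof eventually_elim
    case (elim t)
    have "(\<lambda>n. C + 1 / real (Suc n)) \<longlonglongrightarrow> C + 0"
      by (intro tendsto_add tendsto_const LIMSEQ_Suc[OF lim_1_over_n])
    then show ?case using elim by (intro LIMSEQ_le_const[of _ C]) auto
  qed
qed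

section \<open>Nonatomic measures\<close>

lemma nonatomic_split:
  assumes "nonatomic M" "A \<in> sets M" "0 < emeasure M A"
  obtains B where "B \<in> sets M" "B \<subseteq> A" "0 < emeasure M B" "0 < emeasure M (A - B)"
proof -
  obtain B where B: "B \<in> sets M" "B \<subseteq> A" "0 < emeasure M B" "emeasure M B < emeasure M A"
    using assms unfolding nonatomic_def by blast
  have "emeasure M (A - B) \<noteq> 0"
  proof
    assume 0: "emeasure M (A - B) = 0"
    have "emeasure M A = emeasure M (B \<union> (A - B))" using B by (simp add: Un_absorb1)
    also have "\<dots> \<le> emeasure M B + emeasure M (A - B)"
      using B assms by (intro emeasure_subadditive) auto
    finally show False using B 0 by simp
  qed
  then show ?thesis using that B by (simp add: zero_less_iff_neq_zero)
qed

lemma nonatomic_small_subset: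
  assumes na: "nonatomic M" and A: "A \<in> sets M" "emeasure M A < \<infinity>" "0 < measure M A"
  shows "\<exists>B\<in>sets M. B \<subseteq> A \<and> 0 < measure M B \<and> measure M B \<le> measure M A / 2 ^ n"
proof (induction n)
  case 0
  show ?case using A by (intro bexI[of _ A]) auto
next
  case (Suc n)
  then obtain B where B: "B \<in> sets M" "B \<subseteq> A" "0 < measure M B" "measure M B \<le> measure M A / 2 ^ n"
    by blast
  have fin: "emeasure M C \<noteq> \<infinity>" if "C \<subseteq> A" for C
    using emeasure_mono[OF that A(1)] A(2) by (auto simp: top_unique)
  have pos: "0 < measure M C \<longleftrightarrow> 0 < emeasure M C" if "C \<subseteq> A" for C
    using fin[OF that] by (simp add: emeasure_eq_ennreal_measure)
  from nonatomic_split[OF na B(1)] pos B obtain C where C: "C \<in> sets M" "C \<subseteq> B"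
    "0 < emeasure M C" "0 < emeasure M (B - C)" by blast
  have sum: "measure M (B - C) = measure M B - measure M C"
    using B C fin[OF B(2)] by (intro measure_Diff) auto
  define D where "D = (if measure M C \<le> measure M (B - C) then C else B - C)"
  have "D \<in> sets M" "D \<subseteq> A" "0 < emeasure M D" using B C by (auto simp: D_def)
  then have "D \<in> sets M" "D \<subseteq> A" "0 < measure M D" using pos by auto
  moreover have "measure M D \<le> measure M A / 2 ^ Suc n" using sum B(4) by (auto simp: D_def)
  ultimately show ?case by blast
qed

text \<open>
  A nonatomic finite measure attains all values below the measure of a set. The set is exhausted
  greedily: each step adds a piece with at least half of the largest measure that still fits. If
  the union stayed below \<open>t\<close>, a small leftover piece would have fitted at every step, so every
  step would have added at least half its measure.
\<close>

lemma (in finite_measure) nonatomic_intermediate_value: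
  assumes na: "nonatomic M" and A: "A \<in> sets M" and t: "0 \<le> t" "t \<le> measure M A"
  shows "\<exists>B\<in>sets M. B \<subseteq> A \<and> measure M B = t"
proof -
  \<comment> \<open>The pieces that may still be added to \<open>C\<close>.\<close>
  define \<D> where "\<D> C = {D \<in> sets M. D \<subseteq> A - C \<and> measure M C + measure M D \<le> t}" for C
  define good where "good C D \<longleftrightarrow> D \<in> \<D> C \<and> (\<forall>D'\<in>\<D> C. measure M D' \<le> 2 * measure M D)" for C D
  have good_ex: "\<exists>D. good C D" if C: "measure M C \<le> t" for C
  proof -
    have e: "{} \<in> \<D> C" using C by (simp add: \<D>_def)
    have bdd: "bdd_above (measure M ` \<D> C)"
      by (rule bdd_aboveI2[of _ _ "measure M (space M)"]) (rule bounded_measure)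
    define s where "s = (SUP D\<in>\<D> C. measure M D)"
    have le: "measure M D \<le> s" if "D \<in> \<D> C" for D
      unfolding s_def using that bdd by (rule cSUP_upper)
    show ?thesis
    proof (cases "s \<le> 0")
      case True
      then have "good C {}" using e le unfolding good_def by fastforce
      then show ?thesis by blast
    next
      case False
      then have "s / 2 < (SUP D\<in>\<D> C. measure M D)" by (simp add: s_def[symmetric])
      then obtain D where "D \<in> \<D> C" "s / 2 < measure M D"
        using less_cSUP_iff[OF _ bdd] e by blast
      then have "good C D" using le unfolding good_def by fastforce
      then show ?thesis by blast
    qed
  qed
  define pick where "pick C = (SOME D. good C D)" for C
  have pick: "good C (pick C)" if "measure M C \<le> t" for C
    unfolding pick_def using good_ex[OF that] by (rule someI_ex)
  define S where "S = rec_nat {} (\<lambda>_ C. C \<union> pick C)"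
  have S0: "S 0 = {}" and SSuc: "S (Suc n) = S n \<union> pick (S n)" for n by (simp_all add: S_def)
  have S: "S n \<in> sets M \<and> S n \<subseteq> A \<and> measure M (S n) \<le> t" for n
  proof (induction n)
    case (Suc n)
    then have p: "pick (S n) \<in> \<D> (S n)" using pick good_def by blast
    then have "measure M (S n \<union> pick (S n)) = measure M (S n) + measure M (pick (S n))"
      using Suc by (intro finite_measure_Union) (auto simp: \<D>_def)
    then show ?case using Suc p by (auto simp: SSuc \<D>_def)
  qed (use t S0 in simp)
  have grow: "measure M (S (Suc n)) = measure M (S n) + measure M (pick (S n))" for n
  proof -
    have "pick (S n) \<in> \<D> (S n)" using pick S good_def by blast
    then show ?thesis unfolding SSuc using S[of n] by (intro finite_measure_Union) (auto simp: \<D>_def)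
  qed
  define C where "C = (\<Union>n. S n)"
  have C: "C \<in> sets M" "C \<subseteq> A" using S by (auto simp: C_def)
  have "incseq S" by (rule incseq_SucI) (auto simp: SSuc)
  then have lim: "(\<lambda>n. measure M (S n)) \<longlonglongrightarrow> measure M C"
    unfolding C_def using S by (intro finite_Lim_measure_incseq) auto
  then have le: "measure M C \<le> t" using S by (intro LIMSEQ_le_const2) auto
  have "measure M C = t"
  proof (rule ccontr)
    assume "measure M C \<noteq> t"
    with le have lt: "measure M C < t" by simp
    have diff: "measure M (A - C) = measure M A - measure M C"
      using C A by (intro finite_measure_Diff) auto
    then have pos: "0 < measure M (A - C)" using lt t by simp
    obtain n where n: "measure M (A - C) / (t - measure M C) < 2 ^ n"
      using real_arch_pow[of 2] by fastforce
    have AC: "A - C \<in> sets M" using A C by simp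
    have fin: "emeasure M (A - C) < \<infinity>" by (simp add: emeasure_eq_measure)
    from nonatomic_small_subset[OF na AC fin pos, of n] obtain D
      where D: "D \<in> sets M" "D \<subseteq> A - C" "0 < measure M D" "measure M D \<le> measure M (A - C) / 2 ^ n"
      by blast
    have "measure M (A - C) / 2 ^ n \<le> t - measure M C"
      using n lt by (simp add: field_simps)
    then have Dt: "measure M C + measure M D \<le> t" using D by simp
    have "measure M D \<le> 2 * measure M (pick (S n))" for n
    proof -
      have "measure M (S n) \<le> measure M C"
        using C by (intro finite_measure_mono) (auto simp: C_def)
      then have "D \<in> \<D> (S n)" using D Dt by (auto simp: \<D>_def C_def)
      then show ?thesis using pick[of "S n"] S[of n] by (simp add: good_def)
    qed
    then have "real n * (measure M D / 2) \<le> measure M (S n)" for n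
    proof (induction n)
      case (Suc n)
      then show ?case using Suc.prems[of n] by (simp add: grow algebra_simps) (smt (verit) field_sum_of_halves)
    qed simp
    then have "real n * (measure M D / 2) \<le> t" for n using S[of n] by (meson order_trans)
    moreover obtain n where "t < real n * (measure M D / 2)"
      using reals_Archimedean3[of "measure M D / 2"] D by auto
    ultimately show False by (meson not_le)
  qed
  with C show ?thesis by blast
qed

text \<open>
  The intermediate value theorem is applied to the measure with density \<open>\<bar>e\<bar>\<close>, which inherits
  nonatomicity: on the set where \<open>e\<close> does not vanish it has the same null sets as \<open>M\<close>.
\<close>

lemma halve_integral:
  fixes e :: "'a \<Rightarrow> real"
  assumes na: "nonatomic M" and e: "integrable M e" and A: "A \<in> sets M"
  obtains B where "B \<in> sets M" "B \<subseteq> A" "(LINT t:B|M. \<bar>e t\<bar>) = (LINT t:A|M. \<bar>e t\<bar>) / 2"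
proof -
  have [measurable]: "e \<in> borel_measurable M" using e by simp
  define D where "D = density M (\<lambda>t. ennreal \<bar>e t\<bar>)"
  have sets_D [simp]: "sets D = sets M" by (simp add: D_def)
  have em: "emeasure D B = ennreal (LINT t:B|M. \<bar>e t\<bar>)" if [measurable]: "B \<in> sets M" for B
  proof -
    have "emeasure D B = (\<integral>\<^sup>+t. ennreal \<bar>e t\<bar> * indicator B t \<partial>M)"
      unfolding D_def by (rule emeasure_density) measurable
    also have "\<dots> = (\<integral>\<^sup>+t. ennreal (indicator B t * \<bar>e t\<bar>) \<partial>M)"
      by (intro nn_integral_cong) (auto simp: indicator_def)
    also have "\<dots> = ennreal (\<integral>t. indicator B t * \<bar>e t\<bar> \<partial>M)"
    proof (rule nn_integral_eq_integral)
      show "integrable M (\<lambda>t. indicator B t * \<bar>e t\<bar>)"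
        using integrable_real_mult_indicator[OF that integrable_abs[OF e]] by (simp add: mult.commute)
    qed auto
    finally show ?thesis by (simp add: set_lebesgue_integral_def)
  qed
  interpret D: finite_measure D
  proof (rule finite_measureI)
    have "space D = space M" by (simp add: D_def)
    then show "emeasure D (space D) \<noteq> \<infinity>" using em[OF sets.top] by simp
  qed
  have meas: "measure D B = (LINT t:B|M. \<bar>e t\<bar>)" if "B \<in> sets M" for B
  proof -
    have "0 \<le> (LINT t:B|M. \<bar>e t\<bar>)" unfolding set_lebesgue_integral_def by simp
    then show ?thesis using em[OF that] by (simp add: measure_def)
  qed
  have "nonatomic D"
    unfolding nonatomic_def
  proof (intro ballI impI)
    fix C assume C: "C \<in> sets D" "0 < emeasure D C"
    define E where "E = C \<inter> {t \<in> space M. e t \<noteq> 0}"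
    have E: "E \<in> sets M" using C by (simp add: E_def)
    have null: "emeasure D G = 0 \<longleftrightarrow> emeasure M G = 0" if G: "G \<in> sets M" "G \<subseteq> E" for G
    proof -
      have "G \<in> null_sets D \<longleftrightarrow> (AE t in M. t \<in> G \<longrightarrow> ennreal \<bar>e t\<bar> = 0)"
        unfolding D_def using G by (subst null_sets_density_iff) auto
      also have "\<dots> \<longleftrightarrow> (AE t in M. t \<notin> G)"
        using G by (intro AE_cong) (auto simp: E_def)
      also have "\<dots> \<longleftrightarrow> emeasure M G = 0"
        using AE_iff_measurable[OF G(1), of "\<lambda>t. t \<notin> G"] sets.sets_into_space[OF G(1)] by auto
      finally show ?thesis using G by (simp add: null_sets_def)
    qed
    have "C - E \<in> null_sets D"
      unfolding D_def using C by (subst null_sets_density_iff) (auto simp: E_def)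
    then have DE: "emeasure D E = emeasure D C"
      using C E by (subst emeasure_Diff_null_set[symmetric, of "C - E" D C]) (auto simp: E_def intro!: arg_cong[where f = "emeasure D"])
    then have "0 < emeasure M E" using null[OF E] C by (auto simp: zero_less_iff_neq_zero)
    from nonatomic_split[OF na E this] obtain B where B: "B \<in> sets M" "B \<subseteq> E"
      "0 < emeasure M B" "0 < emeasure M (E - B)" .
    have "0 < emeasure D B" using null[of B] B by (simp add: zero_less_iff_neq_zero)
    moreover have "0 < emeasure D (E - B)" using null[of "E - B"] B E by (auto simp: zero_less_iff_neq_zero)
    then have "emeasure D B < emeasure D C"
      using B E DE D.finite_measure_Diff[of E B] by (simp add: D.emeasure_eq_measure ennreal_less_iff)
    moreover have "B \<subseteq> C" using B by (auto simp: E_def)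
    ultimately show "\<exists>B\<in>sets D. B \<subseteq> C \<and> 0 < emeasure D B \<and> emeasure D B < emeasure D C"
      using B by auto
  qed
  then obtain B where "B \<in> sets D" "B \<subseteq> A" "measure D B = measure D A / 2"
    using D.nonatomic_intermediate_value[of A "measure D A / 2"] A by auto
  then show ?thesis using that[of B] A by (simp add: meas)
qed

section \<open>Orlicz functions\<close>

text \<open>
  The super-level sets of a function increasing on the half-line are intervals.
\<close>

lemma borel_measurable_mono_abs:
  fixes \<omega> :: "real \<Rightarrow> ennreal"
  assumes mono: "\<And>u v. 0 \<le> u \<Longrightarrow> u \<le> v \<Longrightarrow> \<omega> u \<le> \<omega> v" and f: "f \<in> borel_measurable M"
  shows "(\<lambda>t. \<omega> \<bar>f t\<bar>) \<in> borel_measurable M"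
proof -
  have "(\<lambda>u. \<omega> (max 0 u)) \<in> borel_measurable borel"
  proof (rule borel_measurableI_greater)
    fix y
    have "is_interval {u. y < \<omega> (max 0 u)}"
      unfolding is_interval_1 using mono
      by (smt (verit) mem_Collect_eq order_less_le_trans)
    then show "{u \<in> space borel. y < \<omega> (max 0 u)} \<in> sets borel"
      using real_interval_borel_measurable by simp
  qed
  moreover have "(\<lambda>t. \<bar>f t\<bar>) \<in> borel_measurable M" using f by measurable
  ultimately have "(\<lambda>t. \<omega> (max 0 \<bar>f t\<bar>)) \<in> borel_measurable M" by (rule measurable_compose[rotated])
  then show ?thesis by simp
qed

locale orlicz =
  fixes \<phi> :: "real \<Rightarrow> ennreal"
  assumes orlicz: "orlicz_function \<phi>"
begin

lemma phi_0 [simp]: "\<phi> 0 = 0"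
  using orlicz by (simp add: orlicz_function_def)

lemma phi_tendsto_0: "(\<phi> \<longlongrightarrow> 0) (at_right 0)"
  using orlicz by (simp add: orlicz_function_def)

lemma phi_eq_top_above_b:
  assumes "b_of \<phi> < ennreal u"
  shows "\<phi> u = \<infinity>"
proof (rule ccontr)
  assume "\<phi> u \<noteq> \<infinity>"
  moreover have "0 < u" using assms by (metis ennreal_neg not_less not_less_zero)
  ultimately have "ennreal u \<le> b_of \<phi>"
    unfolding b_of_def by (intro Sup_upper) (auto simp: less_top)
  with assms show False by simp
qed

text \<open>
  Convexity with \<open>0\<close> as one end point. It is assumed only for positive arguments, so \<open>0\<close> is
  approached by positive \<open>w\<close>, using that \<open>\<phi> w\<close> tends to \<open>0\<close>. Monotonicity, full convexity and
  the comparison of slopes all follow from this inequality.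
\<close>

lemma phi_scale:
  assumes s: "0 \<le> s" "s \<le> 1" and u: "0 \<le> u"
  shows "\<phi> (s * u) \<le> ennreal s * \<phi> u"
proof -
  consider "s = 0 \<or> u = 0" | "s = 1" | "\<phi> u = \<infinity>" "0 < s" | "0 < s" "s < 1" "0 < u" "\<phi> u < \<infinity>"
    using s u by (fastforce simp: less_top)
  then show ?thesis
  proof cases
    case 3 then show ?thesis by (simp add: ennreal_mult_top)
  next
    case 4
    have ub: "ennreal u \<le> b_of \<phi>" using phi_eq_top_above_b 4 by (metis less_irrefl not_le)
    have su: "0 < s * u" "s * u < u" using 4 by auto
    have "eventually (\<lambda>w. \<phi> (s * u) \<le> \<phi> w + ennreal s * \<phi> u) (at_right 0)"
      using eventually_at_right_real[OF su(1)]
    proof eventually_elim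
      case (elim w)
      \<comment> \<open>The weight that writes \<open>s * u\<close> as a convex combination of \<open>w\<close> and \<open>u\<close>.\<close>
      define r where "r = (s * u - w) / (u - w)"
      have w: "0 < w" "w < s * u" "w < u" using elim su by auto
      have r: "0 \<le> r" "r \<le> s" "r \<le> 1"
        using w s 4 by (auto simp: r_def field_simps intro: mult_left_le)
      have "s * u = (1 - r) * w + r * u"
      proof -
        have "r * (u - w) = s * u - w" using w by (simp add: r_def)
        then show ?thesis by (simp add: algebra_simps)
      qed
      moreover have "ennreal w \<le> b_of \<phi>" using ub w by (meson ennreal_leI less_imp_le order_trans)
      ultimately have "\<phi> (s * u) \<le> ennreal (1 - r) * \<phi> w + ennreal r * \<phi> u"
        using orlicz w r 4 ub unfolding orlicz_function_def by presburger
      also have "\<dots> \<le> 1 * \<phi> w + ennreal s * \<phi> u"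
        using r by (intro add_mono mult_right_mono) auto
      finally show ?case by simp
    qed
    moreover have "((\<lambda>w. \<phi> w + ennreal s * \<phi> u) \<longlongrightarrow> 0 + ennreal s * \<phi> u) (at_right 0)"
      by (intro tendsto_add phi_tendsto_0 tendsto_const)
    ultimately show ?thesis
      by (intro tendsto_lowerbound[where F = "at_right 0"]) auto
  qed auto
qed

lemma phi_mono:
  assumes "0 \<le> u" "u \<le> v"
  shows "\<phi> u \<le> \<phi> v"
proof (cases "v = 0")
  case False
  then have "\<phi> ((u / v) * v) \<le> ennreal (u / v) * \<phi> v"
    using assms by (intro phi_scale) auto
  also have "\<dots> \<le> 1 * \<phi> v"
    using assms False by (intro mult_right_mono) auto
  finally show ?thesis using False by simp
qed (use assms in auto)

lemma phi_convex:
  assumes s: "0 \<le> s" "0 \<le> s'" "s + s' = 1" and uv: "0 \<le> u" "0 \<le> v"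
  shows "\<phi> (s * u + s' * v) \<le> ennreal s * \<phi> u + ennreal s' * \<phi> v"
proof -
  consider "s = 0" | "s' = 0" | "u = 0" | "v = 0" |
    "0 < s" "0 < s'" "0 < u" "0 < v" "\<phi> u = \<infinity> \<or> \<phi> v = \<infinity>" |
    "0 < u" "0 < v" "\<phi> u < \<infinity>" "\<phi> v < \<infinity>"
    using s(1,2) uv unfolding infinity_ennreal_def less_top[symmetric] by (metis less_eq_real_def)
  then show ?thesis
  proof cases
    case 1 then show ?thesis using s by simp
  next
    case 2 then show ?thesis using s by simp
  next
    case 3 then show ?thesis using phi_scale[of s' v] s uv by simp
  next
    case 4 then show ?thesis using phi_scale[of s u] s uv by simp
  next
    case 5 then show ?thesis by (auto simp: ennreal_mult_top)
  next
    case 6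
    then have "ennreal u \<le> b_of \<phi>" "ennreal v \<le> b_of \<phi>"
      using phi_eq_top_above_b by (metis less_irrefl not_le)+
    then have "\<phi> ((1 - s') * u + s' * v) \<le> ennreal (1 - s') * \<phi> u + ennreal s' * \<phi> v"
      using orlicz 6 s unfolding orlicz_function_def by auto
    moreover have "1 - s' = s" using s by simp
    ultimately show ?thesis by simp
  qed
qed

lemma phi_finite_below_b:
  assumes "ennreal u < b_of \<phi>" "0 \<le> u"
  shows "\<phi> u < \<infinity>"
proof -
  obtain v where "0 < v" "\<phi> v < \<infinity>" "ennreal u < ennreal v"
    using assms(1) unfolding b_of_def less_Sup_iff by auto
  then show ?thesis using phi_mono[of u v] assms(2)
    by (metis ennreal_less_iff le_less_trans less_imp_le)
qed

text \<open>
  Lower semicontinuity from the left. Below \<open>b_of \<phi>\<close> it is the assumed left continuity; behind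
  \<open>b_of \<phi>\<close> the hypothesis fails, since \<open>\<phi>\<close> is already infinite slightly before \<open>u\<close>.
\<close>

lemma phi_le_from_left:
  assumes u: "0 < u" and le: "\<And>v. 0 < v \<Longrightarrow> v < u \<Longrightarrow> \<phi> v \<le> r" and r: "r < \<infinity>"
  shows "\<phi> u \<le> r"
proof (cases "ennreal u \<le> b_of \<phi>")
  case True
  then have "(\<phi> \<longlongrightarrow> \<phi> u) (at_left u)"
    using orlicz u by (simp add: orlicz_function_def continuous_within)
  moreover have "eventually (\<lambda>v. \<phi> v \<le> r) (at_left u)"
    using eventually_at_left_real[OF u] by eventually_elim (use le in auto)
  ultimately show ?thesis
    by (intro tendsto_upperbound[where F = "at_left u"]) auto
next
  case False
  then have "b_of \<phi> < ennreal u" by simp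
  then obtain z where z: "b_of \<phi> < z" "z < ennreal u" using dense by blast
  then obtain v where v: "z = ennreal v" "0 \<le> v"
    by (metis ennreal_cases ennreal_less_top less_asym infinity_ennreal_def)
  then have "v < u" using z by (simp add: ennreal_less_iff)
  moreover have "0 < v" using z v by (metis less_le not_less_zero ennreal_0)
  ultimately have "\<phi> v \<le> r" using le by simp
  then show ?thesis using phi_eq_top_above_b[of v] z v r by auto
qed

lemma phi_pos_point: "\<exists>u>0. 0 < \<phi> u"
proof -
  obtain u where u: "u \<ge> 0" "\<phi> u \<noteq> 0"
    using orlicz unfolding orlicz_function_def by blast
  then have "u \<noteq> 0" by auto
  with u show ?thesis by (intro exI[of _ u]) (auto simp: zero_less_iff_neq_zero)
qed

lemma b_of_pos: "0 < b_of \<phi>"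
proof -
  have "eventually (\<lambda>w. \<phi> w < 1) (at_right 0)"
    using phi_tendsto_0 by (rule order_tendstoD) simp
  moreover have "eventually (\<lambda>w::real. 0 < w) (at_right 0)"
    by (simp add: eventually_at_right_less)
  ultimately have "eventually (\<lambda>w. \<phi> w < 1 \<and> 0 < w) (at_right 0)"
    by (rule eventually_conj)
  then obtain w where w: "\<phi> w < 1" "0 < w"
    using eventually_happens by force
  then have "ennreal w \<le> b_of \<phi>"
    unfolding b_of_def by (intro Sup_upper) (auto intro: less_trans[OF _ ennreal_one_less_top])
  then show ?thesis using w by (metis ennreal_less_zero_iff order_less_le_trans)
qed

lemma measurable_phi_abs [measurable (raw)]:
  "f \<in> borel_measurable M \<Longrightarrow> (\<lambda>t. \<phi> \<bar>f t\<bar>) \<in> borel_measurable M"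
  by (rule borel_measurable_mono_abs[where \<omega> = \<phi>, OF phi_mono])

end

section \<open>Modulars, averages and linear Orlicz functions\<close>

text \<open>
  The modular on real-valued functions, where the convention for infinite values is void.
\<close>

definition real_modular :: "'a measure \<Rightarrow> (real \<Rightarrow> ennreal) \<Rightarrow> ('a \<Rightarrow> real) \<Rightarrow> ennreal" where
  "real_modular M \<phi> f = (\<integral>\<^sup>+t. \<phi> \<bar>f t\<bar> \<partial>M)"

context orlicz
begin

lemma finite_point_above:
  assumes "ennreal k < b_of \<phi>" "0 \<le> k"
  obtains \<beta> where "k < \<beta>" "\<phi> \<beta> < \<infinity>"
proof -
  obtain v where "0 < v" "\<phi> v < \<infinity>" "ennreal k < ennreal v"
    using assms(1) unfolding b_of_def less_Sup_iff by auto
  moreover from this have "k < v" using assms(2) by (simp add: ennreal_less_iff)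
  ultimately show ?thesis using that by blast
qed

lemma convex_on_phi:
  assumes "\<phi> \<beta> < \<infinity>"
  shows "convex_on {0..\<beta>} (\<lambda>u. enn2real (\<phi> u))"
proof (rule convex_onI)
  fix s x y :: real
  assume s: "0 < s" "s < 1" and xy: "x \<in> {0..\<beta>}" "y \<in> {0..\<beta>}"
  then have fin: "\<phi> x < \<infinity>" "\<phi> y < \<infinity>"
    using phi_mono[of x \<beta>] phi_mono[of y \<beta>] assms by (auto intro: le_less_trans)
  have "\<phi> ((1 - s) * x + s * y) \<le> ennreal (1 - s) * \<phi> x + ennreal s * \<phi> y"
    using s xy by (intro phi_convex) auto
  also have "\<dots> = ennreal ((1 - s) * enn2real (\<phi> x) + s * enn2real (\<phi> y))"
    using fin s by (simp add: ennreal_plus ennreal_mult)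
  finally have "enn2real (\<phi> ((1 - s) * x + s * y)) \<le> (1 - s) * enn2real (\<phi> x) + s * enn2real (\<phi> y)"
    using s by (intro enn2real_leI) auto
  then show "enn2real (\<phi> ((1 - s) *\<^sub>R x + s *\<^sub>R y)) \<le> (1 - s) * enn2real (\<phi> x) + s * enn2real (\<phi> y)"
    by simp
qed simp

lemma isCont_phi:
  assumes "0 < k" "ennreal k < b_of \<phi>"
  shows "isCont (\<lambda>u. enn2real (\<phi> u)) k"
proof -
  obtain \<beta> where \<beta>: "k < \<beta>" "\<phi> \<beta> < \<infinity>" using finite_point_above assms by (metis less_imp_le)
  have "convex_on {0<..<\<beta>} (\<lambda>u. enn2real (\<phi> u))"
    using convex_on_phi[OF \<beta>(2)] by (rule convex_on_subset) auto
  then have "continuous_on {0<..<\<beta>} (\<lambda>u. enn2real (\<phi> u))"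
    by (intro convex_on_continuous) auto
  then show ?thesis
    by (rule continuous_on_interior) (use \<beta> assms in \<open>simp add: interior_open\<close>)
qed

text \<open>
  Jensen's inequality is needed at a single point only, where a supporting line suffices. Its slope
  is positive because the line lies below \<open>\<phi> 0 = 0\<close> at \<open>0\<close> and is positive at \<open>k\<close>. Moving the
  negative terms to the other side keeps the inequality meaningful where \<open>\<phi>\<close> is infinite.
\<close>

lemma supporting_line:
  assumes k: "0 < k" "ennreal k < b_of \<phi>" and pos: "0 < \<phi> k"
  obtains s where "0 < s" "\<And>u. 0 \<le> u \<Longrightarrow> ennreal (s * u) + \<phi> k \<le> \<phi> u + ennreal (s * k)"
proof -
  obtain \<beta> where \<beta>: "k < \<beta>" "\<phi> \<beta> < \<infinity>" using finite_point_above k by (metis less_imp_le)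
  have fin: "\<phi> k < \<infinity>" using phi_finite_below_b k by simp
  define I where "I = {u. 0 \<le> u \<and> \<phi> u < \<infinity>}"
  define h where "h u = enn2real (\<phi> u)" for u
  have I: "u \<in> I" if "0 \<le> u" "u \<le> v" "v \<in> I" for u v
    using that phi_mono[of u v] by (auto simp: I_def intro: le_less_trans)
  have conv: "convex_on I h"
  proof (rule convex_onI)
    fix s x y :: real
    assume s: "0 < s" "s < 1" and xy: "x \<in> I" "y \<in> I"
    then have "\<phi> (max x y) < \<infinity>" by (simp add: I_def max_def)
    then have "convex_on {0..max x y} h" unfolding h_def by (rule convex_on_phi)
    then show "h ((1 - s) *\<^sub>R x + s *\<^sub>R y) \<le> (1 - s) * h x + s * h y"
      by (rule convex_onD) (use s xy in \<open>simp_all add: I_def\<close>)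
  next
    have "is_interval I"
      unfolding is_interval_1
    proof (intro ballI allI impI)
      fix x y z assume xy: "x \<in> I" "y \<in> I" "x \<le> z \<and> z \<le> y"
      then have "0 \<le> z" by (simp add: I_def)
      with xy show "z \<in> I" by (blast intro: I)
    qed
    then show "convex I" by (rule is_interval_convex)
  qed
  have "k \<in> interior I"
  proof (rule interiorI[of "{0<..<\<beta>}"])
    show "{0<..<\<beta>} \<subseteq> I" using I[of _ \<beta>] \<beta> k by (auto simp: I_def)
  qed (use k \<beta> in auto)
  note line = convex_le_Inf_differential[OF conv this]
  define s where "s = Inf ((\<lambda>t. (h k - h t) / (k - t)) ` ({k<..} \<inter> I))"
  have s: "h k + s * (y - k) \<le> h y" if "y \<in> I" for y
    using line[OF that] by (simp only: s_def)
  have "0 < h k" using pos fin by (simp add: h_def enn2real_positive_iff)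
  moreover have "h k - s * k \<le> 0" using s[of 0] by (simp add: I_def h_def)
  ultimately have "0 < s * k" by linarith
  then have "0 < s" using k by (simp add: zero_less_mult_iff)
  show ?thesis
  proof (rule that[OF \<open>0 < s\<close>])
    fix u :: real assume u: "0 \<le> u"
    show "ennreal (s * u) + \<phi> k \<le> \<phi> u + ennreal (s * k)"
    proof (cases "\<phi> u = \<infinity>")
      case False
      then have "u \<in> I" using u by (simp add: I_def less_top)
      then have "s * u + h k \<le> h u + s * k" using s[of u] by (simp add: algebra_simps)
      then have "ennreal (s * u + h k) \<le> ennreal (h u + s * k)" by (rule ennreal_leI)
      moreover have "\<phi> k = ennreal (h k)" "\<phi> u = ennreal (h u)"
        using fin False by (auto simp: h_def less_top)
      moreover have "0 \<le> h u" "0 \<le> h k" by (simp_all add: h_def)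
      ultimately show ?thesis using u k \<open>0 < s\<close> by simp
    qed auto
  qed
qed

text \<open>
  Jensen's inequality for the mean over \<open>A\<close>: integrate the supporting line at \<open>k\<close>.
\<close>

lemma average_le:
  assumes A [measurable]: "A \<in> sets M" and fin: "emeasure M A < \<infinity>"
    and k: "0 < k" "ennreal k < b_of \<phi>" and ge: "1 \<le> \<phi> k * emeasure M A"
    and g [measurable]: "g \<in> borel_measurable M" and le: "real_modular M \<phi> g \<le> 1"
  shows "(\<integral>\<^sup>+t. ennreal \<bar>g t\<bar> * indicator A t \<partial>M) \<le> ennreal k * emeasure M A"
proof -
  have "0 < \<phi> k" using ge by (cases "\<phi> k = 0") (auto simp: zero_less_iff_neq_zero)
  from supporting_line[OF k this] obtain s where s: "0 < s"
    and line: "\<And>u. 0 \<le> u \<Longrightarrow> ennreal (s * u) + \<phi> k \<le> \<phi> u + ennreal (s * k)" by blast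
  have [simp]: "\<phi> k * emeasure M A \<noteq> top"
    using fin phi_finite_below_b[OF k(2)] k(1) by (auto simp: ennreal_mult_eq_top_iff)
  let ?J = "\<integral>\<^sup>+t. ennreal \<bar>g t\<bar> * indicator A t \<partial>M"
  have "\<phi> k * emeasure M A + ennreal s * ?J =
      (\<integral>\<^sup>+t. (ennreal (s * \<bar>g t\<bar>) + \<phi> k) * indicator A t \<partial>M)"
    using s by (simp add: ennreal_mult distrib_right nn_integral_add nn_integral_cmult mult.assoc add.commute)
  also have "\<dots> \<le> (\<integral>\<^sup>+t. \<phi> \<bar>g t\<bar> + ennreal (s * k) * indicator A t \<partial>M)"
    using line by (intro nn_integral_mono) (auto simp: indicator_def)
  also have "\<dots> = real_modular M \<phi> g + ennreal (s * k) * emeasure M A"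
    by (simp add: nn_integral_add nn_integral_cmult real_modular_def)
  also have "\<dots> \<le> \<phi> k * emeasure M A + ennreal s * (ennreal k * emeasure M A)"
    using le ge s k by (intro add_mono) (auto simp: ennreal_mult mult.assoc)
  finally have "ennreal s * ?J \<le> ennreal s * (ennreal k * emeasure M A)"
    by (subst (asm) ennreal_add_left_cancel_le) simp
  then show ?thesis using s by (subst (asm) ennreal_mult_le_mult_iff) auto
qed

text \<open>
  The modular of \<open>(y - q) / (2 - e)\<close> is compared with that of \<open>y\<close> and \<open>q\<close> by convexity with weights
  \<open>1 / (2 - e)\<close> and \<open>(1 - e) / (2 - e)\<close>; the argument of the second term is therefore
  \<open>q / (1 - e)\<close>. Where \<open>y\<close> and \<open>q\<close> have the same sign the differences cancel instead of adding up,
  and the estimate improves by the proportion \<open>w\<close> of the second term.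
\<close>

lemma pointwise_deficit:
  fixes e q y :: real
  assumes e: "0 < e" "e < 1" and q: "0 < q"
  defines "\<theta> \<equiv> 1 / (2 - e)" and "p \<equiv> q / (1 - e)" and "w \<equiv> min (max y 0) q / q"
  shows "\<phi> \<bar>(y - q) / (2 - e)\<bar> + ennreal ((1 - e) * \<theta>) * \<phi> p * ennreal w
    \<le> ennreal \<theta> * \<phi> \<bar>y\<bar> + ennreal ((1 - e) * \<theta>) * \<phi> p"
proof -
  have \<theta>: "0 < \<theta>" "\<theta> < 1" "\<theta> + (1 - e) * \<theta> = 1" "0 \<le> (1 - e) * \<theta>" "(1 - e) * \<theta> \<le> 1"
    using e by (auto simp: \<theta>_def field_simps)
  have p: "0 < p" "(1 - e) * \<theta> * p = \<theta> * q" using e q by (auto simp: p_def)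
  consider "y < 0" | "0 \<le> y" "y \<le> q" | "q < y" by linarith
  then show ?thesis
  proof cases
    case 1
    then have "\<bar>(y - q) / (2 - e)\<bar> = \<theta> * (q - y)" using q e by (simp add: \<theta>_def)
    then have "\<bar>(y - q) / (2 - e)\<bar> = \<theta> * \<bar>y\<bar> + (1 - e) * \<theta> * p"
      using 1 p by (simp add: algebra_simps)
    moreover have "\<phi> (\<theta> * \<bar>y\<bar> + (1 - e) * \<theta> * p)
        \<le> ennreal \<theta> * \<phi> \<bar>y\<bar> + ennreal ((1 - e) * \<theta>) * \<phi> p"
      using \<theta> p by (intro phi_convex) auto
    moreover have "w = 0" using 1 q by (simp add: w_def)
    ultimately show ?thesis by simp
  next
    case 2
    then have w: "w = y / q" "0 \<le> w" "w \<le> 1" using q by (auto simp: w_def)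
    have "\<bar>(y - q) / (2 - e)\<bar> = (1 - w) * ((1 - e) * \<theta>) * p"
    proof -
      have "\<bar>(y - q) / (2 - e)\<bar> = \<theta> * (q - y)" using 2 e by (simp add: \<theta>_def)
      also have "\<dots> = (1 - w) * (\<theta> * q)" using q by (simp add: w field_simps)
      also have "\<dots> = (1 - w) * ((1 - e) * \<theta> * p)" by (simp only: p)
      finally show ?thesis by (simp only: mult.assoc)
    qed
    then have "\<phi> \<bar>(y - q) / (2 - e)\<bar> \<le> ennreal ((1 - w) * ((1 - e) * \<theta>)) * \<phi> p"
      using w \<theta> p e by (auto intro!: phi_scale mult_le_one)
    also have "\<dots> = ennreal (1 - w) * (ennreal ((1 - e) * \<theta>) * \<phi> p)"
      using w \<theta> by (subst ennreal_mult) (auto simp: mult.assoc)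
    finally have "\<phi> \<bar>(y - q) / (2 - e)\<bar> + ennreal ((1 - e) * \<theta>) * \<phi> p * ennreal w
        \<le> ennreal (1 - w) * (ennreal ((1 - e) * \<theta>) * \<phi> p) + ennreal w * (ennreal ((1 - e) * \<theta>) * \<phi> p)"
      by (subst mult.commute[of _ "ennreal w"]) (rule add_right_mono)
    also have "\<dots> = ennreal ((1 - w) + w) * (ennreal ((1 - e) * \<theta>) * \<phi> p)"
      using w(2,3) by (subst ennreal_plus) (auto simp: distrib_right)
    also have "\<dots> = ennreal ((1 - e) * \<theta>) * \<phi> p" by simp
    finally have "\<phi> \<bar>(y - q) / (2 - e)\<bar> + ennreal ((1 - e) * \<theta>) * \<phi> p * ennreal w
        \<le> ennreal ((1 - e) * \<theta>) * \<phi> p" .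
    then show ?thesis by (rule order_trans) (rule add_increasing, auto)
  next
    case 3
    then have w: "w = 1" using q by (simp add: w_def)
    have "\<phi> \<bar>(y - q) / (2 - e)\<bar> \<le> \<phi> (\<theta> * \<bar>y\<bar>)"
      using 3 e q by (intro phi_mono) (auto simp: \<theta>_def divide_right_mono)
    also have "\<dots> \<le> ennreal \<theta> * \<phi> \<bar>y\<bar>" using \<theta> by (intro phi_scale) auto
    finally show ?thesis by (simp add: w add_right_mono)
  qed
qed

text \<open>
  Below \<open>K\<close> the value \<open>y\<close> is controlled by the truncation \<open>w\<close>, beyond \<open>K\<close> by \<open>\<phi>\<close>, whose slope
  from the origin is at least \<open>r\<close> there.
\<close>

lemma pointwise_linear_growth:
  fixes r q K y :: real
  assumes q: "0 < q" "q \<le> K" and r: "0 < r" "ennreal (r * K) \<le> \<phi> K"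
  shows "ennreal (r * y) \<le> ennreal (r * K) * ennreal (min (max y 0) q / q) + \<phi> \<bar>y\<bar>"
proof -
  consider "y \<le> 0" | "0 < y" "y \<le> K" | "K < y" by linarith
  then show ?thesis
  proof cases
    case 1
    then have "r * y \<le> 0" using r by (simp add: mult_nonneg_nonpos)
    then show ?thesis by (simp add: ennreal_neg)
  next
    case 2
    have "y \<le> K * (min (max y 0) q / q)"
    proof (cases "y \<le> q")
      case True
      have "q * y \<le> K * y" using q 2 by (intro mult_right_mono) auto
      then show ?thesis using q 2 True by (simp add: field_simps)
    qed (use q 2 in auto)
    then have "ennreal (r * y) \<le> ennreal (r * (K * (min (max y 0) q / q)))"
      using r by (intro ennreal_leI mult_left_mono) auto
    also have "\<dots> = ennreal (r * K) * ennreal (min (max y 0) q / q)"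
      using r q by (subst ennreal_mult[symmetric]) (auto simp: mult.assoc)
    finally show ?thesis by (simp add: add_increasing2)
  next
    case 3
    have "ennreal (r * y) = ennreal (y / K) * ennreal (r * K)"
      using q r 3 by (subst ennreal_mult[symmetric]) auto
    also have "\<dots> \<le> ennreal (y / K) * \<phi> K" using r by (intro mult_left_mono) auto
    also have "\<phi> K = \<phi> ((K / y) * y)" using q 3 by simp
    also have "ennreal (y / K) * \<phi> ((K / y) * y) \<le> ennreal (y / K) * (ennreal (K / y) * \<phi> y)"
      using q 3 by (intro mult_left_mono phi_scale) auto
    also have "\<dots> = ennreal ((y / K) * (K / y)) * \<phi> y"
      using q 3 by (subst ennreal_mult) (auto simp: mult.assoc)
    also have "\<dots> = \<phi> \<bar>y\<bar>" using q 3 by simp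
    finally show ?thesis by (simp add: add_increasing)
  qed
qed

text \<open>
  The quantitative core of the necessity. Integrating \<open>pointwise_deficit\<close> shows two things: the
  average \<open>q\<close> must exceed \<open>(1 - e) * k\<close>, and the truncation \<open>w\<close> of the positive part of \<open>y\<close> has
  integral below \<open>m - 1 / \<phi> (k / (1 - e))\<close>, a bound that vanishes as \<open>e \<rightarrow> 0\<close>. By
  \<open>pointwise_linear_growth\<close> nearly all of the mass \<open>q * m\<close> is then paid for by the modular of
  \<open>y\<close> at rate \<open>r\<close>. For fixed \<open>K\<close> the conclusion tends to \<open>r * k * m \<le> 1\<close> as \<open>e \<rightarrow> 0\<close>.
\<close>

lemma deviation_from_average:
  fixes e q r K k m :: real
  assumes A [measurable]: "A \<in> sets M" and m: "emeasure M A = ennreal m" "0 < m"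
    and k: "0 < k" "\<phi> k = ennreal (1 / m)"
    and e: "0 < e" "e < 1" "ennreal (k / (1 - e)) < b_of \<phi>"
    and y [measurable]: "y \<in> borel_measurable M" and y1: "real_modular M \<phi> y \<le> 1"
    and q: "0 \<le> q" "q \<le> k" "ennreal (q * m) \<le> (\<integral>\<^sup>+t. ennreal (y t) * indicator A t \<partial>M)"
    and big: "1 < real_modular M \<phi> (\<lambda>t. (y t - q * indicator A t) / (2 - e))"
    and K: "k \<le> K" and r: "0 < r" "ennreal (r * K) \<le> \<phi> K"
  shows "r * ((1 - e) * k * m - K * (m - 1 / enn2real (\<phi> (k / (1 - e))))) \<le> 1"
proof -
  define \<theta> p where "\<theta> = 1 / (2 - e)" and "p = q / (1 - e)"
  define P Q where "P = enn2real (\<phi> p)" and "Q = enn2real (\<phi> (k / (1 - e)))"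
  have \<theta>: "0 < \<theta>" "\<theta> < 1" "\<theta> * (2 - e) = 1" using e by (auto simp: \<theta>_def field_simps)
  have pk: "0 \<le> p" "p \<le> k / (1 - e)" using q e by (auto simp: p_def divide_right_mono)
  have finQ: "\<phi> (k / (1 - e)) < \<infinity>" using e k by (intro phi_finite_below_b) auto
  have PQ: "P \<le> Q" "0 \<le> P" "\<phi> p = ennreal P"
  proof -
    have "\<phi> p \<le> \<phi> (k / (1 - e))" using pk by (intro phi_mono)
    then show "P \<le> Q" "\<phi> p = ennreal P" using finQ
      by (auto simp: P_def Q_def less_top intro!: enn2real_mono)
  qed (simp add: P_def)
  have q0: "0 < q"
  proof (rule ccontr)
    assume "\<not> 0 < q"
    then have "q = 0" using q by simp
    have "real_modular M \<phi> (\<lambda>t. (y t - q * indicator A t) / (2 - e)) \<le> (\<integral>\<^sup>+t. \<phi> \<bar>y t\<bar> \<partial>M)"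
      unfolding real_modular_def \<open>q = 0\<close>
    proof (intro nn_integral_mono phi_mono)
      fix t
      have "\<bar>y t\<bar> / (2 - e) \<le> \<bar>y t\<bar> / 1" using e by (intro divide_left_mono) auto
      then show "\<bar>(y t - 0 * indicat_real A t) / (2 - e)\<bar> \<le> \<bar>y t\<bar>" using e by simp
    qed simp
    with big y1 show False by (simp add: real_modular_def)
  qed
  define w where "w t = min (max (y t) 0) q / q" for t
  have [measurable]: "w \<in> borel_measurable M" unfolding w_def by measurable
  have w01: "0 \<le> w t" "w t \<le> 1" for t using q0 by (auto simp: w_def)
  define W where "W = (\<integral>\<^sup>+t. ennreal (w t) * indicator A t \<partial>M)"
  have "W \<le> (\<integral>\<^sup>+t. indicator A t \<partial>M)"
    unfolding W_def using w01 by (intro nn_integral_mono) (auto simp: indicator_def)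
  then have "W \<le> ennreal m" by (simp add: m)
  then obtain W' where W': "W = ennreal W'" "0 \<le> W'" "W' \<le> m"
    using m by (cases W) (auto simp: top_unique)
  define c where "c = (1 - e) * \<theta>"
  have c: "0 < c" using e \<theta> by (simp add: c_def)
  have "real_modular M \<phi> (\<lambda>t. (y t - q * indicator A t) / (2 - e)) + ennreal c * \<phi> p * W
      = (\<integral>\<^sup>+t. \<phi> \<bar>(y t - q * indicator A t) / (2 - e)\<bar>
           + ennreal c * \<phi> p * (ennreal (w t) * indicator A t) \<partial>M)"
    by (simp add: real_modular_def W_def nn_integral_add nn_integral_cmult del: abs_divide)
  also have "\<dots> \<le> (\<integral>\<^sup>+t. ennreal \<theta> * \<phi> \<bar>y t\<bar> + ennreal c * \<phi> p * indicator A t \<partial>M)"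
  proof (intro nn_integral_mono)
    fix t
    show "\<phi> \<bar>(y t - q * indicator A t) / (2 - e)\<bar> + ennreal c * \<phi> p * (ennreal (w t) * indicator A t)
      \<le> ennreal \<theta> * \<phi> \<bar>y t\<bar> + ennreal c * \<phi> p * indicator A t"
    proof (cases "t \<in> A")
      case True
      then show ?thesis
        using pointwise_deficit[OF e(1,2) q0, of "y t"] by (simp add: w_def c_def \<theta>_def p_def)
    next
      case False
      have "\<phi> (\<theta> * \<bar>y t\<bar>) \<le> ennreal \<theta> * \<phi> \<bar>y t\<bar>" using \<theta> by (intro phi_scale) auto
      moreover have "\<theta> * \<bar>y t\<bar> = \<bar>y t / (2 - e)\<bar>" using e by (simp add: \<theta>_def)
      ultimately show ?thesis using False by simp
    qed
  qed
  also have "\<dots> = ennreal \<theta> * real_modular M \<phi> y + ennreal c * \<phi> p * ennreal m"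
    by (simp add: real_modular_def nn_integral_add nn_integral_cmult m)
  also have "\<dots> \<le> ennreal \<theta> * 1 + ennreal c * \<phi> p * ennreal m"
    using y1 by (intro add_mono mult_left_mono) auto
  finally have "real_modular M \<phi> (\<lambda>t. (y t - q * indicator A t) / (2 - e)) + ennreal (c * P * W')
      \<le> ennreal (\<theta> + c * P * m)"
    using PQ W' m c \<theta> by (simp add: ennreal_mult)
  moreover have "ennreal (1 + c * P * W') = ennreal (c * P * W') + 1"
    using PQ W' c by (simp add: add.commute)
  moreover have "ennreal (c * P * W') + 1
      < ennreal (c * P * W') + real_modular M \<phi> (\<lambda>t. (y t - q * indicator A t) / (2 - e))"
    using big by (simp only: ennreal_add_left_cancel_less) simp
  ultimately have "ennreal (1 + c * P * W') < ennreal (\<theta> + c * P * m)"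
    by (simp only: add.commute[of "ennreal (c * P * W')"] order_less_le_trans)
  then have "1 + c * P * W' < \<theta> + c * P * m"
    using PQ W' c by (subst (asm) ennreal_less_iff) auto
  then have "(2 - e) * (1 + c * P * W') < (2 - e) * (\<theta> + c * P * m)"
    using e by (intro mult_strict_left_mono) auto
  moreover have "(2 - e) * (1 + c * P * W') = (2 - e) + (1 - e) * (\<theta> * (2 - e)) * P * W'"
    "(2 - e) * (\<theta> + c * P * m) = \<theta> * (2 - e) + (1 - e) * (\<theta> * (2 - e)) * P * m"
    by (simp_all only: c_def distrib_left mult_ac mult_1_right mult_1_left)
  ultimately have "(2 - e) + (1 - e) * P * W' < 1 + (1 - e) * P * m"
    by (simp only: \<theta>(3))
  then have "(1 - e) * 1 < (1 - e) * (P * (m - W'))" by (simp add: algebra_simps)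
  then have main: "1 < P * (m - W')" using e by (simp only: mult_less_cancel_left_pos)
  have "P * (m - W') \<le> P * m" using W' PQ by (intro mult_left_mono) auto
  with main have "1 < P * m" by simp
  then have "1 / m < P" using m by (simp add: field_simps)
  then have "\<phi> k < \<phi> p" using k PQ m by (simp add: ennreal_less_iff)
  then have "k < p" using phi_mono[of p k] pk by (meson not_le)
  then have qk: "(1 - e) * k < q" using e by (simp add: p_def field_simps)
  have "P * (m - W') \<le> Q * (m - W')" using W' PQ by (intro mult_right_mono) auto
  with main have Qm: "1 < Q * (m - W')" by simp
  then have "0 < Q * (m - W')" by simp
  then have "0 < Q" using W' by (auto simp: zero_less_mult_iff)
  with Qm have WQ: "W' < m - 1 / Q" by (simp add: field_simps)
  have "ennreal (r * (q * m)) \<le> ennreal r * (\<integral>\<^sup>+t. ennreal (y t) * indicator A t \<partial>M)"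
    using q r m by (subst ennreal_mult) (auto intro!: mult_left_mono)
  also have "\<dots> = (\<integral>\<^sup>+t. ennreal (r * y t) * indicator A t \<partial>M)"
    using r by (subst nn_integral_cmult[symmetric]) (auto simp: ennreal_mult' mult.assoc)
  also have "\<dots> \<le> (\<integral>\<^sup>+t. ennreal (r * K) * (ennreal (w t) * indicator A t) + \<phi> \<bar>y t\<bar> \<partial>M)"
    using pointwise_linear_growth[OF q0 _ r] q K
    by (intro nn_integral_mono) (auto simp: indicator_def w_def)
  also have "\<dots> = ennreal (r * K) * W + real_modular M \<phi> y"
    by (simp add: real_modular_def W_def nn_integral_add nn_integral_cmult)
  also have "\<dots> \<le> ennreal (r * K) * W + 1" using y1 by (intro add_mono) auto
  also have "\<dots> = ennreal (r * K * W' + 1)"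
    using W' r K k by (simp add: ennreal_mult)
  finally have "r * (q * m) \<le> r * K * W' + 1"
    using W' r K k by (subst (asm) ennreal_le_iff) auto
  moreover have "r * ((1 - e) * k * m) \<le> r * (q * m)"
    using qk m r by (intro mult_left_mono mult_right_mono) auto
  moreover have "r * K * W' \<le> r * K * (m - 1 / Q)"
    using WQ r K k by (intro mult_left_mono) auto
  ultimately show ?thesis by (simp add: Q_def algebra_simps)
qed

end

text \<open>
  For this shape of \<open>\<phi>\<close> the Luxemburg space is a weighted \<open>L\<^sub>1\<close> and the Orlicz space of the
  complementary function a weighted \<open>L\<^sub>\<infinity>\<close>; for \<open>bounded_type\<close> the roles are exchanged.
\<close>

definition linear_type :: "(real \<Rightarrow> ennreal) \<Rightarrow> real \<Rightarrow> bool" where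
  "linear_type \<phi> c \<longleftrightarrow> 0 < c \<and> (\<forall>u\<ge>0. \<phi> u = ennreal (c * u))"

text \<open>
  Every function bounded by \<open>\<beta>\<close> has modular at most \<open>1\<close>, and no function of
  finite modular exceeds \<open>\<beta>\<close>. With \<open>0 * \<infinity> = 0\<close> the last condition reads \<open>\<phi> \<beta> = 0\<close> on
  a space of infinite measure.
\<close>

definition bounded_type :: "'a measure \<Rightarrow> (real \<Rightarrow> ennreal) \<Rightarrow> real \<Rightarrow> bool" where
  "bounded_type M \<phi> \<beta> \<longleftrightarrow> 0 < \<beta> \<and> b_of \<phi> = ennreal \<beta> \<and> \<phi> \<beta> * emeasure M (space M) \<le> 1"

context orlicz
begin

text \<open>
  The slope \<open>\<phi> u / u\<close> increases, so it is \<open>c\<close> from \<open>k\<close> on. Below \<open>k\<close> the upper bound is again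
  the monotone slope; the lower bound is midpoint convexity for \<open>u\<close>, \<open>k\<close> and the reflected point
  \<open>2 * k - u\<close>, where \<open>\<phi>\<close> is known.
\<close>

lemma linear_typeI:
  assumes k: "0 < k" "\<phi> k = ennreal (c * k)" and c: "0 < c"
    and above: "\<And>K. k \<le> K \<Longrightarrow> \<phi> K \<le> ennreal (c * K)"
  shows "linear_type \<phi> c"
  unfolding linear_type_def
proof (intro conjI allI impI c)
  fix u :: real assume u: "0 \<le> u"
  show "\<phi> u = ennreal (c * u)"
  proof (cases "k \<le> u")
    case True
    have "\<phi> ((k / u) * u) \<le> ennreal (k / u) * \<phi> u" using k True by (intro phi_scale) auto
    then have "ennreal (c * k) \<le> ennreal (k / u) * \<phi> u" using k True by simp
    then have "ennreal (u / k) * ennreal (c * k) \<le> ennreal (u / k) * (ennreal (k / u) * \<phi> u)"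
      by (rule mult_left_mono) simp
    also have "\<dots> = ennreal ((u / k) * (k / u)) * \<phi> u"
      using k u by (subst ennreal_mult) (auto simp: mult.assoc)
    also have "\<dots> = \<phi> u" using k True by simp
    finally have "ennreal (c * u) \<le> \<phi> u"
      using k c u by (simp add: ennreal_mult[symmetric] mult.commute)
    with above[OF True] show ?thesis by (rule antisym)
  next
    case False
    have "\<phi> ((u / k) * k) \<le> ennreal (u / k) * \<phi> k" using False u by (intro phi_scale) auto
    also have "\<dots> = ennreal (c * u)" using k c u by (simp add: ennreal_mult[symmetric])
    finally have le: "\<phi> u \<le> ennreal (c * u)" using k by simp
    then obtain v where v: "\<phi> u = ennreal v" "0 \<le> v" by (cases "\<phi> u") (auto simp: top_unique)
    have "\<phi> ((1/2) * u + (1/2) * (2 * k - u)) \<le> ennreal (1/2) * \<phi> u + ennreal (1/2) * \<phi> (2 * k - u)"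
      using False u by (intro phi_convex) auto
    also have "\<dots> \<le> ennreal (1/2) * ennreal v + ennreal (1/2) * ennreal (c * (2 * k - u))"
      using False v by (intro add_mono mult_left_mono above) auto
    also have "\<dots> = ennreal ((1/2) * v + (1/2) * (c * (2 * k - u)))"
    proof -
      have "ennreal s * ennreal x + ennreal s * ennreal z = ennreal (s * x + s * z)"
        if "0 \<le> s" "0 \<le> x" "0 \<le> z" for s x z
        using that by (simp add: ennreal_mult)
      from this[of "1/2" v "c * (2 * k - u)"] show ?thesis using v(2) False u c k by simp
    qed
    finally have "ennreal (c * k) \<le> ennreal ((1/2) * v + (1/2) * (c * (2 * k - u)))"
      using k by (simp add: algebra_simps)
    moreover have "0 \<le> (1/2) * v + (1/2) * (c * (2 * k - u))"
      using v False u c k by (intro add_nonneg_nonneg mult_nonneg_nonneg) auto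
    ultimately have "c * k \<le> (1/2) * v + (1/2) * (c * (2 * k - u))" by simp
    then have "c * u \<le> v" by (simp add: algebra_simps)
    with le v show ?thesis by (intro antisym) (auto intro: ennreal_leI)
  qed
qed

text \<open>
  Letting \<open>e \<rightarrow> 0\<close> in \<open>deviation_from_average\<close>, with \<open>\<phi>\<close> continuous at \<open>k < b_of \<phi>\<close>, bounds every
  slope \<open>\<phi> K / K\<close> with \<open>K \<ge> k\<close> by the slope at \<open>k\<close>. In particular \<open>\<phi>\<close> is finite everywhere.
\<close>

lemma linear_if_deviation_large:
  fixes k m :: real
  assumes A [measurable]: "A \<in> sets M" and m: "emeasure M A = ennreal m" "0 < m"
    and k: "0 < k" "ennreal k < b_of \<phi>" "\<phi> k = ennreal (1 / m)"
    and H: "\<And>e. 0 < e \<Longrightarrow> e < 1 \<Longrightarrow> \<exists>y\<in>borel_measurable M. real_modular M \<phi> y \<le> 1 \<and>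
      1 < real_modular M \<phi> (\<lambda>t. (y t - (LINT t:A|M. y t) / m * indicator A t) / (2 - e))"
  shows "linear_type \<phi> (1 / m / k)"
proof -
  have signed: "\<exists>y\<in>borel_measurable M. \<exists>q. real_modular M \<phi> y \<le> 1 \<and> 0 \<le> q \<and> q \<le> k \<and>
      ennreal (q * m) \<le> (\<integral>\<^sup>+t. ennreal (y t) * indicator A t \<partial>M) \<and>
      1 < real_modular M \<phi> (\<lambda>t. (y t - q * indicator A t) / (2 - e))"
    if e: "0 < e" "e < 1" for e
  proof -
    from H[OF e] obtain y where [measurable]: "y \<in> borel_measurable M" and y1: "real_modular M \<phi> y \<le> 1"
      and big: "1 < real_modular M \<phi> (\<lambda>t. (y t - (LINT t:A|M. y t) / m * indicator A t) / (2 - e))"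
      by blast
    \<comment> \<open>The hypothesis is invariant under a change of sign; choose the sign with nonnegative average.\<close>
    define s :: real where "s = (if 0 \<le> (LINT t:A|M. y t) then 1 else -1)"
    define z where "z t = s * y t" for t
    define q where "q = (LINT t:A|M. z t) / m"
    have s: "\<bar>s\<bar> = 1" by (simp add: s_def)
    have [measurable]: "z \<in> borel_measurable M" unfolding z_def by measurable
    have z1: "real_modular M \<phi> z \<le> 1" using y1 s by (simp add: real_modular_def z_def abs_mult)
    have "(\<integral>\<^sup>+t. ennreal \<bar>z t\<bar> * indicator A t \<partial>M) \<le> ennreal k * emeasure M A"
      using k m z1 by (intro average_le) (auto simp: ennreal_mult[symmetric])
    then have "(\<integral>\<^sup>+t. ennreal \<bar>z t\<bar> * indicator A t \<partial>M) \<le> ennreal (k * m)"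
      using k m by (simp add: ennreal_mult)
    note bounds = set_integral_bounds[OF A _ this]
    have qs: "(LINT t:A|M. z t) = s * (LINT t:A|M. y t)" by (simp add: z_def)
    then have "0 \<le> q" using m by (simp add: q_def s_def)
    moreover have "q \<le> k" using bounds(2) m k by (simp add: q_def field_simps)
    moreover have "ennreal (q * m) \<le> (\<integral>\<^sup>+t. ennreal (z t) * indicator A t \<partial>M)"
      using bounds(3) m k by (simp add: q_def)
    moreover have "real_modular M \<phi> (\<lambda>t. (z t - q * indicator A t) / (2 - e))
      = real_modular M \<phi> (\<lambda>t. (y t - (LINT t:A|M. y t) / m * indicator A t) / (2 - e))"
      unfolding real_modular_def
    proof (intro nn_integral_cong arg_cong[where f = \<phi>])
      fix t
      have "z t - q * indicator A t = s * (y t - (LINT t:A|M. y t) / m * indicator A t)"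
        by (simp add: z_def q_def qs algebra_simps)
      then show "\<bar>(z t - q * indicator A t) / (2 - e)\<bar>
          = \<bar>(y t - (LINT t:A|M. y t) / m * indicator A t) / (2 - e)\<bar>"
        using s by (simp add: abs_mult)
    qed
    ultimately show ?thesis using z1 big by (intro bexI[of _ z] exI[of _ q]) auto
  qed
  have slope: "r * (k * m) \<le> 1" if K: "k \<le> K" and r: "0 < r" "ennreal (r * K) \<le> \<phi> K" for r K
  proof -
    define h where "h u = enn2real (\<phi> u)" for u
    have "((\<lambda>e. k / (1 - e)) \<longlongrightarrow> k / (1 - 0)) (at_right 0)"
      by (intro tendsto_intros) auto
    then have ke: "((\<lambda>e. k / (1 - e)) \<longlongrightarrow> k) (at_right 0)" by simp
    have "isCont h k" unfolding h_def using k by (intro isCont_phi) auto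
    then have "((\<lambda>e. h (k / (1 - e))) \<longlongrightarrow> h k) (at_right 0)"
      using ke by (rule isCont_tendsto_compose)
    moreover have hk: "h k = 1 / m" using k m by (simp add: h_def)
    ultimately have "((\<lambda>e. r * ((1 - e) * k * m - K * (m - 1 / h (k / (1 - e))))) \<longlongrightarrow>
        r * ((1 - 0) * k * m - K * (m - 1 / h k))) (at_right 0)"
      using m by (intro tendsto_intros) auto
    moreover have "eventually (\<lambda>e. r * ((1 - e) * k * m - K * (m - 1 / h (k / (1 - e)))) \<le> 1) (at_right 0)"
    proof -
      obtain v where v: "k < v" "\<phi> v < \<infinity>" using finite_point_above k by (metis less_imp_le)
      obtain v' where v': "k < v'" "v' < v" using dense v by blast
      have "ennreal v \<le> b_of \<phi>" using v phi_eq_top_above_b by (metis less_irrefl not_le)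
      have "ennreal v' < ennreal v" using v' k by (simp add: ennreal_less_iff)
      then have "ennreal v' < b_of \<phi>" using \<open>ennreal v \<le> b_of \<phi>\<close> by (rule less_le_trans)
      have "eventually (\<lambda>e. k / (1 - e) < v') (at_right 0)"
        using ke v'(1) by (rule order_tendstoD)
      moreover have "eventually (\<lambda>e::real. e \<in> {0<..<1}) (at_right 0)"
        by (rule eventually_at_right_real) simp
      ultimately show ?thesis
      proof eventually_elim
        case (elim e)
        then have e: "0 < e" "e < 1" by auto
        have "ennreal (k / (1 - e)) \<le> ennreal v'" using elim by (intro ennreal_leI) auto
        then have "ennreal (k / (1 - e)) < b_of \<phi>" using \<open>ennreal v' < b_of \<phi>\<close> by (rule le_less_trans)
        with signed[OF e] show ?case
          unfolding h_def using deviation_from_average[OF A m k(1,3) e] K r by blast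
      qed
    qed
    ultimately have "r * ((1 - 0) * k * m - K * (m - 1 / h k)) \<le> 1"
      by (intro tendsto_upperbound[where F = "at_right 0"]) auto
    then show ?thesis using hk m by (simp add: mult.assoc)
  qed
  show ?thesis
  proof (rule linear_typeI[OF k(1)])
    show "\<phi> k = ennreal (1 / m / k * k)" "0 < 1 / m / k" using k m by auto
    fix K assume K: "k \<le> K"
    show "\<phi> K \<le> ennreal (1 / m / k * K)"
    proof (rule ccontr)
      assume "\<not> ?thesis"
      then obtain z where z: "ennreal (1 / m / k * K) < z" "z < \<phi> K" using dense by (meson not_le)
      then obtain v where v: "z = ennreal v" "0 \<le> v" by (cases z) (auto simp: top_unique)
      have "0 \<le> 1 / m / k * K" using k K m by auto
      then have "1 / m / k * K < v" using z(1) v by (simp add: ennreal_less_iff)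
      then have gt: "1 / m / k < v / K" using K k by (simp add: field_simps)
      then have "0 < v / K" using k m by (intro less_trans[OF _ gt]) auto
      moreover have "ennreal (v / K * K) \<le> \<phi> K" using z v K k by auto
      ultimately have "v / K * (k * m) \<le> 1" by (rule slope[OF K])
      then have "v / K \<le> 1 / m / k" using k m by (simp add: field_simps)
      with gt show False by simp
    qed
  qed
qed

text \<open>
  If \<open>\<phi>\<close> is not of bounded type, left continuity at \<open>b_of \<phi>\<close> (or growth at infinity) yields
  \<open>k0 < b_of \<phi>\<close> with \<open>\<phi> k0 * \<mu>(\<Omega>) > 1\<close>. A set \<open>A\<close> of finite measure still satisfies this, and
  \<open>\<phi> k = 1 / \<mu>(A)\<close> is solved on \<open>[0, k0]\<close> by the intermediate value theorem. Staying strictly below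
  \<open>b_of \<phi>\<close> makes \<open>\<phi>\<close> continuous at \<open>k\<close>.
\<close>

lemma level_set_exists:
  fixes M :: "'a measure"
  assumes sf: "sigma_finite_measure M" and pos: "emeasure M (space M) \<noteq> 0"
    and nb: "\<And>\<beta>. \<not> bounded_type M \<phi> \<beta>"
  obtains A m k where "A \<in> sets M" "emeasure M A = ennreal m" "0 < m"
    "0 < k" "ennreal k < b_of \<phi>" "\<phi> k = ennreal (1 / m)"
proof -
  interpret sigma_finite_measure M by (rule sf)
  let ?S = "emeasure M (space M)"
  have "\<exists>k0>0. ennreal k0 < b_of \<phi> \<and> 1 < \<phi> k0 * ?S"
  proof (rule ccontr)
    assume none: "\<not> ?thesis"
    have le: "\<phi> k \<le> 1 / ?S" if "0 < k" "ennreal k < b_of \<phi>" for k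
    proof -
      have "\<not> 1 < \<phi> k * ?S" using that none by blast
      then show ?thesis by (simp only: not_less ennreal_mult_le_1_iff[OF pos])
    qed
    have fin: "1 / ?S < \<infinity>" using pos by (auto simp: less_top[symmetric] ennreal_divide_eq_top_iff)
    show False
    proof (cases "b_of \<phi>")
      case (real \<beta>)
      then have \<beta>: "0 < \<beta>" using b_of_pos by (cases "\<beta> = 0") auto
      have "\<phi> \<beta> \<le> 1 / ?S"
      proof (rule phi_le_from_left[OF \<beta> _ fin])
        fix v :: real assume "0 < v" "v < \<beta>"
        then show "\<phi> v \<le> 1 / ?S" using real(2) by (intro le) (auto simp: ennreal_less_iff)
      qed
      then have "\<phi> \<beta> * ?S \<le> 1" by (simp only: ennreal_mult_le_1_iff[OF pos])
      then have "bounded_type M \<phi> \<beta>" using \<beta> real by (simp add: bounded_type_def)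
      with nb show False by blast
    next
      case top
      obtain u where u: "0 < u" "0 < \<phi> u" using phi_pos_point by blast
      have "\<phi> u \<le> ennreal (1 / real (Suc n)) * (1 / ?S)" for n
      proof -
        have "\<phi> ((1 / real (Suc n)) * (real (Suc n) * u))
            \<le> ennreal (1 / real (Suc n)) * \<phi> (real (Suc n) * u)"
          using u by (intro phi_scale) auto
        also have "\<dots> \<le> ennreal (1 / real (Suc n)) * (1 / ?S)"
          using u top by (intro mult_left_mono le) auto
        finally show ?thesis using u by simp
      qed
      moreover have "(\<lambda>n. ennreal (1 / real (Suc n)) * (1 / ?S)) \<longlonglongrightarrow> ennreal 0 * (1 / ?S)"
        using fin LIMSEQ_Suc[OF lim_1_over_n[where 'a=real]]
        by (intro tendsto_mult_ennreal tendsto_ennrealI tendsto_const) auto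
      ultimately have "\<phi> u \<le> ennreal 0 * (1 / ?S)"
        by (intro LIMSEQ_le_const) auto
      with u show False by simp
    qed
  qed
  then obtain k0 where k0: "0 < k0" "ennreal k0 < b_of \<phi>" "1 < \<phi> k0 * ?S" by blast
  have p0: "\<phi> k0 \<noteq> 0" using k0 by auto
  have "\<not> ?S * \<phi> k0 \<le> 1" using k0(3) by (simp only: not_le mult.commute)
  then have "1 / \<phi> k0 < ?S" by (simp only: ennreal_mult_le_1_iff[OF p0] not_le)
  from finite_subset_large[OF sets.top this] obtain A
    where A: "A \<in> sets M" "emeasure M A < \<infinity>" "1 / \<phi> k0 < emeasure M A" .
  obtain m where m: "emeasure M A = ennreal m" "0 \<le> m" using A by (cases "emeasure M A") auto
  have "m \<noteq> 0"
  proof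
    assume "m = 0"
    with A(3) m(1) show False by simp
  qed
  then have m0: "0 < m" using m by simp
  obtain v where v: "\<phi> k0 = ennreal v" "0 \<le> v"
    using phi_finite_below_b[OF k0(2)] k0 by (cases "\<phi> k0") auto
  have "\<not> ennreal m * \<phi> k0 \<le> 1"
    unfolding ennreal_mult_le_1_iff[OF p0] using A(3) m(1) by (simp only: not_le)
  then have "\<not> ennreal (m * v) \<le> 1" unfolding v(1) ennreal_mult[OF m(2) v(2)] .
  then have "1 < m * v" by simp
  then have vm: "1 / m \<le> v" using m0 by (simp add: field_simps)
  define h where "h u = enn2real (\<phi> u)" for u
  have "continuous_on {0..k0} h"
    unfolding continuous_on_eq_continuous_within
  proof
    fix x assume x: "x \<in> {0..k0}"
    show "continuous (at x within {0..k0}) h"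
    proof (cases "x = 0")
      case True
      have "(\<phi> \<longlongrightarrow> ennreal 0) (at_right 0)" using phi_tendsto_0 by simp
      then have "(h \<longlongrightarrow> 0) (at_right 0)"
        unfolding h_def by (rule tendsto_enn2real) simp
      then have "continuous (at_right 0) h" by (simp add: continuous_within h_def)
      then show ?thesis using k0 True
        by (simp add: at_within_Icc_at_right)
    next
      case False
      then have "0 < x" using x by simp
      moreover have "ennreal x < b_of \<phi>"
        by (rule le_less_trans[OF ennreal_leI k0(2)]) (use x in simp)
      ultimately have "isCont (\<lambda>u. enn2real (\<phi> u)) x" by (rule isCont_phi)
      then show ?thesis unfolding h_def by (rule continuous_at_imp_continuous_at_within)
    qed
  qed
  then obtain k where k: "0 \<le> k" "k \<le> k0" "h k = 1 / m"
    using IVT'[of h 0 "1 / m" k0] vm v m0 k0 by (auto simp: h_def)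
  have "k \<noteq> 0" using k m0 by (auto simp: h_def)
  moreover have kb: "ennreal k < b_of \<phi>" by (rule le_less_trans[OF ennreal_leI k0(2)]) (rule k)
  moreover have "\<phi> k = ennreal (1 / m)"
  proof -
    have "\<phi> k = ennreal (h k)" using phi_finite_below_b[OF kb] k(1) by (simp add: h_def)
    then show ?thesis by (simp only: k(3))
  qed
  ultimately show ?thesis using that[OF A(1) m(1) m0, of k] k by auto
qed

end

section \<open>Spaces of almost everywhere classes through real representatives\<close>

text \<open>
  The class of a real-valued function; finitely valued representatives make sums of functions
  unambiguous.
\<close>

definition cls :: "'a measure \<Rightarrow> ('a \<Rightarrow> real) \<Rightarrow> ('a \<Rightarrow> ereal) set" where
  "cls M f = ae_rel M `` {\<lambda>t. ereal (f t)}"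

lemma equiv_ae_rel: "equiv (borel_measurable M) (ae_rel M)"
proof (rule equivI)
  show "sym (ae_rel M)"
  proof (rule symI)
    fix f g assume "(f, g) \<in> ae_rel M"
    then have "f \<in> borel_measurable M" "g \<in> borel_measurable M" "AE t in M. f t = g t"
      by (auto simp: ae_rel_def)
    moreover from this(3) have "AE t in M. g t = f t" by eventually_elim simp
    ultimately show "(g, f) \<in> ae_rel M" by (simp add: ae_rel_def)
  qed
  show "trans (ae_rel M)"
  proof (rule transI)
    fix f g h assume "(f, g) \<in> ae_rel M" "(g, h) \<in> ae_rel M"
    then have "f \<in> borel_measurable M" "h \<in> borel_measurable M" "AE t in M. f t = g t" "AE t in M. g t = h t"
      by (auto simp: ae_rel_def)
    moreover from this(3,4) have "AE t in M. f t = h t" by eventually_elim simp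
    ultimately show "(f, h) \<in> ae_rel M" by (simp add: ae_rel_def)
  qed
qed (auto simp: ae_rel_def refl_on_def)

lemma in_cls_iff:
  assumes "f \<in> borel_measurable M"
  shows "g \<in> cls M f \<longleftrightarrow> g \<in> borel_measurable M \<and> (AE t in M. ereal (f t) = g t)"
  using assms by (auto simp: cls_def ae_rel_def)

lemma cls_eq_iff:
  assumes [measurable]: "f \<in> borel_measurable M" "g \<in> borel_measurable M"
  shows "cls M f = cls M g \<longleftrightarrow> (AE t in M. f t = g t)"
proof -
  have "cls M f = cls M g \<longleftrightarrow> ((\<lambda>t. ereal (f t)), (\<lambda>t. ereal (g t))) \<in> ae_rel M"
    unfolding cls_def by (rule eq_equiv_class_iff[OF equiv_ae_rel]) measurable
  then show ?thesis by (simp add: ae_rel_def)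
qed

text \<open>
  What the function spaces have in common: the norm and membership depend only on the class, and
  members are finite almost everywhere. Closure under the linear operations is required for real
  functions only, where no sum \<open>\<infinity> + (- \<infinity>)\<close> can occur.
\<close>

locale ae_space =
  fixes M :: "'a measure" and F :: "('a \<Rightarrow> ereal) set" and N :: "('a \<Rightarrow> ereal) \<Rightarrow> real"
  assumes meas: "f \<in> F \<Longrightarrow> f \<in> borel_measurable M"
    and cong: "f \<in> F \<Longrightarrow> g \<in> borel_measurable M \<Longrightarrow> AE t in M. f t = g t \<Longrightarrow> g \<in> F \<and> N g = N f"
    and ae_finite: "f \<in> F \<Longrightarrow> AE t in M. \<bar>f t\<bar> \<noteq> \<infinity>"
    and zero: "(\<lambda>_. 0) \<in> F"
    and add: "(\<lambda>t. ereal (u t)) \<in> F \<Longrightarrow> (\<lambda>t. ereal (v t)) \<in> F \<Longrightarrow> (\<lambda>t. ereal (u t + v t)) \<in> F"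
    and scale: "(\<lambda>t. ereal (u t)) \<in> F \<Longrightarrow> (\<lambda>t. ereal (c * u t)) \<in> F"
begin

abbreviation "X \<equiv> class_space M F N"

definition V :: "('a \<Rightarrow> real) set" where
  "V = {u \<in> borel_measurable M. (\<lambda>t. ereal (u t)) \<in> F}"

definition nrm :: "('a \<Rightarrow> real) \<Rightarrow> real" where
  "nrm u = N (\<lambda>t. ereal (u t))"

lemma V_meas [measurable_dest]: "u \<in> V \<Longrightarrow> u \<in> borel_measurable M"
  by (simp add: V_def)

lemma V_zero: "(\<lambda>_. 0) \<in> V"
  using zero by (simp add: V_def zero_ereal_def)

lemma V_add: "u \<in> V \<Longrightarrow> v \<in> V \<Longrightarrow> (\<lambda>t. u t + v t) \<in> V"
  using add[of u v] by (auto simp: V_def)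

lemma V_scale: "u \<in> V \<Longrightarrow> (\<lambda>t. c * u t) \<in> V"
  using scale[of u c] by (auto simp: V_def)

lemma V_cong:
  assumes "u \<in> V" and [measurable]: "v \<in> borel_measurable M" and "AE t in M. u t = v t"
  shows "v \<in> V" "nrm v = nrm u"
proof -
  have "(\<lambda>t. ereal (v t)) \<in> F \<and> N (\<lambda>t. ereal (v t)) = N (\<lambda>t. ereal (u t))"
    using assms by (intro cong) (auto simp: V_def)
  then show "v \<in> V" "nrm v = nrm u" by (auto simp: V_def nrm_def)
qed

lemma vnorm_class:
  assumes "f \<in> F"
  shows "vnorm X (ae_rel M `` {f}) = N f"
proof -
  have "N g = N f" if "g \<in> ae_rel M `` {f}" for g
    using that cong[OF assms, of g] by (simp add: ae_rel_def)
  moreover have "f \<in> ae_rel M `` {f}" using meas[OF assms] by (simp add: ae_rel_def)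
  ultimately have "N ` (ae_rel M `` {f}) = {N f}" by blast
  then show ?thesis by (simp add: class_space_def)
qed

lemma real_representative:
  assumes "f \<in> F"
  shows "\<exists>u\<in>V. cls M u = ae_rel M `` {f}"
proof
  have [measurable]: "f \<in> borel_measurable M" by (rule meas[OF assms])
  let ?u = "\<lambda>t. real_of_ereal (f t)"
  have ae: "AE t in M. f t = ereal (?u t)"
    using ae_finite[OF assms] by eventually_elim (simp add: ereal_real)
  show "?u \<in> V" using cong[OF assms _ ae] by (simp add: V_def)
  have "(f, \<lambda>t. ereal (?u t)) \<in> ae_rel M" using ae by (simp add: ae_rel_def)
  then show "cls M ?u = ae_rel M `` {f}"
    unfolding cls_def using equiv_ae_rel by (metis equiv_class_eq)
qed

lemma vecs_X: "vecs X = cls M ` V"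
proof
  show "vecs X \<subseteq> cls M ` V"
  proof
    fix x assume "x \<in> vecs X"
    then obtain f where "f \<in> F" "x = ae_rel M `` {f}"
      by (auto simp: class_space_def quotient_def)
    then show "x \<in> cls M ` V" using real_representative by (metis image_eqI)
  qed
  show "cls M ` V \<subseteq> vecs X"
    by (auto simp: class_space_def quotient_def cls_def V_def)
qed

lemma vnorm_cls: "u \<in> V \<Longrightarrow> vnorm X (cls M u) = nrm u"
  unfolding cls_def nrm_def by (rule vnorm_class) (simp add: V_def)

lemma vzero_X: "vzero X = cls M (\<lambda>_. 0)"
  by (simp add: class_space_def cls_def zero_ereal_def)

lemma vadd_cls:
  assumes uv: "u \<in> V" "v \<in> V"
  shows "vadd X (cls M u) (cls M v) = cls M (\<lambda>t. u t + v t)"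
proof -
  have [measurable]: "u \<in> borel_measurable M" "v \<in> borel_measurable M"
    using uv by (auto simp: V_def)
  have "ae_rel M `` {\<lambda>t. f t + g t} = cls M (\<lambda>t. u t + v t)"
    if "f \<in> cls M u" "g \<in> cls M v" for f g
  proof -
    have [measurable]: "f \<in> borel_measurable M" "g \<in> borel_measurable M"
      and ae: "AE t in M. ereal (u t) = f t" "AE t in M. ereal (v t) = g t"
      using that by (auto simp: in_cls_iff)
    have "AE t in M. f t + g t = ereal (u t + v t)"
      using ae by eventually_elim (metis plus_ereal.simps(1))
    then have "(\<lambda>t. f t + g t, \<lambda>t. ereal (u t + v t)) \<in> ae_rel M" by (simp add: ae_rel_def)
    then show ?thesis unfolding cls_def using equiv_ae_rel by (metis equiv_class_eq)
  qed
  moreover have "(\<lambda>t. ereal (u t)) \<in> cls M u" "(\<lambda>t. ereal (v t)) \<in> cls M v"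
    by (auto simp: in_cls_iff)
  ultimately show ?thesis by (auto simp: class_space_def)
qed

lemma vscale_cls:
  assumes u: "u \<in> V"
  shows "vscale X c (cls M u) = cls M (\<lambda>t. c * u t)"
proof -
  have [measurable]: "u \<in> borel_measurable M" using u by (auto simp: V_def)
  have "ae_rel M `` {\<lambda>t. ereal c * f t} = cls M (\<lambda>t. c * u t)" if "f \<in> cls M u" for f
  proof -
    have [measurable]: "f \<in> borel_measurable M" and ae: "AE t in M. ereal (u t) = f t"
      using that by (auto simp: in_cls_iff)
    have "AE t in M. ereal c * f t = ereal (c * u t)"
      using ae by eventually_elim (metis times_ereal.simps(1))
    then have "(\<lambda>t. ereal c * f t, \<lambda>t. ereal (c * u t)) \<in> ae_rel M" by (simp add: ae_rel_def)
    then show ?thesis unfolding cls_def using equiv_ae_rel by (metis equiv_class_eq)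
  qed
  moreover have "(\<lambda>t. ereal (u t)) \<in> cls M u" by (auto simp: in_cls_iff)
  ultimately show ?thesis by (auto simp: class_space_def)
qed

lemma cls_eq_V: "u \<in> V \<Longrightarrow> v \<in> V \<Longrightarrow> cls M u = cls M v \<longleftrightarrow> (AE t in M. u t = v t)"
  by (rule cls_eq_iff) (auto simp: V_def)

text \<open>
  The Daugavet equation for \<open>- P\<close> with \<open>P\<close> the averaging projection onto the multiples of \<open>\<one>\<^sub>A\<close>. As
  \<open>P\<close> fixes \<open>\<one>\<^sub>A\<close>, its norm is at least one, so \<open>\<parallel>I - P\<parallel> \<ge> 2\<close>.
\<close>

lemma daugavet_averaging:
  assumes dp: "daugavet_property X"
    and A [measurable]: "A \<in> sets M" and m: "emeasure M A = ennreal m" "0 < m"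
    and ind: "indicator A \<in> V"
    and int: "\<And>u. u \<in> V \<Longrightarrow> set_integrable M A u"
    and bound: "\<And>u. u \<in> V \<Longrightarrow> \<bar>LINT t:A|M. u t\<bar> \<le> K * nrm u"
    and norm_ind: "\<And>c. nrm (\<lambda>t. c * indicator A t) = \<bar>c\<bar> * n" and n: "0 < n"
    and e: "0 < e"
  shows "\<exists>u\<in>V. nrm u \<le> 1 \<and> 2 - e < nrm (\<lambda>t. u t - (LINT t:A|M. u t) / m * indicator A t)"
proof -
  define avg where "avg u = (LINT t:A|M. u t) / m" for u :: "'a \<Rightarrow> real"
  define P where "P u t = - avg u * indicator A t" for u :: "'a \<Rightarrow> real" and t
  have P_V: "P u \<in> V" if "u \<in> V" for u
    unfolding P_def using ind by (rule V_scale)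
  have avg_cong: "avg u = avg v" if "u \<in> V" "v \<in> V" "AE t in M. u t = v t" for u v
  proof -
    have [measurable]: "u \<in> borel_measurable M" "v \<in> borel_measurable M"
      using that by (auto simp: V_def)
    have "(LINT t:A|M. u t) = (LINT t:A|M. v t)"
      unfolding set_lebesgue_integral_def
    proof (rule integral_cong_AE)
      show "AE t in M. indicat_real A t *\<^sub>R u t = indicat_real A t *\<^sub>R v t"
        using that(3) by eventually_elim simp
    qed measurable
    then show ?thesis by (simp add: avg_def)
  qed
  \<comment> \<open>The operator acts on classes; the average does not depend on the representative chosen.\<close>
  define rep where "rep x = (SOME u. u \<in> V \<and> cls M u = x)" for x
  have rep: "rep (cls M u) \<in> V \<and> cls M (rep (cls M u)) = cls M u" if "u \<in> V" for u
    unfolding rep_def by (rule someI[of "\<lambda>v. v \<in> V \<and> cls M v = cls M u" u]) (simp add: that)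
  define T where "T x = cls M (P (rep x))" for x
  have T_cls: "T (cls M u) = cls M (P u)" if "u \<in> V" for u
  proof -
    have "AE t in M. rep (cls M u) t = u t" using cls_eq_V[of "rep (cls M u)" u] rep[OF that] that by blast
    then have "avg (rep (cls M u)) = avg u" by (rule avg_cong[OF conjunct1[OF rep[OF that]] that])
    then show ?thesis by (simp add: T_def P_def[abs_def])
  qed
  have avg_add: "avg (\<lambda>t. u t + v t) = avg u + avg v" if "u \<in> V" "v \<in> V" for u v
    using set_integral_add(2)[OF int[OF that(1)] int[OF that(2)]]
    by (simp add: avg_def add_divide_distrib)
  have avg_scale: "avg (\<lambda>t. c * u t) = c * avg u" for u c
    by (simp add: avg_def)
  have lin: "linear_operator X T"
    unfolding linear_operator_def
  proof (intro conjI allI ballI)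
    fix x y c assume "x \<in> vecs X" "y \<in> vecs X"
    then obtain u v where uv: "u \<in> V" "v \<in> V" "x = cls M u" "y = cls M v" by (auto simp: vecs_X)
    show "T (vadd X x y) = vadd X (T x) (T y)"
      using uv by (simp add: vadd_cls T_cls V_add P_V) (simp add: P_def[abs_def] avg_add algebra_simps)
  next
    fix x c assume "x \<in> vecs X"
    then obtain u where u: "u \<in> V" "x = cls M u" by (auto simp: vecs_X)
    show "T x \<in> vecs X" using u by (simp add: T_cls P_V vecs_X)
    show "T (vscale X c x) = vscale X c (T x)"
      using u by (simp add: vscale_cls T_cls V_scale P_V) (simp add: P_def[abs_def] avg_scale algebra_simps)
  qed
  have nrmP: "nrm (P u) = \<bar>avg u\<bar> * n" for u
    unfolding P_def[abs_def] norm_ind by simp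
  have vnT: "vnorm X (T (cls M u)) = \<bar>avg u\<bar> * n" if "u \<in> V" for u
    using that by (simp add: T_cls vnorm_cls P_V nrmP)
  have bd: "\<bar>avg u\<bar> * n \<le> K / m * n * nrm u" if "u \<in> V" for u
  proof -
    have "\<bar>avg u\<bar> \<le> K * nrm u / m"
      unfolding avg_def using bound[OF that] m by (simp add: divide_right_mono)
    then have "\<bar>avg u\<bar> * n \<le> K * nrm u / m * n" using n by (intro mult_right_mono) auto
    then show ?thesis by (simp add: field_simps)
  qed
  have bop: "bounded_operator X T"
    unfolding bounded_operator_def
  proof (intro conjI lin exI[of _ "K / m * n"] ballI)
    fix x assume "x \<in> vecs X"
    then obtain u where u: "u \<in> V" "x = cls M u" by (auto simp: vecs_X)
    then show "vnorm X (T x) \<le> K / m * n * vnorm X x"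
      using bd[OF u(1)] by (simp add: vnT vnorm_cls)
  qed
  have avg_ind: "avg (indicator A) = 1"
  proof -
    have "(\<lambda>t. indicat_real A t *\<^sub>R indicat_real A t) = indicat_real A"
      by (auto simp: indicator_def)
    moreover have "measure M (A \<inter> space M) = m"
      using m sets.sets_into_space[OF A] by (simp add: measure_def Int_absorb2)
    ultimately show ?thesis
      using m by (simp add: avg_def set_lebesgue_integral_def)
  qed
  have rank: "rank_one X T"
    unfolding rank_one_def
  proof (intro bexI[of _ "cls M (indicator A)"] conjI)
    show "cls M (indicator A) \<noteq> vzero X"
    proof
      assume "cls M (indicator A) = vzero X"
      then have "AE t in M. indicator A t = (0::real)"
        using cls_eq_V[OF ind V_zero] by (simp add: vzero_X)
      then have "AE t in M. t \<notin> A" by (auto simp: indicator_def split: if_splits)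
      then have "emeasure M A = 0" using AE_iff_measurable[OF A, of "\<lambda>t. t \<notin> A"] sets.sets_into_space[OF A] by auto
      with m show False by simp
    qed
    show "T ` vecs X = range (\<lambda>c. vscale X c (cls M (indicator A)))"
    proof (intro equalityI subsetI)
      fix z assume "z \<in> T ` vecs X"
      then obtain u where u: "u \<in> V" "z = T (cls M u)" by (auto simp: vecs_X)
      then have "z = vscale X (- avg u) (cls M (indicator A))"
        using ind by (simp add: T_cls vscale_cls P_def[abs_def])
      then show "z \<in> range (\<lambda>c. vscale X c (cls M (indicator A)))" by blast
    next
      fix z assume "z \<in> range (\<lambda>c. vscale X c (cls M (indicator A)))"
      then obtain c where z: "z = vscale X c (cls M (indicator A))" by blast
      have "(\<lambda>t. - c * indicator A t) \<in> V" using ind by (rule V_scale)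
      moreover have "T (cls M (\<lambda>t. - c * indicator A t)) = z"
        using ind calculation avg_scale[of "- c" "indicator A"]
        by (simp add: z T_cls vscale_cls P_def[abs_def] avg_ind)
      ultimately show "z \<in> T ` vecs X" unfolding vecs_X by blast
    qed
  qed (use ind in \<open>simp add: vecs_X\<close>)
  let ?B = "{x \<in> vecs X. vnorm X x \<le> 1}"
  have "1 \<le> operator_norm X T"
  proof -
    let ?u = "\<lambda>t. (1 / n) * indicator A t"
    have u: "?u \<in> V" using ind by (rule V_scale)
    have "nrm ?u = 1" using n by (simp only: norm_ind) simp
    have "\<bar>LINT t:A|M. ?u t\<bar> \<le> K" using bound[OF u] \<open>nrm ?u = 1\<close> by simp
    then have "0 \<le> K" by (rule order_trans[OF abs_ge_zero])
    have "cls M ?u \<in> ?B" using u \<open>nrm ?u = 1\<close> by (simp add: vnorm_cls vecs_X del: times_divide_eq_left mult_1_left)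
    moreover have "bdd_above ((\<lambda>x. vnorm X (T x)) ` ?B)"
    proof (rule bdd_aboveI2)
      fix x assume "x \<in> ?B"
      then obtain u where u: "u \<in> V" "x = cls M u" "nrm u \<le> 1" by (auto simp: vecs_X vnorm_cls)
      have "K / m * n * nrm u \<le> K / m * n"
        using \<open>0 \<le> K\<close> m n u(3) by (intro mult_left_le) auto
      then show "vnorm X (T x) \<le> K / m * n"
        using bd[OF u(1)] u by (simp add: vnT)
    qed
    ultimately have "vnorm X (T (cls M ?u)) \<le> operator_norm X T"
      unfolding operator_norm_def by (rule cSUP_upper)
    moreover have "avg ?u = 1 / n" unfolding avg_scale avg_ind by simp
    ultimately show ?thesis using vnT[OF u] n by simp
  qed
  moreover have "operator_norm X (\<lambda>x. vadd X x (T x)) = 1 + operator_norm X T"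
    using dp bop rank by (simp add: daugavet_property_def)
  ultimately have ge2: "2 \<le> operator_norm X (\<lambda>x. vadd X x (T x))" by simp
  have vn_sum: "vnorm X (vadd X (cls M u) (T (cls M u))) = nrm (\<lambda>t. u t - avg u * indicator A t)"
    if "u \<in> V" for u
  proof -
    have "vnorm X (vadd X (cls M u) (T (cls M u))) = nrm (\<lambda>t. u t + P u t)"
      using that by (simp add: T_cls vadd_cls P_V vnorm_cls V_add)
    also have "(\<lambda>t. u t + P u t) = (\<lambda>t. u t - avg u * indicator A t)" by (simp add: P_def)
    finally show ?thesis .
  qed
  have "\<exists>x\<in>?B. 2 - e < vnorm X (vadd X x (T x))"
  proof (rule ccontr)
    assume "\<not> ?thesis"
    then have "\<And>x. x \<in> ?B \<Longrightarrow> vnorm X (vadd X x (T x)) \<le> 2 - e" by (auto simp: not_less)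
    moreover have "nrm (\<lambda>t. 0 * indicator A t) = 0" unfolding norm_ind by simp
    then have "cls M (\<lambda>_. 0) \<in> ?B" using V_zero by (simp add: vnorm_cls vecs_X)
    then have "?B \<noteq> {}" by blast
    ultimately have "operator_norm X (\<lambda>x. vadd X x (T x)) \<le> 2 - e"
      unfolding operator_norm_def by (intro cSUP_least) auto
    with ge2 e show False by simp
  qed
  then obtain x where "x \<in> ?B" "2 - e < vnorm X (vadd X x (T x))" by blast
  moreover from this obtain u where "u \<in> V" "x = cls M u" by (auto simp: vecs_X)
  ultimately show ?thesis
    by (intro bexI[of _ u]) (auto simp: vn_sum vnorm_cls avg_def)
qed

end

context ae_space
begin

definition bounded_functional :: "(('a \<Rightarrow> real) \<Rightarrow> real) \<Rightarrow> bool" where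
  "bounded_functional l \<longleftrightarrow>
     (\<forall>u\<in>V. \<forall>v\<in>V. l (\<lambda>t. u t + v t) = l u + l v) \<and>
     (\<forall>c. \<forall>u\<in>V. l (\<lambda>t. c * u t) = c * l u) \<and>
     (\<exists>K\<ge>0. \<forall>u\<in>V. \<bar>l u\<bar> \<le> K * nrm u)"

end

locale ae_normed_space = ae_space +
  assumes nrm_triangle: "u \<in> V \<Longrightarrow> v \<in> V \<Longrightarrow> nrm (\<lambda>t. u t + v t) \<le> nrm u + nrm v"
    and nrm_scale: "u \<in> V \<Longrightarrow> nrm (\<lambda>t. c * u t) = \<bar>c\<bar> * nrm u"
    and nrm_definite: "u \<in> V \<Longrightarrow> nrm u = 0 \<Longrightarrow> AE t in M. u t = 0"
begin

lemma nrm_nonneg: "u \<in> V \<Longrightarrow> 0 \<le> nrm u"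
  using nrm_triangle[of u "\<lambda>t. -1 * u t"] nrm_scale[of u 0] nrm_scale[of u "-1"] V_scale[of u "-1"]
  by simp

text \<open>
  A rank one operator is \<open>u \<mapsto> l u * e\<close> for a bounded functional \<open>l\<close>. The upper estimate is the
  triangle inequality, so it is enough to approach \<open>1 + l u * \<parallel>e\<parallel>\<close> by some \<open>v\<close> in the unit ball for
  each \<open>u\<close> with \<open>l u > 0\<close>; a negative value is turned into a positive one by changing the sign of \<open>u\<close>.
\<close>

lemma daugavet_if_functional:
  assumes step: "\<And>l e u \<delta>. bounded_functional l \<Longrightarrow> e \<in> V \<Longrightarrow> u \<in> V \<Longrightarrow> nrm u \<le> 1 \<Longrightarrow> 0 < l u \<Longrightarrow> 0 < \<delta> \<Longrightarrow>
    \<exists>v\<in>V. nrm v \<le> 1 \<and> 1 + l u * nrm e - \<delta> \<le> nrm (\<lambda>t. v t + l v * e t)"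
  shows "daugavet_property X"
  unfolding daugavet_property_def
proof (intro allI impI, elim conjE)
  fix T assume bop: "bounded_operator X T" and rank: "rank_one X T"
  from rank obtain e0 where e0: "e0 \<in> vecs X" "e0 \<noteq> vzero X"
    and range: "T ` vecs X = range (\<lambda>c. vscale X c e0)" unfolding rank_one_def by blast
  then obtain e where e: "e \<in> V" "e0 = cls M e" by (auto simp: vecs_X)
  have ce: "(\<lambda>t. c * e t) \<in> V" for c by (rule V_scale[OF e(1)])
  have "nrm e \<noteq> 0"
  proof
    assume "nrm e = 0"
    then have "AE t in M. e t = 0" using nrm_definite e by blast
    then have "cls M e = vzero X" using cls_eq_V[OF e(1) V_zero] by (simp add: vzero_X)
    with e0 e show False by simp
  qed
  then have ne: "0 < nrm e" using nrm_nonneg[OF e(1)] by simp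
  have uniq: "a = b" if "cls M (\<lambda>t. a * e t) = cls M (\<lambda>t. b * e t)" for a b
  proof -
    have "AE t in M. a * e t = b * e t" using that cls_eq_V[OF ce ce] by simp
    then have "AE t in M. (a - b) * e t = 0" by eventually_elim (simp add: algebra_simps)
    moreover have "(\<lambda>t. (a - b) * e t) \<in> borel_measurable M" using ce[of "a - b"] by (rule V_meas)
    ultimately have "nrm (\<lambda>t. (a - b) * e t) = nrm (\<lambda>_. 0)"
      by (intro V_cong(2)[OF V_zero]) (auto elim: eventually_mono)
    also have "\<dots> = 0" using nrm_scale[OF V_zero, of 0] by simp
    finally show ?thesis using ne nrm_scale[OF e(1), of "a - b"] by simp
  qed
  define l where "l u = (SOME c. T (cls M u) = cls M (\<lambda>t. c * e t))" for u
  have T_cls: "T (cls M u) = cls M (\<lambda>t. l u * e t)" if "u \<in> V" for u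
  proof -
    have "T (cls M u) \<in> T ` vecs X" using that by (simp add: vecs_X)
    then obtain c where "T (cls M u) = cls M (\<lambda>t. c * e t)"
      unfolding range using vscale_cls[OF e(1)] e(2) by auto
    then show ?thesis unfolding l_def by (rule someI)
  qed
  have lin: "linear_operator X T" and "\<exists>K. \<forall>x\<in>vecs X. vnorm X (T x) \<le> K * vnorm X x"
    using bop by (auto simp: bounded_operator_def)
  then obtain K where K: "\<And>x. x \<in> vecs X \<Longrightarrow> vnorm X (T x) \<le> K * vnorm X x" by blast
  have vnT: "vnorm X (T (cls M u)) = \<bar>l u\<bar> * nrm e" if "u \<in> V" for u
    using that by (simp add: T_cls vnorm_cls ce nrm_scale[OF e(1)])
  have l_add: "l (\<lambda>t. u t + v t) = l u + l v" if uv: "u \<in> V" "v \<in> V" for u v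
  proof (rule uniq)
    have "T (vadd X (cls M u) (cls M v)) = vadd X (T (cls M u)) (T (cls M v))"
      using lin uv by (auto simp: linear_operator_def vecs_X)
    then have "cls M (\<lambda>t. l (\<lambda>t. u t + v t) * e t) = cls M (\<lambda>t. l u * e t + l v * e t)"
      using uv by (simp add: vadd_cls T_cls V_add ce)
    then show "cls M (\<lambda>t. l (\<lambda>t. u t + v t) * e t) = cls M (\<lambda>t. (l u + l v) * e t)"
      by (simp add: distrib_right)
  qed
  have l_scale: "l (\<lambda>t. c * u t) = c * l u" if u: "u \<in> V" for u c
  proof (rule uniq)
    have "T (vscale X c (cls M u)) = vscale X c (T (cls M u))"
      using lin u by (auto simp: linear_operator_def vecs_X)
    then have "cls M (\<lambda>t. l (\<lambda>t. c * u t) * e t) = cls M (\<lambda>t. c * (l u * e t))"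
      using u by (simp add: vscale_cls T_cls V_scale ce)
    then show "cls M (\<lambda>t. l (\<lambda>t. c * u t) * e t) = cls M (\<lambda>t. (c * l u) * e t)"
      by (simp add: mult.assoc)
  qed
  define K' where "K' = \<bar>K\<bar> / nrm e"
  have l_bound: "\<bar>l u\<bar> \<le> K' * nrm u" if u: "u \<in> V" for u
  proof -
    have "\<bar>l u\<bar> * nrm e \<le> K * nrm u"
      using K[of "cls M u"] u by (simp add: vnT vnorm_cls vecs_X)
    also have "\<dots> \<le> \<bar>K\<bar> * nrm u" using nrm_nonneg[OF u] by (intro mult_right_mono) auto
    finally show ?thesis using ne by (simp add: K'_def field_simps)
  qed
  have "0 \<le> K'" using ne by (simp add: K'_def)
  have bf: "bounded_functional l"
    unfolding bounded_functional_def using l_add l_scale l_bound \<open>0 \<le> K'\<close> by blast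
  let ?B = "{x \<in> vecs X. vnorm X x \<le> 1}"
  let ?I = "operator_norm X (\<lambda>x. vadd X x (T x))"
  have ball: "x \<in> ?B \<longleftrightarrow> (\<exists>u\<in>V. nrm u \<le> 1 \<and> x = cls M u)" for x
    by (auto simp: vecs_X vnorm_cls)
  have bdd: "bdd_above ((\<lambda>x. vnorm X (T x)) ` ?B)"
  proof (rule bdd_aboveI2)
    fix x assume "x \<in> ?B"
    then obtain u where u: "u \<in> V" "nrm u \<le> 1" "x = cls M u" unfolding ball by blast
    have "\<bar>l u\<bar> \<le> K'" using l_bound[OF u(1)] u(2) \<open>0 \<le> K'\<close> by (meson mult_left_le order_trans)
    then show "vnorm X (T x) \<le> K' * nrm e" using u ne by (simp add: vnT)
  qed
  have T_le: "\<bar>l u\<bar> * nrm e \<le> operator_norm X T" if "u \<in> V" "nrm u \<le> 1" for u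
  proof -
    have "cls M u \<in> ?B" using that ball by blast
    then have "vnorm X (T (cls M u)) \<le> operator_norm X T"
      unfolding operator_norm_def using bdd by (rule cSUP_upper)
    then show ?thesis using that by (simp add: vnT)
  qed
  have vnI: "vnorm X (vadd X (cls M u) (T (cls M u))) = nrm (\<lambda>t. u t + l u * e t)" if "u \<in> V" for u
    using that by (simp add: T_cls vadd_cls ce vnorm_cls V_add)
  have I_le: "nrm (\<lambda>t. u t + l u * e t) \<le> 1 + operator_norm X T" if u: "u \<in> V" "nrm u \<le> 1" for u
  proof -
    have "nrm (\<lambda>t. u t + l u * e t) \<le> nrm u + \<bar>l u\<bar> * nrm e"
      using nrm_triangle[OF u(1) ce[of "l u"]] nrm_scale[OF e(1)] by simp
    then show ?thesis using u T_le[OF u] by simp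
  qed
  have I_upper: "nrm (\<lambda>t. u t + l u * e t) \<le> ?I" if u: "u \<in> V" "nrm u \<le> 1" for u
  proof -
    have "bdd_above ((\<lambda>x. vnorm X (vadd X x (T x))) ` ?B)"
    proof (rule bdd_aboveI2)
      fix x assume "x \<in> ?B"
      then obtain u where "u \<in> V" "nrm u \<le> 1" "x = cls M u" unfolding ball by blast
      then show "vnorm X (vadd X x (T x)) \<le> 1 + operator_norm X T" using I_le by (simp add: vnI)
    qed
    moreover have "cls M u \<in> ?B" using u ball by blast
    ultimately have "vnorm X (vadd X (cls M u) (T (cls M u))) \<le> ?I"
      unfolding operator_norm_def by (intro cSUP_upper)
    then show ?thesis using u by (simp add: vnI)
  qed
  have I_pos: "1 + l u * nrm e \<le> ?I" if u: "u \<in> V" "nrm u \<le> 1" "0 < l u" for u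
  proof (rule field_le_epsilon)
    fix \<delta> :: real assume "0 < \<delta>"
    from step[OF bf e(1) u this] obtain v where "v \<in> V" "nrm v \<le> 1"
      "1 + l u * nrm e - \<delta> \<le> nrm (\<lambda>t. v t + l v * e t)" by blast
    with I_upper[of v] show "1 + l u * nrm e \<le> ?I + \<delta>" by simp
  qed
  have I_abs: "1 + \<bar>l u\<bar> * nrm e \<le> ?I" if u: "u \<in> V" "nrm u \<le> 1" "l u \<noteq> 0" for u
  proof -
    define v where "v t = sgn (l u) * u t" for t
    have v: "v \<in> V" unfolding v_def[abs_def] by (rule V_scale[OF u(1)])
    moreover have "nrm v \<le> 1"
      unfolding v_def[abs_def] nrm_scale[OF u(1)] using u by (simp add: abs_sgn_eq)
    moreover have "l v = \<bar>l u\<bar>"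
      unfolding v_def[abs_def] l_scale[OF u(1)] by (simp add: abs_sgn mult.commute)
    ultimately show ?thesis using I_pos[of v] u by simp
  qed
  have "\<exists>u\<in>V. nrm u \<le> 1 \<and> l u \<noteq> 0"
  proof -
    have "cls M e \<in> T ` vecs X"
      unfolding range using vscale_cls[OF e(1), of 1] e(2) by (simp add: image_iff) metis
    then obtain u where u: "u \<in> V" "T (cls M u) = cls M (\<lambda>t. 1 * e t)" by (auto simp: vecs_X)
    then have lu: "l u = 1" using uniq[of "l u" 1] by (simp add: T_cls)
    \<comment> \<open>Dividing by \<open>1 + nrm u\<close> brings \<open>u\<close> into the unit ball whatever its norm.\<close>
    define v where "v t = 1 / (1 + nrm u) * u t" for t
    have n: "0 \<le> nrm u" by (rule nrm_nonneg[OF u(1)])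
    have "v \<in> V" unfolding v_def[abs_def] by (rule V_scale[OF u(1)])
    moreover have "nrm v \<le> 1" unfolding v_def[abs_def] nrm_scale[OF u(1)] using n by simp
    moreover have "l v \<noteq> 0" unfolding v_def[abs_def] l_scale[OF u(1)] using n lu by simp
    ultimately show ?thesis by blast
  qed
  then have I1: "1 \<le> ?I" using I_abs ne by (meson le_add_same_cancel1 mult_nonneg_nonneg abs_ge_zero less_imp_le order_trans)
  have ne_B: "?B \<noteq> {}"
  proof -
    have "nrm (\<lambda>_. 0) = 0" using nrm_scale[OF V_zero, of 0] by simp
    then show ?thesis using ball V_zero by fastforce
  qed
  show "?I = 1 + operator_norm X T"
  proof (rule antisym)
    show "?I \<le> 1 + operator_norm X T"
      unfolding operator_norm_def[of X "\<lambda>x. vadd X x (T x)"]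
    proof (rule cSUP_least[OF ne_B])
      fix x assume "x \<in> ?B"
      then obtain u where "u \<in> V" "nrm u \<le> 1" "x = cls M u" unfolding ball by blast
      then show "vnorm X (vadd X x (T x)) \<le> 1 + operator_norm X T" using I_le by (simp add: vnI)
    qed
    have "operator_norm X T \<le> ?I - 1"
      unfolding operator_norm_def[of X T]
    proof (rule cSUP_least[OF ne_B])
      fix x assume "x \<in> ?B"
      then obtain u where u: "u \<in> V" "nrm u \<le> 1" "x = cls M u" unfolding ball by blast
      show "vnorm X (T x) \<le> ?I - 1"
        using I_abs[OF u(1,2)] I1 u by (cases "l u = 0") (auto simp: vnT)
    qed
    then show "1 + operator_norm X T \<le> ?I" by simp
  qed
qed

end

section \<open>The Daugavet property of weighted integrable and bounded functions\<close>

context ae_space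
begin

text \<open>
  Fix a functional \<open>l\<close> and split the support of \<open>v\<close> in two. The norm is additive on the two pieces,
  hence on one of them \<open>l\<close> is at least as large relative to the norm as on \<open>v\<close>. Halving \<open>\<integral>\<bar>e\<bar>\<close> each
  time, one reaches a normalized \<open>w\<close> with \<open>l w \<ge> l u\<close> that lives on a set where \<open>e\<close> has almost no
  mass, and \<open>w + l w * e\<close> has norm almost \<open>\<parallel>w\<parallel> + l w * \<parallel>e\<parallel>\<close>.
\<close>

lemma daugavet_L1:
  assumes na: "nonatomic M" and c: "0 < c"
    and V_iff: "\<And>u. u \<in> V \<longleftrightarrow> integrable M u"
    and nrm_eq: "\<And>u. u \<in> V \<Longrightarrow> nrm u = c * (\<integral>t. \<bar>u t\<bar> \<partial>M)"
  shows "daugavet_property X"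
proof -
  interpret n: ae_normed_space M F N
  proof unfold_locales
    fix u v assume uv: "u \<in> V" "v \<in> V"
    have "(\<integral>t. \<bar>u t + v t\<bar> \<partial>M) \<le> (\<integral>t. \<bar>u t\<bar> + \<bar>v t\<bar> \<partial>M)"
      using uv V_iff by (intro integral_mono) auto
    also have "\<dots> = (\<integral>t. \<bar>u t\<bar> \<partial>M) + (\<integral>t. \<bar>v t\<bar> \<partial>M)"
      using uv V_iff by (intro Bochner_Integration.integral_add) auto
    finally have "c * (\<integral>t. \<bar>u t + v t\<bar> \<partial>M) \<le> c * ((\<integral>t. \<bar>u t\<bar> \<partial>M) + (\<integral>t. \<bar>v t\<bar> \<partial>M))"
      using c by simp
    then show "nrm (\<lambda>t. u t + v t) \<le> nrm u + nrm v"
      using uv by (simp add: nrm_eq V_add distrib_left)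
  next
    fix u d assume u: "u \<in> V"
    show "nrm (\<lambda>t. d * u t) = \<bar>d\<bar> * nrm u"
      using u by (simp add: nrm_eq V_scale abs_mult)
  next
    fix u assume u: "u \<in> V" "nrm u = 0"
    then have "(\<integral>t. \<bar>u t\<bar> \<partial>M) = 0" using c by (simp add: nrm_eq)
    then show "AE t in M. u t = 0"
      using u V_iff integral_nonneg_eq_0_iff_AE[of M "\<lambda>t. \<bar>u t\<bar>"] by simp
  qed
  show ?thesis
  proof (rule n.daugavet_if_functional)
    fix l e u and \<delta> :: real
    assume l: "bounded_functional l" and e: "e \<in> V" and u: "u \<in> V" "nrm u \<le> 1" "0 < l u"
      and \<delta>: "0 < \<delta>"
    have ie: "integrable M e" using e V_iff by simp
    from l obtain K where K: "0 \<le> K" "\<And>u. u \<in> V \<Longrightarrow> \<bar>l u\<bar> \<le> K * nrm u"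
      and l_add: "\<And>u v. u \<in> V \<Longrightarrow> v \<in> V \<Longrightarrow> l (\<lambda>t. u t + v t) = l u + l v"
      and l_scale: "\<And>a u. u \<in> V \<Longrightarrow> l (\<lambda>t. a * u t) = a * l u"
      unfolding bounded_functional_def by blast
    have concentrate: "\<exists>v\<in>V. \<exists>A\<in>sets M. nrm v \<le> 1 \<and> l u \<le> l v \<and> (\<forall>t. t \<notin> A \<longrightarrow> v t = 0) \<and>
        (LINT t:A|M. \<bar>e t\<bar>) \<le> (\<integral>t. \<bar>e t\<bar> \<partial>M) / 2 ^ n" for n
    proof (induction n)
      case 0
      define v where "v t = indicator (space M) t * u t" for t
      have eq: "AE t in M. u t = v t" by (rule AE_I2) (simp add: v_def)
      have vm: "v \<in> borel_measurable M"
        using V_meas[OF u(1)] unfolding v_def[abs_def] by measurable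
      have "v \<in> V" "nrm v = nrm u" using V_cong[OF u(1) vm eq] by auto
      moreover have "l v = l u"
      proof -
        have "(\<lambda>t. u t + (-1) * v t) \<in> V" using u(1) V_scale[OF \<open>v \<in> V\<close>, of "-1"] by (rule V_add)
        moreover have "nrm (\<lambda>t. u t + (-1) * v t) = nrm (\<lambda>_. 0)"
          using eq by (intro V_cong(2)[OF V_zero] V_meas[OF calculation]) (auto elim: eventually_mono)
        moreover have "nrm (\<lambda>_. 0) = 0" using nrm_eq[OF V_zero] by simp
        ultimately have "l (\<lambda>t. u t + (-1) * v t) = 0" using K(2) by fastforce
        then show ?thesis
          using l_add[OF u(1) V_scale[OF \<open>v \<in> V\<close>, of "-1"]] l_scale[OF \<open>v \<in> V\<close>, of "-1"] by simp
      qed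
      moreover have "(LINT t:space M|M. \<bar>e t\<bar>) = (\<integral>t. \<bar>e t\<bar> \<partial>M)"
        unfolding set_lebesgue_integral_def by (intro Bochner_Integration.integral_cong) auto
      moreover have "\<forall>t. t \<notin> space M \<longrightarrow> v t = 0" by (simp add: v_def)
      ultimately show ?case using u by (intro bexI[of _ v] bexI[of _ "space M"]) auto
    next
      case (Suc n)
      then obtain v A where v: "v \<in> V" "nrm v \<le> 1" "l u \<le> l v" "\<And>t. t \<notin> A \<Longrightarrow> v t = 0"
        and A: "A \<in> sets M" "(LINT t:A|M. \<bar>e t\<bar>) \<le> (\<integral>t. \<bar>e t\<bar> \<partial>M) / 2 ^ n" by blast
      obtain B where B: "B \<in> sets M" "B \<subseteq> A" "(LINT t:B|M. \<bar>e t\<bar>) = (LINT t:A|M. \<bar>e t\<bar>) / 2"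
        using halve_integral[OF na ie A(1)] .
      have "(LINT t:A|M. \<bar>e t\<bar>) = (LINT t:B \<union> (A - B)|M. \<bar>e t\<bar>)" using B by (simp add: Un_absorb1)
      also have "\<dots> = (LINT t:B|M. \<bar>e t\<bar>) + (LINT t:A - B|M. \<bar>e t\<bar>)"
        using A B ie by (intro set_integral_Un)
          (auto simp: set_integrable_def mult.commute intro!: integrable_real_mult_indicator)
      finally have half: "(LINT t:A - B|M. \<bar>e t\<bar>) = (LINT t:A|M. \<bar>e t\<bar>) / 2" using B by simp
      define p q where "p t = indicator B t * v t" and "q t = indicator (A - B) t * v t" for t
      have iv: "integrable M v" using v V_iff by simp
      have pq: "p \<in> V" "q \<in> V"
        unfolding V_iff p_def[abs_def] q_def[abs_def] using A B iv
        by (auto simp: mult.commute intro!: integrable_real_mult_indicator)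
      have sum: "v = (\<lambda>t. p t + q t)"
      proof
        fix t show "v t = p t + q t"
          using v(4)[of t] B(2) by (auto simp: p_def q_def indicator_def)
      qed
      have lv: "l v = l p + l q" unfolding sum by (rule l_add[OF pq])
      have "(\<integral>t. \<bar>v t\<bar> \<partial>M) = (\<integral>t. \<bar>p t\<bar> + \<bar>q t\<bar> \<partial>M)"
        using v(4) B(2) by (intro Bochner_Integration.integral_cong) (auto simp: p_def q_def indicator_def)
      also have "\<dots> = (\<integral>t. \<bar>p t\<bar> \<partial>M) + (\<integral>t. \<bar>q t\<bar> \<partial>M)"
        using pq V_iff by (intro Bochner_Integration.integral_add) auto
      finally have nv: "nrm v = nrm p + nrm q" using v pq by (simp add: nrm_eq distrib_left)
      \<comment> \<open>Pieces that remain admissible after normalization.\<close>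
      define good where "good w \<longleftrightarrow> 0 < nrm w \<and> nrm w * l u \<le> l w" for w
      have bad: "l w \<le> nrm w * l u \<and> (l w = nrm w * l u \<longrightarrow> nrm w = 0 \<and> l w = 0)"
        if "w \<in> V" "\<not> good w" for w
      proof (cases "nrm w = 0")
        case True
        then show ?thesis using K(2)[OF that(1)] by simp
      next
        case False
        then show ?thesis using that n.nrm_nonneg[OF that(1)] by (simp add: good_def)
      qed
      have "good p \<or> good q"
      proof (rule ccontr)
        assume neg: "\<not> ?thesis"
        have "nrm v * l u \<le> 1 * l u" using v(2) u(3) by (intro mult_right_mono) auto
        then have "nrm p * l u + nrm q * l u \<le> l p + l q"
          using v(3) by (simp add: lv nv distrib_right)
        then have "l p + l q = 0" using bad[OF pq(1)] bad[OF pq(2)] neg by linarith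
        with lv v(3) u(3) show False by simp
      qed
      then obtain w C where w: "w \<in> V" "good w" and C: "C \<in> sets M" "\<And>t. t \<notin> C \<Longrightarrow> w t = 0"
        "(LINT t:C|M. \<bar>e t\<bar>) = (LINT t:A|M. \<bar>e t\<bar>) / 2"
      proof
        assume "good p"
        then show thesis using that[of p B] pq B by (simp add: p_def)
      next
        assume "good q"
        then show thesis using that[of q "A - B"] pq A B half by (simp add: q_def)
      qed
      have nw: "0 < nrm w" "nrm w * l u \<le> l w" using w by (auto simp: good_def)
      let ?w = "\<lambda>t. (1 / nrm w) * w t"
      have "nrm ?w \<le> 1" unfolding n.nrm_scale[OF w(1)] using nw by simp
      moreover have "l u \<le> l ?w" unfolding l_scale[OF w(1)] using nw by (simp add: field_simps)
      moreover have "?w \<in> V" using w(1) by (rule V_scale)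
      moreover have "(LINT t:C|M. \<bar>e t\<bar>) \<le> (\<integral>t. \<bar>e t\<bar> \<partial>M) / 2 ^ Suc n"
        unfolding C(3) using A(2) by simp
      ultimately show ?case using C by (intro bexI[of _ ?w] bexI[of _ C]) auto
    qed
    define I where "I = (\<integral>t. \<bar>e t\<bar> \<partial>M)"
    \<comment> \<open>Overlapping mass of \<open>w\<close> and \<open>l w * e\<close> counts twice and \<open>l w \<le> K\<close>, whence the constant.\<close>
    obtain n where n: "2 * K * c * I / \<delta> < 2 ^ n" using real_arch_pow[of 2] by fastforce
    then have small: "2 * K * c * (I / 2 ^ n) \<le> \<delta>" using \<delta> by (simp add: field_simps)
    from concentrate[of n] obtain v A where v: "v \<in> V" "nrm v \<le> 1" "l u \<le> l v" "\<And>t. t \<notin> A \<Longrightarrow> v t = 0"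
      and A: "A \<in> sets M" "(LINT t:A|M. \<bar>e t\<bar>) \<le> I / 2 ^ n" unfolding I_def by blast
    have nv: "0 < nrm v"
      using K(2)[OF v(1)] K(1) v(3) u(3) n.nrm_nonneg[OF v(1)] by (cases "nrm v = 0") auto
    define w where "w t = (1 / nrm v) * v t" for t
    have w: "w \<in> V" "nrm w = 1" "l w = l v / nrm v"
      unfolding w_def[abs_def] 
      using V_scale[OF v(1), of "1 / nrm v"] n.nrm_scale[OF v(1), of "1 / nrm v"]
        l_scale[OF v(1), of "1 / nrm v"] nv by simp_all
    have lw: "l u \<le> l w"
    proof -
      have "l v * nrm v \<le> l v * 1" using v u by (intro mult_left_mono) auto
      then have "l v \<le> l w" using nv by (simp add: w(3) field_simps)
      with v(3) show ?thesis by simp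
    qed
    have lwK: "l w \<le> K" using K(2)[OF w(1)] w(2) by simp
    have lw0: "0 < l w" using lw u(3) by simp
    have we: "(\<lambda>t. w t + l w * e t) \<in> V" using w(1) V_scale[OF e] by (rule V_add)
    have iw: "integrable M w" using w V_iff by simp
    have iA: "integrable M (\<lambda>t. indicator A t * \<bar>e t\<bar>)"
      using integrable_real_mult_indicator[OF A(1) integrable_abs[OF ie]] by (simp add: mult.commute)
    have "(\<integral>t. \<bar>w t\<bar> + l w * \<bar>e t\<bar> - 2 * l w * (indicator A t * \<bar>e t\<bar>) \<partial>M) \<le> (\<integral>t. \<bar>w t + l w * e t\<bar> \<partial>M)"
    proof (rule integral_mono)
      show "integrable M (\<lambda>t. \<bar>w t\<bar> + l w * \<bar>e t\<bar> - 2 * l w * (indicator A t * \<bar>e t\<bar>))"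
        using iw ie iA by (intro Bochner_Integration.integrable_diff Bochner_Integration.integrable_add) auto
      show "integrable M (\<lambda>t. \<bar>w t + l w * e t\<bar>)" using we V_iff by simp
      fix t
      have "\<bar>l w * e t\<bar> = l w * \<bar>e t\<bar>" using lw0 by (simp add: abs_mult)
      then show "\<bar>w t\<bar> + l w * \<bar>e t\<bar> - 2 * l w * (indicator A t * \<bar>e t\<bar>) \<le> \<bar>w t + l w * e t\<bar>"
        using v(4)[of t] by (cases "t \<in> A") (auto simp: w_def)
    qed
    also have "(\<integral>t. \<bar>w t\<bar> + l w * \<bar>e t\<bar> - 2 * l w * (indicator A t * \<bar>e t\<bar>) \<partial>M)
        = (\<integral>t. \<bar>w t\<bar> \<partial>M) + l w * I - 2 * l w * (LINT t:A|M. \<bar>e t\<bar>)"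
      using iw ie iA by (simp add: I_def set_lebesgue_integral_def)
    finally have "c * ((\<integral>t. \<bar>w t\<bar> \<partial>M) + l w * I - 2 * l w * (LINT t:A|M. \<bar>e t\<bar>))
        \<le> c * (\<integral>t. \<bar>w t + l w * e t\<bar> \<partial>M)" using c by simp
    then have "nrm w + l w * nrm e - 2 * l w * c * (LINT t:A|M. \<bar>e t\<bar>) \<le> nrm (\<lambda>t. w t + l w * e t)"
      using we w(1) e by (simp add: nrm_eq I_def algebra_simps)
    moreover have "2 * l w * c * (LINT t:A|M. \<bar>e t\<bar>) \<le> 2 * K * c * (I / 2 ^ n)"
      using A(2) lwK lw0 c
      by (intro mult_mono) (auto simp: set_lebesgue_integral_def)
    moreover have "l u * nrm e \<le> l w * nrm e"
      using lw n.nrm_nonneg[OF e] by (intro mult_right_mono) auto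
    ultimately have "1 + l u * nrm e - \<delta> \<le> nrm (\<lambda>t. w t + l w * e t)"
      using small w(2) by linarith
    then show "\<exists>v\<in>V. nrm v \<le> 1 \<and> 1 + l u * nrm e - \<delta> \<le> nrm (\<lambda>t. v t + l v * e t)"
      using w by (intro bexI[of _ w]) auto
  qed
qed

text \<open>
  Replacing \<open>u\<close> on a set \<open>A\<close> by a constant of norm one adds to it a function \<open>h\<close> supported on \<open>A\<close>
  of norm at most \<open>2\<close>. If \<open>A\<close> lies where \<open>\<bar>e\<bar>\<close> is nearly maximal and the constant has the sign of \<open>e\<close>,
  the norm of the sum with \<open>l v * e\<close> is nearly \<open>1 + l v * \<parallel>e\<parallel>\<close>. The value \<open>l h\<close> is small for suitable
  \<open>A\<close>: if \<open>l\<close> took values above \<open>D\<close> on functions of norm at most \<open>2\<close> supported in each of two disjoint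
  halves, then their sum, again of norm at most \<open>2\<close>, would have a value above \<open>2 * D\<close>.
\<close>

lemma daugavet_Linf:
  assumes na: "nonatomic M" and c: "0 < c"
    and V_iff: "\<And>u. u \<in> V \<longleftrightarrow> u \<in> borel_measurable M \<and> (\<exists>C. AE t in M. \<bar>u t\<bar> \<le> C)"
    and nrm_pos: "\<And>u. u \<in> V \<Longrightarrow> 0 \<le> nrm u"
    and nrm_le: "\<And>u C. u \<in> V \<Longrightarrow> 0 \<le> C \<Longrightarrow> nrm u \<le> C \<longleftrightarrow> (AE t in M. c * \<bar>u t\<bar> \<le> C)"
    and nontriv: "emeasure M (space M) \<noteq> 0"
  shows "daugavet_property X"
proof -
  have nrm_bound: "AE t in M. c * \<bar>u t\<bar> \<le> nrm u" if "u \<in> V" for u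
    using nrm_le[OF that nrm_pos[OF that]] by simp
  have scale_le: "nrm (\<lambda>t. d * u t) \<le> \<bar>d\<bar> * nrm u" if "u \<in> V" for u d
  proof -
    have "AE t in M. c * \<bar>d * u t\<bar> \<le> \<bar>d\<bar> * nrm u"
      using nrm_bound[OF that]
    proof eventually_elim
      case (elim t)
      then have "\<bar>d\<bar> * (c * \<bar>u t\<bar>) \<le> \<bar>d\<bar> * nrm u" by (rule mult_left_mono) simp
      then show ?case by (simp add: abs_mult mult.left_commute)
    qed
    then show ?thesis using nrm_le[OF V_scale[OF that]] nrm_pos[OF that] by simp
  qed
  interpret n: ae_normed_space M F N
  proof unfold_locales
    fix u v assume uv: "u \<in> V" "v \<in> V"
    have "AE t in M. c * \<bar>u t + v t\<bar> \<le> nrm u + nrm v"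
      using nrm_bound[OF uv(1)] nrm_bound[OF uv(2)]
    proof eventually_elim
      case (elim t)
      have "c * \<bar>u t + v t\<bar> \<le> c * (\<bar>u t\<bar> + \<bar>v t\<bar>)" using c by (intro mult_left_mono abs_triangle_ineq) auto
      with elim show ?case by (simp add: distrib_left)
    qed
    then show "nrm (\<lambda>t. u t + v t) \<le> nrm u + nrm v"
      using nrm_le[OF V_add[OF uv]] nrm_pos uv by simp
  next
    fix u d assume u: "u \<in> V"
    show "nrm (\<lambda>t. d * u t) = \<bar>d\<bar> * nrm u"
    proof (cases "d = 0")
      case True
      then show ?thesis using scale_le[OF u, of 0] nrm_pos[OF V_scale[OF u, of 0]] by simp
    next
      case False
      have "nrm (\<lambda>t. 1 / d * (d * u t)) \<le> \<bar>1 / d\<bar> * nrm (\<lambda>t. d * u t)"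
        by (rule scale_le[OF V_scale[OF u]])
      then have "\<bar>d\<bar> * nrm u \<le> nrm (\<lambda>t. d * u t)" using False by (simp add: field_simps)
      with scale_le[OF u] show ?thesis by (rule antisym)
    qed
  next
    fix u assume u: "u \<in> V" "nrm u = 0"
    show "AE t in M. u t = 0"
      using nrm_bound[OF u(1)] unfolding u(2)
    proof eventually_elim
      case (elim t)
      then show ?case using c by (simp add: mult_le_0_iff)
    qed
  qed
  have nrm_ge: "r \<le> nrm w"
    if w: "w \<in> V" and A: "A \<in> sets M" "0 < emeasure M A" and ge: "\<And>t. t \<in> A \<Longrightarrow> r \<le> c * \<bar>w t\<bar>" for r w A
  proof (rule ccontr)
    assume "\<not> r \<le> nrm w"
    then have "AE t in M. t \<notin> A"
      using nrm_bound[OF w] by (auto elim!: eventually_mono dest: ge)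
    then have "emeasure M A = 0"
      using AE_iff_measurable[OF A(1), of "\<lambda>t. t \<notin> A"] sets.sets_into_space[OF A(1)] by auto
    with A(2) show False by simp
  qed
  show ?thesis
  proof (rule n.daugavet_if_functional)
    fix l e u and \<delta> :: real
    assume l: "bounded_functional l" and e: "e \<in> V" and u: "u \<in> V" "nrm u \<le> 1" "0 < l u"
      and \<delta>: "0 < \<delta>"
    from l obtain K where K: "0 \<le> K" "\<And>u. u \<in> V \<Longrightarrow> \<bar>l u\<bar> \<le> K * nrm u"
      and l_add: "\<And>u v. u \<in> V \<Longrightarrow> v \<in> V \<Longrightarrow> l (\<lambda>t. u t + v t) = l u + l v"
      and l_scale: "\<And>a u. u \<in> V \<Longrightarrow> l (\<lambda>t. a * u t) = a * l u"
      unfolding bounded_functional_def by blast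
    have [measurable]: "e \<in> borel_measurable M" "u \<in> borel_measurable M"
      using e u(1) by (auto dest: V_meas)
    \<comment> \<open>The tolerance \<open>\<delta>\<close> is shared by \<open>\<eta>\<close>, the defect of \<open>e\<close> from its maximum on \<open>A\<close>,
    and \<open>\<kappa>\<close>, the admissible change of \<open>l\<close>. The summands \<open>1\<close> avoid a zero denominator.\<close>
    define \<eta> where "\<eta> = \<delta> / (2 * (l u + 1))"
    have \<eta>: "0 < \<eta>" "l u * \<eta> \<le> \<delta> / 2"
      using \<delta> u(3) by (auto simp: \<eta>_def field_simps)
    have ne: "0 \<le> nrm e" by (rule nrm_pos[OF e])
    define \<kappa> where "\<kappa> = min (l u) (\<delta> / (2 * (nrm e + 1)))"
    have \<kappa>: "0 < \<kappa>" "\<kappa> \<le> l u" "\<kappa> * nrm e \<le> \<delta> / 2"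
    proof -
      show "0 < \<kappa>" "\<kappa> \<le> l u" using \<delta> u(3) ne by (auto simp: \<kappa>_def)
      have "\<kappa> * nrm e \<le> \<delta> / (2 * (nrm e + 1)) * nrm e"
        using ne by (intro mult_right_mono) (auto simp: \<kappa>_def)
      also have "\<dots> \<le> \<delta> / 2" using ne \<delta> by (simp add: field_simps)
      finally show "\<kappa> * nrm e \<le> \<delta> / 2" .
    qed
    \<comment> \<open>On \<open>peak s\<close> the constant \<open>s / c\<close> has the sign of \<open>e\<close>, so no cancellation occurs.\<close>
    define peak where "peak s = {t \<in> space M. nrm e - \<eta> \<le> c * \<bar>e t\<bar> \<and> 0 \<le> s * e t}" for s :: real
    have peak_sets [measurable]: "peak s \<in> sets M" for s unfolding peak_def by measurable
    have "\<exists>s. \<bar>s\<bar> = 1 \<and> 0 < emeasure M (peak s)"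
    proof (rule ccontr)
      assume none: "\<not> ?thesis"
      have "emeasure M (peak 1) = 0" "emeasure M (peak (-1)) = 0"
        using none by (auto simp: zero_less_iff_neq_zero)
      then have "AE t in M. t \<notin> peak 1" "AE t in M. t \<notin> peak (-1)"
        by (auto intro!: AE_not_in simp: null_sets_def)
      then have ae: "AE t in M. c * \<bar>e t\<bar> < nrm e - \<eta>"
        using AE_space
      proof eventually_elim
        case (elim t)
        then show ?case by (cases "0 \<le> e t") (auto simp: peak_def not_le)
      qed
      show False
      proof (cases "0 \<le> nrm e - \<eta>")
        case True
        have "AE t in M. c * \<bar>e t\<bar> \<le> nrm e - \<eta>" using ae by eventually_elim simp
        then have "nrm e \<le> nrm e - \<eta>" using nrm_le[OF e True] by simp
        with \<eta> show False by simp
      next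
        case False
        have "AE t in M. False"
          using ae
        proof eventually_elim
          case (elim t)
          moreover have "0 \<le> c * \<bar>e t\<bar>" using c by simp
          ultimately show ?case using False by linarith
        qed
        then show False using nontriv by (simp add: AE_iff_measurable[OF sets.top])
      qed
    qed
    then obtain s where s: "\<bar>s\<bar> = 1" "0 < emeasure M (peak s)" by blast
    have s2: "s * s = 1" using s(1) by (auto simp: abs_if split: if_splits)
    have shrink: "\<exists>A\<in>sets M. A \<subseteq> peak s \<and> 0 < emeasure M A \<and>
        (\<forall>h\<in>V. (\<forall>t. t \<notin> A \<longrightarrow> h t = 0) \<and> nrm h \<le> 2 \<longrightarrow> \<bar>l h\<bar> \<le> 2 * K / 2 ^ n)" for n
    proof (induction n)
      case 0
      have "\<bar>l h\<bar> \<le> 2 * K" if "h \<in> V" "nrm h \<le> 2" for h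
      proof -
        have "K * nrm h \<le> K * 2" using K(1) that by (intro mult_left_mono) auto
        with K(2)[OF that(1)] show ?thesis by simp
      qed
      then show ?case using s by (intro bexI[of _ "peak s"]) auto
    next
      case (Suc n)
      then obtain A where A: "A \<in> sets M" "A \<subseteq> peak s" "0 < emeasure M A"
        and small: "\<And>h. h \<in> V \<Longrightarrow> (\<And>t. t \<notin> A \<Longrightarrow> h t = 0) \<Longrightarrow> nrm h \<le> 2 \<Longrightarrow> \<bar>l h\<bar> \<le> 2 * K / 2 ^ n"
        by blast
      from nonatomic_split[OF na A(1,3)] obtain B where B: "B \<in> sets M" "B \<subseteq> A"
        "0 < emeasure M B" "0 < emeasure M (A - B)" .
      define D where "D = 2 * K / 2 ^ Suc n"
      show ?case
      proof (rule ccontr)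
        assume neg: "\<not> ?thesis"
        have "\<exists>h\<in>V. (\<forall>t. t \<notin> C \<longrightarrow> h t = 0) \<and> nrm h \<le> 2 \<and> D < l h"
          if C: "C \<in> sets M" "C \<subseteq> A" "0 < emeasure M C" for C
        proof -
          have "C \<subseteq> peak s" using C A by blast
          with neg C obtain h where h: "h \<in> V" "\<forall>t. t \<notin> C \<longrightarrow> h t = 0" "nrm h \<le> 2" "D < \<bar>l h\<bar>"
            unfolding D_def by (meson not_le)
          show ?thesis
          proof (cases "0 \<le> l h")
            case True
            then show ?thesis using h by auto
          next
            case False
            then show ?thesis
              using h V_scale[OF h(1), of "-1"] n.nrm_scale[OF h(1), of "-1"] l_scale[OF h(1), of "-1"]
              by (intro bexI[of _ "\<lambda>t. -1 * h t"]) auto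
          qed
        qed
        from this[OF B(1,2,3)] this[of "A - B"] obtain p q where
          p: "p \<in> V" "\<And>t. t \<notin> B \<Longrightarrow> p t = 0" "nrm p \<le> 2" "D < l p" and
          q: "q \<in> V" "\<And>t. t \<notin> A - B \<Longrightarrow> q t = 0" "nrm q \<le> 2" "D < l q"
          using A B by (metis Diff_subset sets.Diff)
        have "AE t in M. c * \<bar>p t + q t\<bar> \<le> 2"
          using nrm_bound[OF p(1)] nrm_bound[OF q(1)]
        proof eventually_elim
          case (elim t)
          then show ?case using p(2)[of t] q(2)[of t] p(3) q(3) by (cases "t \<in> B") auto
        qed
        then have "nrm (\<lambda>t. p t + q t) \<le> 2" using nrm_le[OF V_add[OF p(1) q(1)]] by simp
        then have "\<bar>l (\<lambda>t. p t + q t)\<bar> \<le> 2 * K / 2 ^ n"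
          using p(2) q(2) B(2) by (intro small V_add p(1) q(1)) auto
        then show False using p(4) q(4) by (simp add: l_add[OF p(1) q(1)] D_def)
      qed
    qed
    obtain n where n: "2 * K / \<kappa> < 2 ^ n" using real_arch_pow[of 2] by fastforce
    then have kn: "2 * K / 2 ^ n \<le> \<kappa>" using \<kappa> by (simp add: field_simps)
    from shrink[of n] obtain A where A: "A \<in> sets M" "A \<subseteq> peak s" "0 < emeasure M A"
      and small: "\<And>h. h \<in> V \<Longrightarrow> (\<And>t. t \<notin> A \<Longrightarrow> h t = 0) \<Longrightarrow> nrm h \<le> 2 \<Longrightarrow> \<bar>l h\<bar> \<le> 2 * K / 2 ^ n"
      by blast
    have [measurable]: "A \<in> sets M" by fact
    define v where "v t = (if t \<in> A then s / c else u t)" for t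
    define h where "h t = (if t \<in> A then s / c - u t else 0)" for t
    have [measurable]: "v \<in> borel_measurable M" "h \<in> borel_measurable M"
      unfolding v_def[abs_def] h_def[abs_def] by measurable
    have ub: "AE t in M. c * \<bar>u t\<bar> \<le> 1" using nrm_bound[OF u(1)] u(2) by (auto elim: eventually_mono)
    have cs: "c * \<bar>s / c\<bar> = 1" using s c by simp
    have vb: "AE t in M. c * \<bar>v t\<bar> \<le> 1"
      using ub by eventually_elim (use cs in \<open>simp add: v_def\<close>)
    have hb: "AE t in M. c * \<bar>h t\<bar> \<le> 2"
      using ub
    proof eventually_elim
      case (elim t)
      have "c * \<bar>s / c - u t\<bar> \<le> c * (\<bar>s / c\<bar> + \<bar>u t\<bar>)"
        using c by (intro mult_left_mono abs_triangle_ineq4) auto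
      also have "\<dots> = 1 + c * \<bar>u t\<bar>" unfolding distrib_left cs ..
      finally show ?case using elim by (simp add: h_def)
    qed
    have in_V: "w \<in> V" if "w \<in> borel_measurable M" "AE t in M. c * \<bar>w t\<bar> \<le> C" for w C
      unfolding V_iff
    proof (intro conjI exI)
      show "AE t in M. \<bar>w t\<bar> \<le> C / c"
        using that(2) by eventually_elim (use c in \<open>simp add: field_simps\<close>)
    qed (rule that(1))
    have v: "v \<in> V" "nrm v \<le> 1" and h: "h \<in> V" "nrm h \<le> 2"
      using in_V[OF _ vb] in_V[OF _ hb] nrm_le vb hb by auto
    have "\<bar>l h\<bar> \<le> \<kappa>" using small[OF h(1) _ h(2)] kn by (simp add: h_def)
    moreover have "v = (\<lambda>t. u t + h t)" by (auto simp: v_def h_def)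
    then have "l v = l u + l h" using l_add[OF u(1) h(1)] by simp
    ultimately have lv: "l u - \<kappa> \<le> l v" by linarith
    have lv0: "0 \<le> l v" using lv \<kappa>(2) by linarith
    have vV: "(\<lambda>t. v t + l v * e t) \<in> V" using v(1) V_scale[OF e] by (rule V_add)
    have big: "1 + l v * (nrm e - \<eta>) \<le> c * \<bar>v t + l v * e t\<bar>" if t: "t \<in> A" for t
    proof -
      have pk: "nrm e - \<eta> \<le> c * \<bar>e t\<bar>" "0 \<le> s * e t" using t A by (auto simp: peak_def)
      have se: "s * e t = \<bar>e t\<bar>" using s pk(2) by (metis abs_mult abs_of_nonneg mult_1)
      have ss: "s * (s / c) = 1 / c" using s2 by simp
      have "1 / c + l v * \<bar>e t\<bar> = s * (v t + l v * e t)"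
        using t by (simp add: v_def distrib_left ss s2 se mult.left_commute[of s])
      also have "\<dots> \<le> \<bar>s * (v t + l v * e t)\<bar>" by (rule abs_ge_self)
      also have "\<dots> = \<bar>v t + l v * e t\<bar>" using s by (simp add: abs_mult)
      finally have "c * (1 / c + l v * \<bar>e t\<bar>) \<le> c * \<bar>v t + l v * e t\<bar>" using c by simp
      moreover have "l v * (nrm e - \<eta>) \<le> l v * (c * \<bar>e t\<bar>)" using lv0 pk by (intro mult_left_mono) auto
      moreover have "c * (1 / c + l v * \<bar>e t\<bar>) = 1 + l v * (c * \<bar>e t\<bar>)"
        using c by (simp add: distrib_left mult.left_commute)
      ultimately show ?thesis by linarith
    qed
    have bound: "1 + l v * (nrm e - \<eta>) \<le> nrm (\<lambda>t. v t + l v * e t)"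
      by (rule nrm_ge[OF vV A(1,3) big])
    have low: "l u * nrm e - \<delta> \<le> l v * (nrm e - \<eta>) \<or> 1 + l u * nrm e - \<delta> \<le> 1"
    proof (cases "0 \<le> nrm e - \<eta>")
      case True
      have "(l u - \<kappa>) * (nrm e - \<eta>) \<le> l v * (nrm e - \<eta>)"
        using lv True by (rule mult_right_mono)
      moreover have "(l u - \<kappa>) * (nrm e - \<eta>) = l u * nrm e - l u * \<eta> - \<kappa> * nrm e + \<kappa> * \<eta>"
        by (simp add: algebra_simps)
      moreover have "0 \<le> \<kappa> * \<eta>" using \<kappa> \<eta> by simp
      ultimately show ?thesis using \<eta>(2) \<kappa>(3) by linarith
    next
      case False
      then have "l u * nrm e \<le> l u * \<eta>" using u(3) by (intro mult_left_mono) auto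
      then show ?thesis using \<eta>(2) \<delta> by linarith
    qed
    have "1 \<le> nrm (\<lambda>t. v t + l v * e t)"
    proof (rule nrm_ge[OF vV A(1,3)])
      fix t assume t: "t \<in> A"
      have pk: "0 \<le> s * e t" using t A by (auto simp: peak_def)
      have "s * (v t + l v * e t) = 1 / c + l v * (s * e t)"
        using t by (simp add: v_def distrib_left s2 mult.left_commute[of s])
      then have "1 / c \<le> s * (v t + l v * e t)" using lv0 pk by simp
      also have "\<dots> \<le> \<bar>s * (v t + l v * e t)\<bar>" by (rule abs_ge_self)
      also have "\<dots> = \<bar>v t + l v * e t\<bar>" using s by (simp add: abs_mult)
      finally show "1 \<le> c * \<bar>v t + l v * e t\<bar>" using c by (simp add: field_simps)
    qed
    with low bound have "1 + l u * nrm e - \<delta> \<le> nrm (\<lambda>t. v t + l v * e t)" by linarith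
    then show "\<exists>v\<in>V. nrm v \<le> 1 \<and> 1 + l u * nrm e - \<delta> \<le> nrm (\<lambda>t. v t + l v * e t)"
      using v by (intro bexI[of _ v]) auto
  qed
qed

end

section \<open>Function classes and equality of spaces\<close>

definition L1_class :: "'a measure \<Rightarrow> ('a \<Rightarrow> ereal) set" where
  "L1_class M = {f \<in> borel_measurable M. (\<integral>\<^sup>+t. e2ennreal \<bar>f t\<bar> \<partial>M) < \<infinity>}"

definition Linf_class :: "'a measure \<Rightarrow> ('a \<Rightarrow> ereal) set" where
  "Linf_class M = {f \<in> borel_measurable M. esssup M (\<lambda>t. e2ennreal \<bar>f t\<bar>) < \<infinity>}"

lemma L1_class_real: "(\<lambda>t. ereal (u t)) \<in> L1_class M \<longleftrightarrow> integrable M u"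
  by (simp add: L1_class_def borel_measurable_ereal_iff integrable_iff_bounded)

lemma e2ennreal_abs_eq_top: "e2ennreal \<bar>x\<bar> = \<infinity> \<longleftrightarrow> \<bar>x\<bar> = \<infinity>"
  by (cases x) auto

lemma ae_space_L1: "ae_space M (L1_class M) (\<lambda>f. enn2real (\<integral>\<^sup>+t. c * e2ennreal \<bar>f t\<bar> \<partial>M))"
proof
  fix f g :: "'a \<Rightarrow> ereal"
  assume f: "f \<in> L1_class M" and g: "g \<in> borel_measurable M" and ae: "AE t in M. f t = g t"
  have "(\<integral>\<^sup>+t. e2ennreal \<bar>g t\<bar> \<partial>M) = (\<integral>\<^sup>+t. e2ennreal \<bar>f t\<bar> \<partial>M)"
    using ae by (intro nn_integral_cong_AE) (auto elim: eventually_mono)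
  moreover have "(\<integral>\<^sup>+t. c * e2ennreal \<bar>g t\<bar> \<partial>M) = (\<integral>\<^sup>+t. c * e2ennreal \<bar>f t\<bar> \<partial>M)"
    using ae by (intro nn_integral_cong_AE) (auto elim: eventually_mono)
  ultimately show "g \<in> L1_class M \<and> enn2real (\<integral>\<^sup>+t. c * e2ennreal \<bar>g t\<bar> \<partial>M) =
      enn2real (\<integral>\<^sup>+t. c * e2ennreal \<bar>f t\<bar> \<partial>M)"
    using f g by (simp add: L1_class_def)
next
  fix f :: "'a \<Rightarrow> ereal"
  assume f: "f \<in> L1_class M"
  then have "AE t in M. e2ennreal \<bar>f t\<bar> \<noteq> \<infinity>"
    by (intro nn_integral_PInf_AE) (auto simp: L1_class_def)
  then show "AE t in M. \<bar>f t\<bar> \<noteq> \<infinity>" by eventually_elim (simp only: e2ennreal_abs_eq_top simp_thms)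
next
  fix u v :: "'a \<Rightarrow> real"
  assume "(\<lambda>t. ereal (u t)) \<in> L1_class M" "(\<lambda>t. ereal (v t)) \<in> L1_class M"
  then show "(\<lambda>t. ereal (u t + v t)) \<in> L1_class M" unfolding L1_class_real by (rule Bochner_Integration.integrable_add)
next
  fix u :: "'a \<Rightarrow> real" and c
  assume "(\<lambda>t. ereal (u t)) \<in> L1_class M"
  then show "(\<lambda>t. ereal (c * u t)) \<in> L1_class M" unfolding L1_class_real by simp
qed (auto simp: L1_class_def e2ennreal_neg)

lemma L1_norm_real:
  assumes "integrable M u" "0 \<le> c"
  shows "enn2real (\<integral>\<^sup>+t. ennreal c * e2ennreal \<bar>ereal (u t)\<bar> \<partial>M) = c * (\<integral>t. \<bar>u t\<bar> \<partial>M)"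
proof -
  have "(\<integral>\<^sup>+t. ennreal c * e2ennreal \<bar>ereal (u t)\<bar> \<partial>M) = (\<integral>\<^sup>+t. ennreal (c * \<bar>u t\<bar>) \<partial>M)"
    using assms by (simp add: ennreal_mult)
  also have "\<dots> = ennreal (\<integral>t. c * \<bar>u t\<bar> \<partial>M)"
    using assms by (intro nn_integral_eq_integral) auto
  finally show ?thesis using assms by simp
qed

lemma esssup_le_iff:
  fixes f :: "'a \<Rightarrow> ennreal"
  assumes "f \<in> borel_measurable M"
  shows "esssup M f \<le> C \<longleftrightarrow> (AE t in M. f t \<le> C)"
proof
  assume "esssup M f \<le> C"
  then show "AE t in M. f t \<le> C"
    using esssup_AE[where M = M and f = f] by (auto elim!: eventually_mono intro: order_trans)
qed (rule esssup_I[OF assms])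

lemma Linf_class_real:
  "(\<lambda>t. ereal (u t)) \<in> Linf_class M \<longleftrightarrow> u \<in> borel_measurable M \<and> (\<exists>C. AE t in M. \<bar>u t\<bar> \<le> C)"
proof (cases "u \<in> borel_measurable M")
  case True
  note [measurable] = this
  have "esssup M (\<lambda>t. ennreal \<bar>u t\<bar>) < \<infinity> \<longleftrightarrow> (\<exists>C. AE t in M. \<bar>u t\<bar> \<le> C)"
  proof
    assume "esssup M (\<lambda>t. ennreal \<bar>u t\<bar>) < \<infinity>"
    then obtain C where C: "esssup M (\<lambda>t. ennreal \<bar>u t\<bar>) = ennreal C" "0 \<le> C"
      by (cases "esssup M (\<lambda>t. ennreal \<bar>u t\<bar>)") auto
    then have "AE t in M. ennreal \<bar>u t\<bar> \<le> ennreal C"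
      by (subst esssup_le_iff[symmetric]) auto
    then have "AE t in M. \<bar>u t\<bar> \<le> C" by eventually_elim (simp add: C)
    then show "\<exists>C. AE t in M. \<bar>u t\<bar> \<le> C" by blast
  next
    assume "\<exists>C. AE t in M. \<bar>u t\<bar> \<le> C"
    then obtain C where "AE t in M. \<bar>u t\<bar> \<le> C" by blast
    then have "AE t in M. ennreal \<bar>u t\<bar> \<le> ennreal C" by eventually_elim (rule ennreal_leI)
    then have "esssup M (\<lambda>t. ennreal \<bar>u t\<bar>) \<le> ennreal C" by (subst esssup_le_iff) auto
    then show "esssup M (\<lambda>t. ennreal \<bar>u t\<bar>) < \<infinity>" by (rule le_less_trans) simp
  qed
  then show ?thesis by (simp add: Linf_class_def borel_measurable_ereal_iff)
qed (simp add: Linf_class_def borel_measurable_ereal_iff)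

text \<open>
  The norm of \<open>L\<^sub>\<infinity>\<close> is used only through its upper bounds.
\<close>

lemma Linf_norm_real:
  assumes "(\<lambda>t. ereal (u t)) \<in> Linf_class M" "0 < c" "0 \<le> C"
  shows "enn2real (esssup M (\<lambda>t. ennreal c * e2ennreal \<bar>ereal (u t)\<bar>)) \<le> C \<longleftrightarrow> (AE t in M. c * \<bar>u t\<bar> \<le> C)"
proof -
  have [measurable]: "u \<in> borel_measurable M" and "\<exists>B. AE t in M. \<bar>u t\<bar> \<le> B"
    using assms(1) unfolding Linf_class_real by auto
  then obtain B where B: "AE t in M. \<bar>u t\<bar> \<le> B" by blast
  have eq: "ennreal c * e2ennreal \<bar>ereal (u t)\<bar> = ennreal (c * \<bar>u t\<bar>)" for t
    using assms by (simp add: ennreal_mult)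
  have iff: "esssup M (\<lambda>t. ennreal (c * \<bar>u t\<bar>)) \<le> ennreal D \<longleftrightarrow> (AE t in M. c * \<bar>u t\<bar> \<le> D)" if "0 \<le> D" for D
    using that by (subst esssup_le_iff) auto
  have "AE t in M. c * \<bar>u t\<bar> \<le> \<bar>c * B\<bar>"
    using B
  proof eventually_elim
    case (elim t)
    then have "c * \<bar>u t\<bar> \<le> c * B" using assms by (intro mult_left_mono) auto
    then show ?case by linarith
  qed
  then have "esssup M (\<lambda>t. ennreal (c * \<bar>u t\<bar>)) \<le> ennreal \<bar>c * B\<bar>" by (subst iff) auto
  then have fin: "esssup M (\<lambda>t. ennreal (c * \<bar>u t\<bar>)) < \<infinity>" by (rule le_less_trans) simp
  have "enn2real (esssup M (\<lambda>t. ennreal (c * \<bar>u t\<bar>))) \<le> C \<longleftrightarrow> esssup M (\<lambda>t. ennreal (c * \<bar>u t\<bar>)) \<le> ennreal C"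
    using fin assms(3) by (cases "esssup M (\<lambda>t. ennreal (c * \<bar>u t\<bar>))") auto
  then show ?thesis unfolding eq using iff[OF assms(3)] by simp
qed

lemma ae_space_Linf: "ae_space M (Linf_class M) (\<lambda>f. enn2real (esssup M (\<lambda>t. c * e2ennreal \<bar>f t\<bar>)))"
proof
  fix f g :: "'a \<Rightarrow> ereal"
  assume f: "f \<in> Linf_class M" and g: "g \<in> borel_measurable M" and ae: "AE t in M. f t = g t"
  have [measurable]: "f \<in> borel_measurable M" "g \<in> borel_measurable M" using f g by (auto simp: Linf_class_def)
  have "esssup M (\<lambda>t. d * e2ennreal \<bar>g t\<bar>) = esssup M (\<lambda>t. d * e2ennreal \<bar>f t\<bar>)" for d
    using ae by (intro esssup_AE_cong) (auto elim: eventually_mono)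
  from this[of 1] this[of c] show "g \<in> Linf_class M \<and> enn2real (esssup M (\<lambda>t. c * e2ennreal \<bar>g t\<bar>)) =
      enn2real (esssup M (\<lambda>t. c * e2ennreal \<bar>f t\<bar>))"
    using f g by (simp add: Linf_class_def)
next
  fix f :: "'a \<Rightarrow> ereal"
  assume f: "f \<in> Linf_class M"
  have "AE t in M. e2ennreal \<bar>f t\<bar> \<le> esssup M (\<lambda>t. e2ennreal \<bar>f t\<bar>)" by (rule esssup_AE)
  then show "AE t in M. \<bar>f t\<bar> \<noteq> \<infinity>"
  proof eventually_elim
    case (elim t)
    then have "e2ennreal \<bar>f t\<bar> < \<infinity>" using f by (auto simp: Linf_class_def intro: le_less_trans)
    then show ?case using e2ennreal_abs_eq_top[of "f t"] by auto
  qed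
next
  fix u v :: "'a \<Rightarrow> real"
  assume *: "(\<lambda>t. ereal (u t)) \<in> Linf_class M" "(\<lambda>t. ereal (v t)) \<in> Linf_class M"
  then obtain B C where "AE t in M. \<bar>u t\<bar> \<le> B" "AE t in M. \<bar>v t\<bar> \<le> C" unfolding Linf_class_real by blast
  then have "AE t in M. \<bar>u t + v t\<bar> \<le> B + C" by eventually_elim linarith
  then show "(\<lambda>t. ereal (u t + v t)) \<in> Linf_class M" using * unfolding Linf_class_real by auto
next
  fix u :: "'a \<Rightarrow> real" and c
  assume *: "(\<lambda>t. ereal (u t)) \<in> Linf_class M"
  then obtain B where "AE t in M. \<bar>u t\<bar> \<le> B" unfolding Linf_class_real by blast
  then have "AE t in M. \<bar>c * u t\<bar> \<le> \<bar>c\<bar> * B" by eventually_elim (simp add: abs_mult mult_left_mono)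
  then show "(\<lambda>t. ereal (c * u t)) \<in> Linf_class M" using * unfolding Linf_class_real by auto
next
  have "(\<lambda>t::'a. ereal 0) \<in> Linf_class M"
    unfolding Linf_class_real by (intro conjI exI[of _ 0]) auto
  then show "(\<lambda>_. 0) \<in> Linf_class M" by (simp add: zero_ereal_def)
qed (auto simp: Linf_class_def)

lemma modular_real: "modular M \<omega> (\<lambda>t. ereal (u t)) = real_modular M \<omega> u"
  by (simp add: modular_def real_modular_def)

lemma modular_cong_AE: "AE t in M. f t = g t \<Longrightarrow> modular M \<omega> f = modular M \<omega> g"
  unfolding modular_def by (intro nn_integral_cong_AE) (auto elim: eventually_mono)

text \<open>
  The integrand is \<open>\<infinity>\<close> where \<open>f\<close> is infinite, whatever \<open>\<omega>\<close> is.
\<close>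

lemma modular_finite_imp:
  assumes [measurable]: "f \<in> borel_measurable M" and fin: "modular M \<omega> f < \<infinity>"
  shows "AE t in M. \<bar>f t\<bar> \<noteq> \<infinity>"
proof -
  define S where "S = {t \<in> space M. \<bar>f t\<bar> = \<infinity>}"
  have [measurable]: "S \<in> sets M" unfolding S_def by measurable
  have "\<infinity> * emeasure M S = (\<integral>\<^sup>+t. \<infinity> * indicator S t \<partial>M)" by (rule nn_integral_cmult_indicator[symmetric]) simp
  also have "\<dots> \<le> modular M \<omega> f"
    unfolding modular_def by (intro nn_integral_mono) (auto simp: S_def indicator_def)
  finally have "emeasure M S = 0" using fin by (auto simp: ennreal_top_mult split: if_splits)
  then have "AE t in M. t \<notin> S" by (intro AE_not_in) (simp add: null_sets_def)
  then show ?thesis using AE_space by eventually_elim (simp add: S_def)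
qed

lemma orlicz_class_real:
  "(\<lambda>t. ereal (u t)) \<in> orlicz_class M \<omega> \<longleftrightarrow>
     u \<in> borel_measurable M \<and> (\<exists>l>0. real_modular M \<omega> (\<lambda>t. l * u t) < \<infinity>)"
  by (simp add: orlicz_class_def borel_measurable_ereal_iff modular_real)

lemma real_modular_mono:
  assumes "\<And>u v. 0 \<le> u \<Longrightarrow> u \<le> v \<Longrightarrow> \<omega> u \<le> \<omega> v" and "\<And>t. \<bar>u t\<bar> \<le> \<bar>v t\<bar>"
  shows "real_modular M \<omega> u \<le> real_modular M \<omega> v"
  unfolding real_modular_def using assms by (intro nn_integral_mono) auto

text \<open>
  Closure under sums comes from monotonicity: with \<open>2 * m \<le> k\<close> and \<open>2 * m \<le> l\<close> the value
  \<open>\<bar>m * (u + v)\<bar>\<close> is at most the larger of \<open>\<bar>k * u\<bar>\<close> and \<open>\<bar>l * v\<bar>\<close>. In this form the lemma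
  applies to \<open>\<phi>\<close> and to its complementary function alike.
\<close>

lemma ae_space_orlicz_class:
  assumes mono: "\<And>u v. 0 \<le> u \<Longrightarrow> u \<le> v \<Longrightarrow> \<omega> u \<le> \<omega> v" and zero: "\<omega> 0 = 0"
    and cong: "\<And>f g. f \<in> borel_measurable M \<Longrightarrow> g \<in> borel_measurable M \<Longrightarrow> AE t in M. f t = g t \<Longrightarrow> N g = N f"
  shows "ae_space M (orlicz_class M \<omega>) N"
proof
  fix f g :: "'a \<Rightarrow> ereal"
  assume f: "f \<in> orlicz_class M \<omega>" and g: "g \<in> borel_measurable M" and ae: "AE t in M. f t = g t"
  then obtain l :: real where l: "0 < l" "modular M \<omega> (\<lambda>t. ereal l * f t) < \<infinity>"
    and fm: "f \<in> borel_measurable M" by (auto simp: orlicz_class_def)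
  have "modular M \<omega> (\<lambda>t. ereal l * f t) = modular M \<omega> (\<lambda>t. ereal l * g t)"
    using ae by (intro modular_cong_AE) (auto elim: eventually_mono)
  with l g have "g \<in> orlicz_class M \<omega>" by (auto simp: orlicz_class_def)
  with cong[OF fm g ae] show "g \<in> orlicz_class M \<omega> \<and> N g = N f" by simp
next
  fix f :: "'a \<Rightarrow> ereal"
  assume f: "f \<in> orlicz_class M \<omega>"
  then obtain l :: real where l: "0 < l" "modular M \<omega> (\<lambda>t. ereal l * f t) < \<infinity>"
    and [measurable]: "f \<in> borel_measurable M" by (auto simp: orlicz_class_def)
  have "AE t in M. \<bar>ereal l * f t\<bar> \<noteq> \<infinity>" by (rule modular_finite_imp[OF _ l(2)]) measurable
  then show "AE t in M. \<bar>f t\<bar> \<noteq> \<infinity>"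
  proof eventually_elim
    case (elim t)
    then show ?case using l(1) by (cases "f t") auto
  qed
next
  fix u v :: "'a \<Rightarrow> real"
  assume "(\<lambda>t. ereal (u t)) \<in> orlicz_class M \<omega>" "(\<lambda>t. ereal (v t)) \<in> orlicz_class M \<omega>"
  then obtain k l where k: "0 < k" "real_modular M \<omega> (\<lambda>t. k * u t) < \<infinity>"
    and l: "0 < l" "real_modular M \<omega> (\<lambda>t. l * v t) < \<infinity>"
    and [measurable]: "u \<in> borel_measurable M" "v \<in> borel_measurable M"
    unfolding orlicz_class_real by blast
  define m where "m = min k l / 2"
  have m: "0 < m" "2 * m \<le> k" "2 * m \<le> l" using k l by (auto simp: m_def)
  have "\<omega> \<bar>m * (u t + v t)\<bar> \<le> \<omega> \<bar>k * u t\<bar> + \<omega> \<bar>l * v t\<bar>" for t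
  proof -
    have max: "x \<le> a \<or> x \<le> b" if "x \<le> a' + b'" "2 * a' \<le> a" "2 * b' \<le> b" for x a b a' b' :: real
      using that by linarith
    have "(2 * m) * \<bar>u t\<bar> \<le> k * \<bar>u t\<bar>" "(2 * m) * \<bar>v t\<bar> \<le> l * \<bar>v t\<bar>"
      using m by (auto intro!: mult_right_mono)
    then have le: "2 * (m * \<bar>u t\<bar>) \<le> k * \<bar>u t\<bar>" "2 * (m * \<bar>v t\<bar>) \<le> l * \<bar>v t\<bar>"
      by (simp_all only: mult.assoc)
    have "m * \<bar>u t + v t\<bar> \<le> m * (\<bar>u t\<bar> + \<bar>v t\<bar>)"
      using m by (intro mult_left_mono) auto
    then have "m * \<bar>u t + v t\<bar> \<le> m * \<bar>u t\<bar> + m * \<bar>v t\<bar>" by (simp only: distrib_left)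
    then have "m * \<bar>u t + v t\<bar> \<le> k * \<bar>u t\<bar> \<or> m * \<bar>u t + v t\<bar> \<le> l * \<bar>v t\<bar>"
      using le by (rule max)
    then have "\<bar>m * (u t + v t)\<bar> \<le> \<bar>k * u t\<bar> \<or> \<bar>m * (u t + v t)\<bar> \<le> \<bar>l * v t\<bar>"
      using m k l by (simp add: abs_mult)
    then have "\<omega> \<bar>m * (u t + v t)\<bar> \<le> \<omega> \<bar>k * u t\<bar> \<or> \<omega> \<bar>m * (u t + v t)\<bar> \<le> \<omega> \<bar>l * v t\<bar>"
      using mono[OF abs_ge_zero] by blast
    then show ?thesis by (auto intro: add_increasing add_increasing2)
  qed
  then have "real_modular M \<omega> (\<lambda>t. m * (u t + v t)) \<le> (\<integral>\<^sup>+t. \<omega> \<bar>k * u t\<bar> + \<omega> \<bar>l * v t\<bar> \<partial>M)"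
    unfolding real_modular_def by (intro nn_integral_mono)
  also have "\<dots> = real_modular M \<omega> (\<lambda>t. k * u t) + real_modular M \<omega> (\<lambda>t. l * v t)"
    unfolding real_modular_def by (intro nn_integral_add borel_measurable_mono_abs[OF mono]) measurable
  also have "\<dots> < \<infinity>" using k l by simp
  finally show "(\<lambda>t. ereal (u t + v t)) \<in> orlicz_class M \<omega>"
    unfolding orlicz_class_real using m by auto
next
  fix u :: "'a \<Rightarrow> real" and c
  assume "(\<lambda>t. ereal (u t)) \<in> orlicz_class M \<omega>"
  then obtain l where l: "0 < l" "real_modular M \<omega> (\<lambda>t. l * u t) < \<infinity>"
    and [measurable]: "u \<in> borel_measurable M" unfolding orlicz_class_real by blast
  define m where "m = l / (\<bar>c\<bar> + 1)"
  have m: "0 < m" "m * \<bar>c\<bar> \<le> l" using l by (auto simp: m_def field_simps)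
  have "real_modular M \<omega> (\<lambda>t. m * (c * u t)) \<le> real_modular M \<omega> (\<lambda>t. l * u t)"
  proof (rule real_modular_mono[OF mono])
    fix t
    have "(m * \<bar>c\<bar>) * \<bar>u t\<bar> \<le> l * \<bar>u t\<bar>" using m by (intro mult_right_mono) auto
    then show "\<bar>m * (c * u t)\<bar> \<le> \<bar>l * u t\<bar>" using m l by (simp add: abs_mult mult.assoc)
  qed
  then have "real_modular M \<omega> (\<lambda>t. m * (c * u t)) < \<infinity>" using l by auto
  then show "(\<lambda>t. ereal (c * u t)) \<in> orlicz_class M \<omega>"
    unfolding orlicz_class_real using m by auto
next
  have "real_modular M \<omega> (\<lambda>t. 1 * 0) < \<infinity>" by (simp add: real_modular_def zero)
  then have "(\<lambda>t. ereal 0) \<in> orlicz_class M \<omega>" unfolding orlicz_class_real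
    by (intro conjI exI[of _ 1]) auto
  then show "(\<lambda>_. 0) \<in> orlicz_class M \<omega>" by (simp add: zero_ereal_def)
qed (auto simp: orlicz_class_def)

lemma same_space_if_real:
  assumes "ae_space M F N" "ae_space M G N'"
    and V: "\<And>u. u \<in> borel_measurable M \<Longrightarrow> (\<lambda>t. ereal (u t)) \<in> F \<longleftrightarrow> (\<lambda>t. ereal (u t)) \<in> G"
    and n: "\<And>u. (\<lambda>t. ereal (u t)) \<in> F \<Longrightarrow> N (\<lambda>t. ereal (u t)) = N' (\<lambda>t. ereal (u t))"
  shows "same_space (class_space M F N) (class_space M G N')"
proof -
  interpret F: ae_space M F N by fact
  interpret G: ae_space M G N' by fact
  have VV: "F.V = G.V" using V by (auto simp: F.V_def G.V_def)
  have "vnorm F.X (cls M u) = vnorm G.X (cls M u)" if u: "u \<in> F.V" for u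
  proof -
    have "N (\<lambda>t. ereal (u t)) = N' (\<lambda>t. ereal (u t))" using u by (intro n) (simp add: F.V_def)
    then show ?thesis
      using F.vnorm_cls[OF u] G.vnorm_cls[OF u[unfolded VV]] by (simp add: F.nrm_def G.nrm_def)
  qed
  then show ?thesis by (auto simp: same_space_def F.vecs_X G.vecs_X VV)
qed

lemma real_if_same_space:
  assumes "ae_space M F N" "ae_space M G N'"
    and same: "same_space (class_space M F N) (class_space M G N')"
    and u: "(\<lambda>t. ereal (u t)) \<in> G"
  shows "(\<lambda>t. ereal (u t)) \<in> F" "N (\<lambda>t. ereal (u t)) = N' (\<lambda>t. ereal (u t))"
proof -
  interpret F: ae_space M F N by fact
  interpret G: ae_space M G N' by fact
  have uG: "u \<in> G.V" using u G.meas[OF u] by (simp add: G.V_def borel_measurable_ereal_iff)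
  then have "cls M u \<in> cls M ` F.V" using same by (simp add: same_space_def F.vecs_X G.vecs_X)
  then obtain v where v: "v \<in> F.V" "cls M u = cls M v" by blast
  have "AE t in M. v t = u t"
    using cls_eq_iff[OF F.V_meas[OF v(1)] G.V_meas[OF uG]] v(2) by simp
  then have uF: "u \<in> F.V" using F.V_cong(1)[OF v(1) G.V_meas[OF uG]] by blast
  then show "(\<lambda>t. ereal (u t)) \<in> F" by (simp add: F.V_def)
  have "vnorm (class_space M F N) (cls M u) = vnorm (class_space M G N') (cls M u)"
    using same uF by (simp add: same_space_def F.vecs_X)
  then show "N (\<lambda>t. ereal (u t)) = N' (\<lambda>t. ereal (u t))"
    using uF uG by (simp add: F.vnorm_cls G.vnorm_cls F.nrm_def G.nrm_def)
qed

section \<open>Orlicz spaces\<close>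

locale orlicz_setting = orlicz \<phi> + sigma_finite_measure M
  for \<phi> :: "real \<Rightarrow> ennreal" and M :: "'a measure" +
  fixes \<psi> :: "real \<Rightarrow> ennreal"
  assumes nonatomic: "nonatomic M" and nontriv: "emeasure M (space M) \<noteq> 0"
    and psi: "\<And>u. 0 \<le> u \<Longrightarrow> \<psi> u = complementary \<phi> u"
begin

lemma psi_ge:
  assumes "0 \<le> u" "0 < v" "\<phi> v = ennreal p" "0 \<le> p"
  shows "ennreal (u * v - p) \<le> \<psi> u"
proof -
  have "ereal (u * v - p) = ereal (u * v) - enn2ereal (\<phi> v)" using assms by simp
  also have "\<dots> \<le> (SUP v\<in>{0<..}. ereal (u * v) - enn2ereal (\<phi> v))"
    using assms by (intro SUP_upper) auto
  finally have "e2ennreal (ereal (u * v - p)) \<le> \<psi> u"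
    unfolding psi[OF assms(1)] complementary_def by (rule e2ennreal_mono)
  then show ?thesis by simp
qed

lemma psi_le:
  assumes u: "0 \<le> u" and B: "0 \<le> B" and le: "\<And>v. 0 < v \<Longrightarrow> ennreal (u * v) \<le> \<phi> v + ennreal B"
  shows "\<psi> u \<le> ennreal B"
proof -
  have "(SUP v\<in>{0<..}. ereal (u * v) - enn2ereal (\<phi> v)) \<le> ereal B"
  proof (rule SUP_least)
    fix v :: real assume "v \<in> {0<..}"
    then have v: "0 < v" by simp
    show "ereal (u * v) - enn2ereal (\<phi> v) \<le> ereal B"
    proof (cases "\<phi> v")
      case (real p)
      then have "ennreal (u * v) \<le> ennreal (p + B)" using le[OF v] B by simp
      then have "u * v \<le> p + B" using real B by (subst (asm) ennreal_le_iff) auto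
      then show ?thesis using real by simp
    qed simp
  qed
  then have "\<psi> u \<le> e2ennreal (ereal B)"
    unfolding psi[OF u] complementary_def by (rule e2ennreal_mono)
  then show ?thesis by simp
qed

lemma young:
  assumes "0 \<le> u" "0 \<le> v"
  shows "ennreal (u * v) \<le> \<phi> v + \<psi> u"
proof (cases "\<phi> v")
  case (real p)
  show ?thesis
  proof (cases "v = 0")
    case False
    then have "ennreal (u * v - p) \<le> \<psi> u" using assms real by (intro psi_ge) auto
    then have "ennreal p + ennreal (u * v - p) \<le> \<phi> v + \<psi> u"
      using real by (intro add_mono) auto
    moreover have "ennreal (u * v) \<le> ennreal p + ennreal (u * v - p)"
      using real by (cases "p \<le> u * v") (auto simp: ennreal_plus[symmetric] ennreal_neg simp del: ennreal_plus intro: ennreal_leI)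
    ultimately show ?thesis by (rule order_trans[rotated])
  qed simp
qed simp

lemma psi_0: "\<psi> 0 = 0"
proof -
  have "\<psi> 0 \<le> ennreal 0" by (rule psi_le) auto
  then show ?thesis by simp
qed

lemma psi_mono:
  assumes "0 \<le> u" "u \<le> v"
  shows "\<psi> u \<le> \<psi> v"
proof (cases "\<psi> v")
  case (real B)
  have "\<psi> u \<le> ennreal B"
  proof (rule psi_le)
    fix w :: real assume w: "0 < w"
    have "ennreal (u * w) \<le> ennreal (v * w)" using assms w by (intro ennreal_leI mult_right_mono) auto
    also have "\<dots> \<le> \<phi> w + \<psi> v" using assms w by (intro young) auto
    finally show "ennreal (u * w) \<le> \<phi> w + ennreal B" using real by simp
  qed (use assms real in auto)
  with real show ?thesis by simp
qed simp

text \<open>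
  A line through the origin below \<open>\<phi>\<close> from some point \<open>u\<close> on has a slope at which the complementary
  function is finite.
\<close>

lemma psi_finite_point: "\<exists>r>0. \<psi> r < \<infinity>"
proof -
  obtain u where u: "0 < u" "0 < \<phi> u" using phi_pos_point by blast
  obtain z where z: "0 < z" "z < \<phi> u" using dense[OF u(2)] by blast
  then obtain x where x: "z = ennreal x" "0 < x" by (cases z) (auto simp: less_top)
  define r where "r = x / u"
  have r: "0 < r" "ennreal (r * u) \<le> \<phi> u" using x u z by (auto simp: r_def)
  have "\<psi> r \<le> ennreal (r * u)"
  proof (rule psi_le)
    fix v :: real assume v: "0 < v"
    have "ennreal (r * v) \<le> ennreal (r * u) * ennreal (min (max v 0) u / u) + \<phi> \<bar>v\<bar>"
      using u r by (intro pointwise_linear_growth) auto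
    also have "\<dots> \<le> ennreal (r * u) * 1 + \<phi> v"
      using u v by (intro add_mono mult_left_mono) auto
    finally show "ennreal (r * v) \<le> \<phi> v + ennreal (r * u)" by (simp add: add.commute)
  qed (use r u in auto)
  then show ?thesis using r by (intro exI[of _ r]) (auto intro: le_less_trans)
qed

lemma luxemburg_norm_real:
  "luxemburg_norm M \<phi> (\<lambda>t. ereal (u t)) = Inf {l. 0 < l \<and> real_modular M \<phi> (\<lambda>t. u t / l) \<le> 1}"
proof -
  have "modular M \<phi> (\<lambda>t. ereal (u t) / ereal l) = real_modular M \<phi> (\<lambda>t. u t / l)" if "0 < l" for l
    using that by (simp add: modular_real[symmetric])
  then show ?thesis unfolding luxemburg_norm_def by (intro arg_cong[where f = Inf]) auto
qed

definition orlicz_sup :: "('a \<Rightarrow> real) \<Rightarrow> ennreal" where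
  "orlicz_sup u = (SUP g\<in>{g \<in> borel_measurable M. real_modular M \<phi> g \<le> 1}. \<integral>\<^sup>+t. ennreal \<bar>u t * g t\<bar> \<partial>M)"

text \<open>
  Test functions of finite modular are finite almost everywhere, so real-valued ones suffice.
\<close>

lemma orlicz_norm_real: "orlicz_norm M \<phi> (\<lambda>t. ereal (u t)) = enn2real (orlicz_sup u)"
  unfolding orlicz_norm_def orlicz_sup_def
proof (intro arg_cong[where f = enn2real] antisym SUP_least)
  fix g :: "'a \<Rightarrow> ereal" assume "g \<in> {g \<in> borel_measurable M. modular M \<phi> g \<le> 1}"
  then have [measurable]: "g \<in> borel_measurable M" and g: "modular M \<phi> g \<le> 1" by auto
  have "modular M \<phi> g < \<infinity>" using g by (rule le_less_trans) simp
  then have ae: "AE t in M. \<bar>g t\<bar> \<noteq> \<infinity>" by (rule modular_finite_imp[rotated]) measurable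
  define h where "h t = real_of_ereal (g t)" for t
  have hm: "h \<in> borel_measurable M" unfolding h_def[abs_def] by measurable
  have gh: "AE t in M. g t = ereal (h t)" using ae by eventually_elim (simp add: h_def ereal_real)
  have "real_modular M \<phi> h = modular M \<phi> g"
    unfolding modular_real[symmetric] using gh by (intro modular_cong_AE) (auto elim: eventually_mono)
  then have h1: "real_modular M \<phi> h \<le> 1" using g by simp
  have "(\<integral>\<^sup>+t. e2ennreal \<bar>ereal (u t) * g t\<bar> \<partial>M) = (\<integral>\<^sup>+t. ennreal \<bar>u t * h t\<bar> \<partial>M)"
    using gh by (intro nn_integral_cong_AE) (auto elim!: eventually_mono)
  then show "(\<integral>\<^sup>+t. e2ennreal \<bar>ereal (u t) * g t\<bar> \<partial>M)
      \<le> (SUP g\<in>{g \<in> borel_measurable M. real_modular M \<phi> g \<le> 1}. \<integral>\<^sup>+t. ennreal \<bar>u t * g t\<bar> \<partial>M)"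
    using h1 hm by (intro SUP_upper2[of h]) auto
next
  fix g assume "g \<in> {g \<in> borel_measurable M. real_modular M \<phi> g \<le> 1}"
  then show "(\<integral>\<^sup>+t. ennreal \<bar>u t * g t\<bar> \<partial>M)
      \<le> (SUP g\<in>{g \<in> borel_measurable M. modular M \<phi> g \<le> 1}. \<integral>\<^sup>+t. e2ennreal \<bar>ereal (u t) * g t\<bar> \<partial>M)"
    by (intro SUP_upper2[of "\<lambda>t. ereal (g t)"]) (auto simp: modular_real)
qed

lemma ae_space_lux: "ae_space M (orlicz_class M \<phi>) (luxemburg_norm M \<phi>)"
proof (rule ae_space_orlicz_class[where \<omega> = \<phi>, OF phi_mono phi_0])
  fix f g :: "'a \<Rightarrow> ereal" assume "AE t in M. f t = g t"
  then have "modular M \<phi> (\<lambda>t. f t / ereal l) = modular M \<phi> (\<lambda>t. g t / ereal l)" for l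
    by (intro modular_cong_AE) (auto elim: eventually_mono)
  then show "luxemburg_norm M \<phi> g = luxemburg_norm M \<phi> f" by (simp add: luxemburg_norm_def)
qed

lemma ae_space_orl: "ae_space M (orlicz_class M \<psi>) (orlicz_norm M \<phi>)"
proof (rule ae_space_orlicz_class[where \<omega> = \<psi>, OF psi_mono psi_0])
  fix f g :: "'a \<Rightarrow> ereal" assume ae: "AE t in M. f t = g t"
  have "(\<integral>\<^sup>+t. e2ennreal \<bar>f t * h t\<bar> \<partial>M) = (\<integral>\<^sup>+t. e2ennreal \<bar>g t * h t\<bar> \<partial>M)" for h
    using ae by (intro nn_integral_cong_AE) (auto elim: eventually_mono)
  then show "orlicz_norm M \<phi> g = orlicz_norm M \<phi> f" by (simp add: orlicz_norm_def)
qed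

sublocale lux: ae_space M "orlicz_class M \<phi>" "luxemburg_norm M \<phi>" by (rule ae_space_lux)
sublocale orl: ae_space M "orlicz_class M \<psi>" "orlicz_norm M \<phi>" by (rule ae_space_orl)

lemma lux_V: "u \<in> lux.V \<longleftrightarrow> u \<in> borel_measurable M \<and> (\<exists>l>0. real_modular M \<phi> (\<lambda>t. l * u t) < \<infinity>)"
  unfolding lux.V_def using orlicz_class_real[of u M \<phi>] by auto

lemma orl_V: "u \<in> orl.V \<longleftrightarrow> u \<in> borel_measurable M \<and> (\<exists>l>0. real_modular M \<psi> (\<lambda>t. l * u t) < \<infinity>)"
  unfolding orl.V_def using orlicz_class_real[of u M \<psi>] by auto

lemma lux_nrm: "lux.nrm u = Inf {l. 0 < l \<and> real_modular M \<phi> (\<lambda>t. u t / l) \<le> 1}"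
  unfolding lux.nrm_def by (rule luxemburg_norm_real)

lemma orl_nrm: "orl.nrm u = enn2real (orlicz_sup u)"
  unfolding orl.nrm_def by (rule orlicz_norm_real)

text \<open>
  A finite modular is brought below \<open>1\<close> by scaling, as \<open>\<phi> (s * u) \<le> s * \<phi> u\<close> for \<open>s \<le> 1\<close>.
\<close>

lemma lux_admissible_exists:
  assumes "u \<in> lux.V"
  shows "\<exists>l>0. real_modular M \<phi> (\<lambda>t. u t / l) \<le> 1"
proof -
  obtain l where l: "0 < l" "real_modular M \<phi> (\<lambda>t. l * u t) < \<infinity>" and [measurable]: "u \<in> borel_measurable M"
    using assms unfolding lux_V by blast
  obtain R where R: "real_modular M \<phi> (\<lambda>t. l * u t) = ennreal R" "0 \<le> R"
    using l(2) by (cases "real_modular M \<phi> (\<lambda>t. l * u t)") auto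
  define s where "s = 1 / (R + 1)"
  have s: "0 < s" "s \<le> 1" "s * R \<le> 1" using R by (auto simp: s_def field_simps)
  have "real_modular M \<phi> (\<lambda>t. u t / (1 / (s * l))) \<le> (\<integral>\<^sup>+t. ennreal s * \<phi> \<bar>l * u t\<bar> \<partial>M)"
    unfolding real_modular_def
  proof (rule nn_integral_mono)
    fix t
    have "\<bar>u t / (1 / (s * l))\<bar> = s * \<bar>l * u t\<bar>" using s l by (simp add: abs_mult)
    then show "\<phi> \<bar>u t / (1 / (s * l))\<bar> \<le> ennreal s * \<phi> \<bar>l * u t\<bar>"
      using phi_scale[of s "\<bar>l * u t\<bar>"] s by simp
  qed
  also have "\<dots> = ennreal s * real_modular M \<phi> (\<lambda>t. l * u t)"
    unfolding real_modular_def by (rule nn_integral_cmult) measurable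
  also have "\<dots> = ennreal (s * R)" unfolding R(1) using s R by (simp add: ennreal_mult)
  also have "\<dots> \<le> 1" using s by simp
  finally show ?thesis using s l by (intro exI[of _ "1 / (s * l)"]) auto
qed

lemma lux_nrm_le:
  assumes "0 < l" "real_modular M \<phi> (\<lambda>t. u t / l) \<le> 1"
  shows "lux.nrm u \<le> l"
  unfolding lux_nrm using assms by (intro cInf_lower bdd_belowI[of _ 0]) auto

lemma lux_modular_le:
  assumes u: "u \<in> lux.V" and l: "lux.nrm u < l"
  shows "real_modular M \<phi> (\<lambda>t. u t / l) \<le> 1"
proof -
  have "{l. 0 < l \<and> real_modular M \<phi> (\<lambda>t. u t / l) \<le> 1} \<noteq> {}" using lux_admissible_exists[OF u] by auto
  then obtain k where k: "0 < k" "real_modular M \<phi> (\<lambda>t. u t / k) \<le> 1" "k < l"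
    using l unfolding lux_nrm by (subst (asm) cInf_less_iff) (auto intro: bdd_belowI[of _ 0])
  have "real_modular M \<phi> (\<lambda>t. u t / l) \<le> real_modular M \<phi> (\<lambda>t. u t / k)"
  proof (rule real_modular_mono[where \<omega> = \<phi>, OF phi_mono])
    fix t
    have "\<bar>u t\<bar> / l \<le> \<bar>u t\<bar> / k" using k by (intro divide_left_mono) auto
    then show "\<bar>u t / l\<bar> \<le> \<bar>u t / k\<bar>" using k by simp
  qed
  with k(2) show ?thesis by simp
qed

lemma lux_nrm_nonneg: "u \<in> lux.V \<Longrightarrow> 0 \<le> lux.nrm u"
  unfolding lux_nrm using lux_admissible_exists by (intro cInf_greatest) auto

lemma orlicz_sup_upper:
  "g \<in> borel_measurable M \<Longrightarrow> real_modular M \<phi> g \<le> 1 \<Longrightarrow> (\<integral>\<^sup>+t. ennreal \<bar>u t * g t\<bar> \<partial>M) \<le> orlicz_sup u"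
  unfolding orlicz_sup_def by (intro SUP_upper) auto

text \<open>
  Young's inequality for \<open>l * u\<close> and \<open>g\<close>. Finiteness matters because the Orlicz norm is
  \<open>enn2real\<close> of this supremum, which would turn the value \<open>\<infinity>\<close> into \<open>0\<close>.
\<close>

lemma orlicz_sup_finite:
  assumes u: "u \<in> orl.V"
  shows "orlicz_sup u < \<infinity>"
proof -
  obtain l where l: "0 < l" "real_modular M \<psi> (\<lambda>t. l * u t) < \<infinity>" and [measurable]: "u \<in> borel_measurable M"
    using u unfolding orl_V by blast
  have "orlicz_sup u \<le> ennreal (1 / l) * (1 + real_modular M \<psi> (\<lambda>t. l * u t))"
    unfolding orlicz_sup_def
  proof (rule SUP_least, safe)
    fix g assume [measurable]: "g \<in> borel_measurable M" and g: "real_modular M \<phi> g \<le> 1"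
    have [measurable]: "(\<lambda>t. \<psi> \<bar>l * u t\<bar>) \<in> borel_measurable M"
      by (rule borel_measurable_mono_abs[where \<omega> = \<psi>, OF psi_mono]) measurable
    have "(\<integral>\<^sup>+t. ennreal \<bar>u t * g t\<bar> \<partial>M) \<le> (\<integral>\<^sup>+t. ennreal (1 / l) * (\<phi> \<bar>g t\<bar> + \<psi> \<bar>l * u t\<bar>) \<partial>M)"
    proof (rule nn_integral_mono)
      fix t
      have "\<bar>u t * g t\<bar> = 1 / l * (\<bar>l * u t\<bar> * \<bar>g t\<bar>)" using l by (simp add: abs_mult)
      then have "ennreal \<bar>u t * g t\<bar> = ennreal (1 / l) * ennreal (\<bar>l * u t\<bar> * \<bar>g t\<bar>)"
        using l by (simp only: ennreal_mult[symmetric] abs_ge_zero mult_nonneg_nonneg divide_nonneg_pos zero_le_one)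
      also have "\<dots> \<le> ennreal (1 / l) * (\<phi> \<bar>g t\<bar> + \<psi> \<bar>l * u t\<bar>)"
        by (intro mult_left_mono young) auto
      finally show "ennreal \<bar>u t * g t\<bar> \<le> ennreal (1 / l) * (\<phi> \<bar>g t\<bar> + \<psi> \<bar>l * u t\<bar>)" .
    qed
    also have "\<dots> = ennreal (1 / l) * (real_modular M \<phi> g + real_modular M \<psi> (\<lambda>t. l * u t))"
      by (simp add: nn_integral_cmult nn_integral_add real_modular_def del: abs_mult)
    also have "\<dots> \<le> ennreal (1 / l) * (1 + real_modular M \<psi> (\<lambda>t. l * u t))"
      using g by (intro mult_left_mono add_mono) auto
    finally show "(\<integral>\<^sup>+t. ennreal \<bar>u t * g t\<bar> \<partial>M) \<le> ennreal (1 / l) * (1 + real_modular M \<psi> (\<lambda>t. l * u t))" .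
  qed
  also have "\<dots> < \<infinity>" using l by (simp add: ennreal_mult_less_top)
  finally show ?thesis .
qed

lemma orl_hoelder:
  assumes "u \<in> orl.V" "g \<in> borel_measurable M" "real_modular M \<phi> g \<le> 1"
  shows "(\<integral>\<^sup>+t. ennreal \<bar>u t * g t\<bar> \<partial>M) \<le> ennreal (orl.nrm u)"
  using orlicz_sup_upper[OF assms(2,3), of u] orlicz_sup_finite[OF assms(1)]
  by (simp add: orl_nrm less_top)

end

section \<open>Necessity of a linear or bounded Orlicz function\<close>

context orlicz_setting
begin

lemma real_modular_indicator:
  assumes "A \<in> sets M"
  shows "real_modular M \<phi> (\<lambda>t. c * indicator A t) = \<phi> \<bar>c\<bar> * emeasure M A"
proof -
  have "\<phi> \<bar>c * indicator A t\<bar> = \<phi> \<bar>c\<bar> * indicator A t" for t by (simp add: indicator_def)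
  then show ?thesis using assms by (simp add: real_modular_def nn_integral_cmult_indicator)
qed

lemma lux_indicator_V:
  assumes A: "A \<in> sets M" "emeasure M A < \<infinity>"
  shows "indicator A \<in> lux.V"
proof -
  obtain l where "0 < l" "\<phi> l < \<infinity>"
    using b_of_pos unfolding b_of_def less_Sup_iff by auto
  then have "real_modular M \<phi> (\<lambda>t. l * indicator A t) < \<infinity>"
    using A by (simp add: real_modular_indicator ennreal_mult_less_top)
  then show ?thesis using A \<open>0 < l\<close> unfolding lux_V by auto
qed

lemma orl_indicator_V:
  assumes A: "A \<in> sets M" "emeasure M A < \<infinity>"
  shows "indicator A \<in> orl.V"
proof -
  obtain l where l: "0 < l" "\<psi> l < \<infinity>" using psi_finite_point by blast
  have "\<psi> \<bar>l * indicator A t\<bar> = \<psi> l * indicator A t" for t using l psi_0 by (simp add: indicator_def)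
  then have "real_modular M \<psi> (\<lambda>t. l * indicator A t) < \<infinity>"
    using A l by (simp add: real_modular_def nn_integral_cmult_indicator ennreal_mult_less_top)
  then show ?thesis using A l unfolding orl_V by auto
qed

lemma orlicz_sup_scale: "orlicz_sup (\<lambda>t. c * u t) = ennreal \<bar>c\<bar> * orlicz_sup u" if [measurable]: "u \<in> borel_measurable M"
  unfolding orlicz_sup_def SUP_mult_left_ennreal
proof (rule SUP_cong[OF refl])
  fix g assume "g \<in> {g \<in> borel_measurable M. real_modular M \<phi> g \<le> 1}"
  then have [measurable]: "g \<in> borel_measurable M" by simp
  have "ennreal \<bar>c * u t * g t\<bar> = ennreal \<bar>c\<bar> * ennreal \<bar>u t * g t\<bar>" for t
    by (simp only: abs_mult ennreal_mult[symmetric] abs_ge_zero mult_nonneg_nonneg mult.assoc)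
  then show "(\<integral>\<^sup>+t. ennreal \<bar>c * u t * g t\<bar> \<partial>M) = ennreal \<bar>c\<bar> * (\<integral>\<^sup>+t. ennreal \<bar>u t * g t\<bar> \<partial>M)"
    by (simp add: nn_integral_cmult)
qed

context
  fixes A m k
  assumes A [measurable]: "A \<in> sets M" and m: "emeasure M A = ennreal m" "0 < m"
    and k: "0 < k" "ennreal k < b_of \<phi>" "\<phi> k = ennreal (1 / m)"
begin

lemma integral_le_on_ball:
  assumes [measurable]: "g \<in> borel_measurable M" and g: "real_modular M \<phi> g \<le> 1"
  shows "(\<integral>\<^sup>+t. ennreal \<bar>g t\<bar> * indicator A t \<partial>M) \<le> ennreal (k * m)"
proof -
  have "(\<integral>\<^sup>+t. ennreal \<bar>g t\<bar> * indicator A t \<partial>M) \<le> ennreal k * emeasure M A"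
    using m k g by (intro average_le) (auto simp: ennreal_mult[symmetric])
  then show ?thesis using m k by (simp add: ennreal_mult)
qed

text \<open>
  Since \<open>\<phi> k > 0\<close>, the function \<open>\<phi>\<close> increases strictly at \<open>k\<close>; hence the unit ball contains
  exactly the multiples of \<open>\<one>\<^sub>A\<close> up to \<open>k\<close>.
\<close>

lemma modular_indicator_le_1_iff:
  "real_modular M \<phi> (\<lambda>t. c * indicator A t) \<le> 1 \<longleftrightarrow> \<bar>c\<bar> \<le> k"
proof
  assume "\<bar>c\<bar> \<le> k"
  then have "\<phi> \<bar>c\<bar> * emeasure M A \<le> \<phi> k * emeasure M A" by (intro mult_right_mono phi_mono) auto
  also have "\<dots> = 1" using m k by (simp add: ennreal_mult[symmetric])
  finally show "real_modular M \<phi> (\<lambda>t. c * indicator A t) \<le> 1" by (simp add: real_modular_indicator)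
next
  assume le: "real_modular M \<phi> (\<lambda>t. c * indicator A t) \<le> 1"
  show "\<bar>c\<bar> \<le> k"
  proof (rule ccontr)
    assume "\<not> \<bar>c\<bar> \<le> k"
    then have kc: "k < \<bar>c\<bar>" by simp
    have "ennreal (1 / m) = \<phi> ((k / \<bar>c\<bar>) * \<bar>c\<bar>)" using k kc by simp
    also have "\<dots> \<le> ennreal (k / \<bar>c\<bar>) * \<phi> \<bar>c\<bar>" using k kc by (intro phi_scale) auto
    finally have "ennreal (1 / m) * ennreal m \<le> ennreal (k / \<bar>c\<bar>) * \<phi> \<bar>c\<bar> * ennreal m"
      by (rule mult_right_mono) simp
    also have "\<dots> \<le> ennreal (k / \<bar>c\<bar>) * 1"
      using le m by (simp only: real_modular_indicator[OF A] mult.assoc mult_left_mono zero_le)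
    finally have "1 \<le> ennreal (k / \<bar>c\<bar>)" using m by (simp add: ennreal_mult[symmetric])
    then show False using k kc by simp
  qed
qed

lemma lux_nrm_indicator: "lux.nrm (\<lambda>t. c * indicator A t) = \<bar>c\<bar> * (1 / k)"
proof -
  have "{l. 0 < l \<and> real_modular M \<phi> (\<lambda>t. c * indicator A t / l) \<le> 1} = {l. 0 < l \<and> \<bar>c\<bar> / k \<le> l}"
  proof (intro Collect_cong conj_cong refl)
    fix l :: real assume l: "0 < l"
    have "real_modular M \<phi> (\<lambda>t. (c / l) * indicator A t) \<le> 1 \<longleftrightarrow> \<bar>c / l\<bar> \<le> k"
      by (rule modular_indicator_le_1_iff)
    also have "\<dots> \<longleftrightarrow> \<bar>c\<bar> / k \<le> l" using l k by (simp add: field_simps)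
    finally show "real_modular M \<phi> (\<lambda>t. c * indicator A t / l) \<le> 1 \<longleftrightarrow> \<bar>c\<bar> / k \<le> l" by simp
  qed
  also have "Inf \<dots> = \<bar>c\<bar> / k" using k by (intro Inf_positive_above) auto
  finally show ?thesis by (simp add: lux_nrm)
qed

text \<open>
  The norm condition from \<open>daugavet_averaging\<close> is turned into a condition on modulars. Norm at
  most \<open>1\<close> bounds the modular only after division by a factor \<open>s > 1\<close>, so the averaging lemma is
  used with \<open>e / 2\<close> and \<open>s\<close> is small enough for \<open>(2 - e) * s \<le> 2 - e / 2\<close>.
\<close>

lemma lux_daugavet_imp_linear:
  assumes dp: "daugavet_property (L_luxemburg M \<phi>)"
  shows "linear_type \<phi> (1 / m / k)"
proof (rule linear_if_deviation_large[OF A m k])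
  fix e :: real assume e: "0 < e" "e < 1"
  have admissible: "set_integrable M A u \<and> \<bar>LINT t:A|M. u t\<bar> \<le> k * m * l"
    if u: "u \<in> borel_measurable M" and l: "0 < l" "real_modular M \<phi> (\<lambda>t. u t / l) \<le> 1" for u l
  proof -
    have ul: "(\<lambda>t. u t / l) \<in> borel_measurable M" using u by measurable
    note b = set_integral_bounds[OF A ul integral_le_on_ball[OF ul l(2)]]
    have "set_integrable M A (\<lambda>t. l * (u t / l))" using b(1) k m by (intro set_integrable_mult_right) auto
    moreover have "\<bar>LINT t:A|M. u t\<bar> = l * \<bar>LINT t:A|M. u t / l\<bar>" using l by simp
    moreover have "l * \<bar>LINT t:A|M. u t / l\<bar> \<le> l * (k * m)"
      using b(2) k m l by (intro mult_left_mono) auto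
    ultimately show ?thesis using l by (simp add: mult.commute)
  qed
  have "\<exists>u\<in>lux.V. lux.nrm u \<le> 1 \<and> 2 - e / 2 < lux.nrm (\<lambda>t. u t - (LINT t:A|M. u t) / m * indicator A t)"
  proof (rule lux.daugavet_averaging[where n = "1 / k" and K = "k * m"])
    show "daugavet_property lux.X" using dp by (simp add: L_luxemburg_def)
    show "indicator A \<in> lux.V" using m by (intro lux_indicator_V) auto
    show "lux.nrm (\<lambda>t. c * indicator A t) = \<bar>c\<bar> * (1 / k)" for c by (rule lux_nrm_indicator)
    fix u assume u: "u \<in> lux.V"
    obtain l where l: "0 < l" "real_modular M \<phi> (\<lambda>t. u t / l) \<le> 1" using lux_admissible_exists[OF u] by blast
    have um: "u \<in> borel_measurable M" using u by (simp add: lux_V)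
    show "set_integrable M A u" using admissible[OF um l] by blast
    show "\<bar>LINT t:A|M. u t\<bar> \<le> k * m * lux.nrm u"
    proof (rule field_le_epsilon)
      fix \<delta> :: real assume \<delta>: "0 < \<delta>"
      define l where "l = lux.nrm u + \<delta> / (k * m)"
      have "lux.nrm u < l" using \<delta> k m by (simp add: l_def)
      then have l: "0 < l" "real_modular M \<phi> (\<lambda>t. u t / l) \<le> 1"
        using lux_nrm_nonneg[OF u] lux_modular_le[OF u] by auto
      have "k * m * l = k * m * lux.nrm u + \<delta>" using k m by (simp add: l_def distrib_left)
      then show "\<bar>LINT t:A|M. u t\<bar> \<le> k * m * lux.nrm u + \<delta>" using admissible[OF um l] by simp
    qed
  qed (use A m k e in auto)
  then obtain u where u: "u \<in> lux.V" "lux.nrm u \<le> 1"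
    and big: "2 - e / 2 < lux.nrm (\<lambda>t. u t - (LINT t:A|M. u t) / m * indicator A t)" by blast
  have [measurable]: "u \<in> borel_measurable M" using u by (simp add: lux_V)
  define s where "s = 1 + e / 4"
  have s: "1 < s" "(2 - e) * s \<le> 2 - e / 2" using e by (auto simp: s_def algebra_simps)
  define y where "y t = u t / s" for t
  have "y \<in> borel_measurable M" unfolding y_def[abs_def] by measurable
  moreover have "real_modular M \<phi> y \<le> 1"
    unfolding y_def[abs_def] using u s by (intro lux_modular_le) auto
  moreover have "1 < real_modular M \<phi> (\<lambda>t. (y t - (LINT t:A|M. y t) / m * indicator A t) / (2 - e))"
  proof (rule ccontr)
    assume "\<not> ?thesis"
    moreover have "(y t - (LINT t:A|M. y t) / m * indicator A t) / (2 - e)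
        = (u t - (LINT t:A|M. u t) / m * indicator A t) / ((2 - e) * s)" for t
      using e s by (simp add: y_def[abs_def] diff_divide_distrib mult.commute)
    ultimately have "real_modular M \<phi> (\<lambda>t. (u t - (LINT t:A|M. u t) / m * indicator A t) / ((2 - e) * s)) \<le> 1"
      by (simp only: not_less)
    then have "lux.nrm (\<lambda>t. u t - (LINT t:A|M. u t) / m * indicator A t) \<le> (2 - e) * s"
      using e s by (intro lux_nrm_le) auto
    with big s show False by simp
  qed
  ultimately show "\<exists>y\<in>borel_measurable M. real_modular M \<phi> y \<le> 1 \<and>
      1 < real_modular M \<phi> (\<lambda>t. (y t - (LINT t:A|M. y t) / m * indicator A t) / (2 - e))" by blast
qed

text \<open>
  Here the norm is a supremum over the modular ball of \<open>\<phi>\<close>. If \<open>w = u - P u\<close> has norm above \<open>2 - e\<close>,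
  some \<open>y\<close> in that ball has \<open>\<integral> w * y > 2 - e\<close>, and \<open>\<integral> (u - P u) * y = \<integral> u * (y - P y)\<close>
  because averaging is self-adjoint. Were the modular of \<open>(y - P y) / (2 - e)\<close> at most \<open>1\<close>,
  the last integral would be at most \<open>(2 - e) * \<parallel>u\<parallel> \<le> 2 - e\<close>. So the same extremal condition
  on \<open>\<phi>\<close> as for the Luxemburg norm results.
\<close>

lemma orl_daugavet_imp_linear:
  assumes dp: "daugavet_property (L_orlicz M \<phi> \<psi>)"
  shows "linear_type \<phi> (1 / m / k)"
proof (rule linear_if_deviation_large[OF A m k])
  fix e :: real assume e: "0 < e" "e < 1"
  have indV: "indicator A \<in> orl.V" using m by (intro orl_indicator_V) auto
  have k_ball: "real_modular M \<phi> (\<lambda>t. k * indicator A t) \<le> 1"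
    using k by (simp add: modular_indicator_le_1_iff)
  have nn: "0 \<le> orl.nrm u" for u by (simp add: orl_nrm)
  have int_A: "(\<integral>\<^sup>+t. ennreal \<bar>u t\<bar> * indicator A t \<partial>M) \<le> ennreal (orl.nrm u / k)" if u: "u \<in> orl.V" for u
  proof -
    have [measurable]: "u \<in> borel_measurable M" using u by (simp add: orl_V)
    have "ennreal k * (\<integral>\<^sup>+t. ennreal \<bar>u t\<bar> * indicator A t \<partial>M) = (\<integral>\<^sup>+t. ennreal k * (ennreal \<bar>u t\<bar> * indicator A t) \<partial>M)"
      by (rule nn_integral_cmult[symmetric]) measurable
    also have "\<dots> = (\<integral>\<^sup>+t. ennreal \<bar>u t * (k * indicator A t)\<bar> \<partial>M)"
    proof (intro nn_integral_cong)
      fix t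
      have "ennreal k * ennreal \<bar>u t\<bar> = ennreal \<bar>u t * k\<bar>"
        using k by (subst ennreal_mult[symmetric]) (auto simp: abs_mult mult.commute)
      then show "ennreal k * (ennreal \<bar>u t\<bar> * indicator A t) = ennreal \<bar>u t * (k * indicator A t)\<bar>"
        by (simp add: indicator_def)
    qed
    also have "\<dots> \<le> ennreal (orl.nrm u)" by (rule orl_hoelder[OF u _ k_ball]) measurable
    also have "\<dots> = ennreal k * ennreal (orl.nrm u / k)"
      using k nn[of u] by (subst ennreal_mult[symmetric]) auto
    finally show ?thesis using k by (subst (asm) ennreal_mult_le_mult_iff) auto
  qed
  note bounds = set_integral_bounds[OF A _ int_A]
  have "\<exists>u\<in>orl.V. orl.nrm u \<le> 1 \<and> 2 - e < orl.nrm (\<lambda>t. u t - (LINT t:A|M. u t) / m * indicator A t)"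
  proof (rule orl.daugavet_averaging[where n = "orl.nrm (indicator A)" and K = "1 / k"])
    show "daugavet_property orl.X" using dp by (simp add: L_orlicz_def)
    show "orl.nrm (\<lambda>t. c * indicator A t) = \<bar>c\<bar> * orl.nrm (indicator A)" for c
      by (simp add: orl_nrm orlicz_sup_scale enn2real_mult)
    have "(\<integral>\<^sup>+t. ennreal \<bar>indicator A t * (k * indicator A t)\<bar> \<partial>M) \<le> ennreal (orl.nrm (indicator A))"
      by (rule orl_hoelder[OF indV _ k_ball]) measurable
    moreover have "(\<integral>\<^sup>+t. ennreal \<bar>indicator A t * (k * indicator A t)\<bar> \<partial>M) = (\<integral>\<^sup>+t. ennreal k * indicator A t \<partial>M)"
      using k by (intro nn_integral_cong) (auto simp: indicator_def)
    ultimately have "ennreal (k * m) \<le> ennreal (orl.nrm (indicator A))"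
      using k m by (simp add: nn_integral_cmult_indicator ennreal_mult)
    then have "k * m \<le> orl.nrm (indicator A)" using nn by simp
    moreover have "0 < k * m" using k m by simp
    ultimately show "0 < orl.nrm (indicator A)" by linarith
    fix u assume u: "u \<in> orl.V"
    have um: "u \<in> borel_measurable M" using u by (simp add: orl_V)
    have nk: "0 \<le> orl.nrm u / k" using nn k by simp
    show "set_integrable M A u" by (rule bounds(1)[OF um u nk])
    show "\<bar>LINT t:A|M. u t\<bar> \<le> 1 / k * orl.nrm u" using bounds(2)[OF um u nk] by simp
  qed (use A m k e indV in auto)
  then obtain u where u: "u \<in> orl.V" "orl.nrm u \<le> 1"
    and big: "2 - e < orl.nrm (\<lambda>t. u t - (LINT t:A|M. u t) / m * indicator A t)" by blast
  have um [measurable]: "u \<in> borel_measurable M" using u by (simp add: orl_V)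
  define a where "a = (LINT t:A|M. u t) / m"
  define w where "w t = u t - a * indicator A t" for t
  have [measurable]: "w \<in> borel_measurable M" unfolding w_def[abs_def] by measurable
  have "2 - e < orl.nrm w" using big by (simp add: w_def[abs_def] a_def)
  then have "2 - e < enn2real (orlicz_sup w)" by (simp add: orl_nrm)
  then have "ennreal (2 - e) < orlicz_sup w"
    using e by (cases "orlicz_sup w") (auto simp: ennreal_less_iff)
  then obtain g where gm: "g \<in> borel_measurable M" and g: "real_modular M \<phi> g \<le> 1"
    and gbig: "ennreal (2 - e) < (\<integral>\<^sup>+t. ennreal \<bar>w t * g t\<bar> \<partial>M)"
    unfolding orlicz_sup_def by (auto simp: less_SUP_iff)
  \<comment> \<open>Align the sign of the test function with \<open>w\<close>, so that the absolute value can be dropped.\<close>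
  define y where "y t = sgn (w t) * \<bar>g t\<bar>" for t
  have ym [measurable]: "y \<in> borel_measurable M"
    using gm unfolding y_def[abs_def] by measurable
  have wy: "w t * y t = \<bar>w t * g t\<bar>" for t
  proof -
    have "w t * sgn (w t) = \<bar>w t\<bar>" by (simp add: abs_sgn)
    then have "w t * sgn (w t) * \<bar>g t\<bar> = \<bar>w t\<bar> * \<bar>g t\<bar>" by simp
    then show ?thesis by (simp add: y_def abs_mult mult.assoc)
  qed
  have y1: "real_modular M \<phi> y \<le> 1"
  proof -
    have "real_modular M \<phi> y \<le> real_modular M \<phi> g"
      by (rule real_modular_mono[where \<omega> = \<phi>, OF phi_mono]) (auto simp: y_def abs_mult sgn_if)
    with g show ?thesis by simp
  qed
  define b where "b = (LINT t:A|M. y t) / m"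
  define z where "z t = (y t - b * indicator A t) / (2 - e)" for t
  have zm [measurable]: "z \<in> borel_measurable M" unfolding z_def[abs_def] by measurable
  have "1 < real_modular M \<phi> z"
  proof (rule ccontr)
    assume "\<not> 1 < real_modular M \<phi> z"
    then have z1: "real_modular M \<phi> z \<le> 1" by simp
    have iuA: "integrable M (\<lambda>t. indicator A t * u t)"
      using bounds(1)[OF um u(1)] nn[of u] k by (simp add: set_integrable_def)
    have iyA: "integrable M (\<lambda>t. indicator A t * y t)"
      using set_integral_bounds(1)[OF A ym integral_le_on_ball[OF ym y1]] k m by (simp add: set_integrable_def)
    have iuy: "integrable M (\<lambda>t. u t * y t)"
    proof (rule integrableI_bounded)
      have "(\<integral>\<^sup>+t. ennreal \<bar>u t * y t\<bar> \<partial>M) \<le> ennreal (orl.nrm u)" by (rule orl_hoelder[OF u(1) ym y1])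
      then show "(\<integral>\<^sup>+t. ennreal (norm (u t * y t)) \<partial>M) < \<infinity>" by (auto intro: le_less_trans)
    qed measurable
    have uA: "(\<integral>t. indicator A t * u t \<partial>M) = a * m" using m by (simp add: a_def set_lebesgue_integral_def)
    have yA: "(\<integral>t. indicator A t * y t \<partial>M) = b * m" using m by (simp add: b_def set_lebesgue_integral_def)
    have Iwy: "integrable M (\<lambda>t. w t * y t) \<and> (\<integral>t. w t * y t \<partial>M) = (\<integral>t. u t * y t \<partial>M) - a * (b * m)"
    proof -
      have "(\<lambda>t. w t * y t) = (\<lambda>t. u t * y t - a * (indicator A t * y t))"
        by (simp add: w_def algebra_simps)
      then show ?thesis using iuy iyA yA by simp
    qed
    have Iuz: "integrable M (\<lambda>t. u t * z t) \<and> (2 - e) * (\<integral>t. u t * z t \<partial>M) = (\<integral>t. u t * y t \<partial>M) - b * (a * m)"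
    proof -
      have "(\<lambda>t. u t * z t) = (\<lambda>t. (u t * y t - b * (indicator A t * u t)) / (2 - e))"
        by (simp add: z_def algebra_simps)
      then show ?thesis using iuy iuA uA e by simp
    qed
    have "ennreal \<bar>\<integral>t. u t * z t \<partial>M\<bar> \<le> (\<integral>\<^sup>+t. ennreal \<bar>u t * z t\<bar> \<partial>M)"
      using integral_norm_bound_ennreal[of M "\<lambda>t. u t * z t"] Iuz by simp
    also have "\<dots> \<le> ennreal (orl.nrm u)" by (rule orl_hoelder[OF u(1) zm z1])
    finally have "\<bar>\<integral>t. u t * z t \<partial>M\<bar> \<le> 1" using u(2) nn[of u] by simp
    then have "(2 - e) * (\<integral>t. u t * z t \<partial>M) \<le> (2 - e) * 1" using e by (intro mult_left_mono) auto
    then have "(\<integral>t. w t * y t \<partial>M) \<le> 2 - e" using Iuz Iwy by (simp add: mult.left_commute)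
    moreover have "(\<integral>\<^sup>+t. ennreal \<bar>w t * g t\<bar> \<partial>M) = ennreal (\<integral>t. w t * y t \<partial>M)"
      unfolding wy[symmetric] using Iwy by (intro nn_integral_eq_integral) (auto simp: wy)
    ultimately show False using gbig ennreal_leI[of "\<integral>t. w t * y t \<partial>M" "2 - e"] by (simp add: not_le[symmetric])
  qed
  then show "\<exists>y\<in>borel_measurable M. real_modular M \<phi> y \<le> 1 \<and>
      1 < real_modular M \<phi> (\<lambda>t. (y t - (LINT t:A|M. y t) / m * indicator A t) / (2 - e))"
    using ym y1 by (intro bexI[of _ y]) (auto simp: z_def[abs_def] b_def)
qed

end

lemma lux_daugavet_imp:
  assumes "daugavet_property (L_luxemburg M \<phi>)"
  shows "(\<exists>c. linear_type \<phi> c) \<or> (\<exists>\<beta>. bounded_type M \<phi> \<beta>)"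
proof (rule disjCI)
  assume "\<not> (\<exists>\<beta>. bounded_type M \<phi> \<beta>)"
  then have "\<And>\<beta>. \<not> bounded_type M \<phi> \<beta>" by simp
  from level_set_exists[OF sigma_finite_measure_axioms nontriv this] obtain A m k
    where "A \<in> sets M" "emeasure M A = ennreal m" "0 < m"
      "0 < k" "ennreal k < b_of \<phi>" "\<phi> k = ennreal (1 / m)" .
  from lux_daugavet_imp_linear[OF this assms] show "\<exists>c. linear_type \<phi> c" by blast
qed

lemma orl_daugavet_imp:
  assumes "daugavet_property (L_orlicz M \<phi> \<psi>)"
  shows "(\<exists>c. linear_type \<phi> c) \<or> (\<exists>\<beta>. bounded_type M \<phi> \<beta>)"
proof (rule disjCI)
  assume "\<not> (\<exists>\<beta>. bounded_type M \<phi> \<beta>)"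
  then have "\<And>\<beta>. \<not> bounded_type M \<phi> \<beta>" by simp
  from level_set_exists[OF sigma_finite_measure_axioms nontriv this] obtain A m k
    where "A \<in> sets M" "emeasure M A = ennreal m" "0 < m"
      "0 < k" "ennreal k < b_of \<phi>" "\<phi> k = ennreal (1 / m)" .
  from orl_daugavet_imp_linear[OF this assms] show "\<exists>c. linear_type \<phi> c" by blast
qed

end

section \<open>The norms for linear and for bounded Orlicz functions\<close>

context orlicz_setting
begin

context
  fixes c
  assumes lin: "linear_type \<phi> c"
begin

lemma c_pos: "0 < c" and phi_lin: "0 \<le> u \<Longrightarrow> \<phi> u = ennreal (c * u)"
  using lin by (auto simp: linear_type_def)

lemma real_modular_linear:
  assumes [measurable]: "u \<in> borel_measurable M"
  shows "real_modular M \<phi> u = ennreal c * (\<integral>\<^sup>+t. ennreal \<bar>u t\<bar> \<partial>M)"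
proof -
  have "\<phi> \<bar>u t\<bar> = ennreal c * ennreal \<bar>u t\<bar>" for t
    using c_pos by (simp add: phi_lin ennreal_mult)
  then show ?thesis by (simp add: real_modular_def nn_integral_cmult)
qed

lemma lux_V_linear: "u \<in> lux.V \<longleftrightarrow> integrable M u"
proof
  assume "u \<in> lux.V"
  then obtain l where l: "0 < l" "real_modular M \<phi> (\<lambda>t. l * u t) < \<infinity>"
    and [measurable]: "u \<in> borel_measurable M" unfolding lux_V by blast
  then have "(\<integral>\<^sup>+t. ennreal \<bar>l * u t\<bar> \<partial>M) < \<infinity>"
    using c_pos by (subst (asm) real_modular_linear) (auto simp: ennreal_mult_less_top)
  then have "integrable M (\<lambda>t. l * u t)" by (intro integrableI_bounded) auto
  then show "integrable M u" using l by simp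
next
  assume u: "integrable M u"
  then have um [measurable]: "u \<in> borel_measurable M" by simp
  have "(\<integral>\<^sup>+t. ennreal \<bar>u t\<bar> \<partial>M) < \<infinity>" using u by (simp add: integrable_iff_bounded)
  then have "real_modular M \<phi> (\<lambda>t. 1 * u t) < \<infinity>"
    by (simp add: real_modular_linear[OF um] ennreal_mult_less_top)
  then show "u \<in> lux.V" unfolding lux_V using um by (intro conjI exI[of _ 1]) auto
qed

lemma lux_nrm_linear:
  assumes u: "integrable M u"
  shows "lux.nrm u = c * (\<integral>t. \<bar>u t\<bar> \<partial>M)"
proof -
  have "real_modular M \<phi> (\<lambda>t. u t / l) \<le> 1 \<longleftrightarrow> c * (\<integral>t. \<bar>u t\<bar> \<partial>M) \<le> l" if l: "0 < l" for l
  proof -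
    have ul: "(\<lambda>t. u t / l) \<in> borel_measurable M" using u by simp
    have "(\<integral>\<^sup>+t. ennreal \<bar>u t / l\<bar> \<partial>M) = ennreal (\<integral>t. \<bar>u t / l\<bar> \<partial>M)"
      using u by (intro nn_integral_eq_integral) auto
    then have "real_modular M \<phi> (\<lambda>t. u t / l) = ennreal (c * ((\<integral>t. \<bar>u t\<bar> \<partial>M) / l))"
      using l c_pos by (simp add: real_modular_linear[OF ul] ennreal_mult[symmetric])
    then have "real_modular M \<phi> (\<lambda>t. u t / l) \<le> 1 \<longleftrightarrow> c * ((\<integral>t. \<bar>u t\<bar> \<partial>M) / l) \<le> 1" by simp
    also have "\<dots> \<longleftrightarrow> c * (\<integral>t. \<bar>u t\<bar> \<partial>M) \<le> l" using l by (simp add: field_simps)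
    finally show ?thesis .
  qed
  then have "{l. 0 < l \<and> real_modular M \<phi> (\<lambda>t. u t / l) \<le> 1} = {l. 0 < l \<and> c * (\<integral>t. \<bar>u t\<bar> \<partial>M) \<le> l}" by auto
  then show ?thesis unfolding lux_nrm using c_pos by (simp add: Inf_positive_above)
qed

lemma psi_linear_below:
  assumes "0 \<le> u" "u \<le> c"
  shows "\<psi> u = 0"
proof -
  have "\<psi> u \<le> ennreal 0"
  proof (rule psi_le)
    fix v :: real assume v: "0 < v"
    then have "ennreal (u * v) \<le> ennreal (c * v)" using assms by (intro ennreal_leI mult_right_mono) auto
    then show "ennreal (u * v) \<le> \<phi> v + ennreal 0" using v by (simp add: phi_lin)
  qed (use assms in auto)
  then show ?thesis by simp
qed

lemma psi_linear_above:
  assumes "c < u"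
  shows "\<psi> u = \<infinity>"
proof (rule ccontr)
  assume "\<psi> u \<noteq> \<infinity>"
  then obtain B where B: "\<psi> u = ennreal B" "0 \<le> B" by (cases "\<psi> u") auto
  define v where "v = (B + 1) / (u - c)"
  have v: "0 < v" "(u - c) * v = B + 1" using assms B by (auto simp: v_def)
  have "ennreal (u * v - c * v) \<le> \<psi> u"
    using v assms c_pos by (intro psi_ge) (auto simp: phi_lin)
  moreover have "u * v - c * v = B + 1" using v by (simp add: left_diff_distrib)
  ultimately show False using B by simp
qed

lemma a_of_linear: "a_of \<psi> = ennreal c"
  unfolding a_of_def
proof (rule antisym)
  show "Sup {ennreal u |u. 0 \<le> u \<and> \<psi> u = 0} \<le> ennreal c"
  proof (rule Sup_least, clarify)
    fix u assume "0 \<le> u" "\<psi> u = 0"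
    then have "\<not> c < u" using psi_linear_above[of u] by auto
    then show "ennreal u \<le> ennreal c" by (intro ennreal_leI) simp
  qed
  show "ennreal c \<le> Sup {ennreal u |u. 0 \<le> u \<and> \<psi> u = 0}"
    using psi_linear_below[of c] c_pos by (intro Sup_upper) auto
qed

lemma orl_V_linear: "u \<in> orl.V \<longleftrightarrow> u \<in> borel_measurable M \<and> (\<exists>C. AE t in M. \<bar>u t\<bar> \<le> C)"
proof (intro iffI)
  assume "u \<in> orl.V"
  then obtain l where l: "0 < l" "real_modular M \<psi> (\<lambda>t. l * u t) < \<infinity>"
    and um [measurable]: "u \<in> borel_measurable M" unfolding orl_V by blast
  have meas: "(\<lambda>t. \<psi> \<bar>l * u t\<bar>) \<in> borel_measurable M"
    by (rule borel_measurable_mono_abs[where \<omega> = \<psi>, OF psi_mono]) measurable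
  have "AE t in M. \<psi> \<bar>l * u t\<bar> \<noteq> \<infinity>"
    using l(2) unfolding real_modular_def by (intro nn_integral_PInf_AE[OF meas]) auto
  then have "AE t in M. \<bar>u t\<bar> \<le> c / l"
  proof eventually_elim
    case (elim t)
    then have "\<bar>l * u t\<bar> \<le> c" using psi_linear_above[of "\<bar>l * u t\<bar>"] by (auto simp: not_less[symmetric])
    then show ?case using l by (simp add: abs_mult field_simps)
  qed
  with um show "u \<in> borel_measurable M \<and> (\<exists>C. AE t in M. \<bar>u t\<bar> \<le> C)" by blast
next
  assume u: "u \<in> borel_measurable M \<and> (\<exists>C. AE t in M. \<bar>u t\<bar> \<le> C)"
  then obtain C where C: "AE t in M. \<bar>u t\<bar> \<le> C" by blast
  define l where "l = c / (\<bar>C\<bar> + 1)"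
  have l: "0 < l" using c_pos by (simp add: l_def)
  have lC: "l * \<bar>C\<bar> \<le> c" using c_pos by (simp add: l_def field_simps)
  have "AE t in M. \<psi> \<bar>l * u t\<bar> = 0"
    using C
  proof eventually_elim
    case (elim t)
    have "l * \<bar>u t\<bar> \<le> l * \<bar>C\<bar>" using elim l by (intro mult_left_mono) auto
    then have "l * \<bar>u t\<bar> \<le> c" using lC by (rule order_trans)
    then show ?case using l by (intro psi_linear_below) (auto simp: abs_mult)
  qed
  then have "real_modular M \<psi> (\<lambda>t. l * u t) = (\<integral>\<^sup>+t. 0 \<partial>M)"
    unfolding real_modular_def by (rule nn_integral_cong_AE)
  then have "real_modular M \<psi> (\<lambda>t. l * u t) < \<infinity>" by simp
  then show "u \<in> orl.V" unfolding orl_V using u l by blast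
qed

lemma orl_nrm_le_iff: "u \<in> orl.V \<Longrightarrow> 0 \<le> C \<Longrightarrow> orl.nrm u \<le> C \<longleftrightarrow> orlicz_sup u \<le> ennreal C"
  using orlicz_sup_finite[of u] by (cases "orlicz_sup u") (auto simp: orl_nrm)

text \<open>
  The ball of test functions is that of \<open>L\<^sub>1\<close> with weight \<open>c\<close>, whose dual norm is the essential
  supremum divided by \<open>c\<close>. For the lower estimate one tests with normalized indicators of sets of
  finite measure on which \<open>\<bar>u\<bar>\<close> exceeds \<open>c * C + d\<close>.
\<close>

lemma orl_nrm_linear:
  assumes u: "u \<in> orl.V" and C: "0 \<le> C"
  shows "orl.nrm u \<le> C \<longleftrightarrow> (AE t in M. 1 / c * \<bar>u t\<bar> \<le> C)"
proof -
  have [measurable]: "u \<in> borel_measurable M" using u by (simp add: orl_V)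
  have iff: "1 / c * \<bar>u t\<bar> \<le> C \<longleftrightarrow> \<bar>u t\<bar> \<le> c * C" for t using c_pos by (simp add: field_simps)
  show ?thesis
    unfolding iff
  proof
    assume nC: "orl.nrm u \<le> C"
    show "AE t in M. \<bar>u t\<bar> \<le> c * C"
    proof (rule AE_le_if_all_above, rule ccontr)
      fix d :: real assume d: "0 < d" and neg: "\<not> (AE t in M. \<bar>u t\<bar> \<le> c * C + d)"
      define S where "S = {t \<in> space M. \<not> \<bar>u t\<bar> \<le> c * C + d}"
      have Sm: "S \<in> sets M" unfolding S_def by measurable
      have "emeasure M S \<noteq> 0" using neg AE_iff_measurable[OF Sm, of "\<lambda>t. \<bar>u t\<bar> \<le> c * C + d"] by (simp add: S_def)
      then have "0 < emeasure M S" by (simp add: zero_less_iff_neq_zero)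
      from finite_subset_large[OF Sm this] obtain A
        where A [measurable]: "A \<in> sets M" and AS: "A \<subseteq> S" "emeasure M A < \<infinity>" "0 < emeasure M A" .
      then obtain m where m: "emeasure M A = ennreal m" "0 < m"
        by (cases "emeasure M A") (auto simp: ennreal_less_zero_iff)
      define a where "a = 1 / (c * m)"
      have a: "0 < a" "c * (a * m) = 1" using c_pos m by (auto simp: a_def)
      have "real_modular M \<phi> (\<lambda>t. a * indicator A t) = ennreal (c * (a * m))"
        using a c_pos m by (simp add: real_modular_indicator[OF A] phi_lin ennreal_mult[symmetric] mult.assoc)
      then have "real_modular M \<phi> (\<lambda>t. a * indicator A t) \<le> 1" using a by simp
      then have le: "(\<integral>\<^sup>+t. ennreal \<bar>u t * (a * indicator A t)\<bar> \<partial>M) \<le> ennreal (orl.nrm u)"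
        by (intro orl_hoelder[OF u]) measurable
      have "ennreal (a * (c * C + d)) * emeasure M A = (\<integral>\<^sup>+t. ennreal (a * (c * C + d)) * indicator A t \<partial>M)"
        by (rule nn_integral_cmult_indicator[symmetric]) measurable
      also have "\<dots> \<le> (\<integral>\<^sup>+t. ennreal \<bar>u t * (a * indicator A t)\<bar> \<partial>M)"
      proof (rule nn_integral_mono)
        fix t
        show "ennreal (a * (c * C + d)) * indicator A t \<le> ennreal \<bar>u t * (a * indicator A t)\<bar>"
        proof (cases "t \<in> A")
          case True
          then have "c * C + d \<le> \<bar>u t\<bar>" using AS by (auto simp: S_def)
          then have "a * (c * C + d) \<le> a * \<bar>u t\<bar>" using a by (intro mult_left_mono) auto
          then show ?thesis using True a by (simp add: abs_mult mult.commute ennreal_leI)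
        qed simp
      qed
      also have "\<dots> \<le> ennreal C" using le nC by (auto intro: order_trans ennreal_leI)
      finally have "ennreal (a * (c * C + d) * m) \<le> ennreal C"
        using a m c_pos C d by (simp add: ennreal_mult)
      then have "a * (c * C + d) * m \<le> C" using C by simp
      moreover have "a * (c * C + d) * m = c * (a * m) * C + a * d * m" by (simp add: algebra_simps)
      moreover have "0 < a * d * m" using a d m by simp
      ultimately show False using a by simp
    qed
  next
    assume ae: "AE t in M. \<bar>u t\<bar> \<le> c * C"
    have "orlicz_sup u \<le> ennreal C"
      unfolding orlicz_sup_def
    proof (rule SUP_least, safe)
      fix g assume gm [measurable]: "g \<in> borel_measurable M" and g: "real_modular M \<phi> g \<le> 1"
      have "(\<integral>\<^sup>+t. ennreal \<bar>u t * g t\<bar> \<partial>M) \<le> (\<integral>\<^sup>+t. ennreal (c * C) * ennreal \<bar>g t\<bar> \<partial>M)"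
      proof (rule nn_integral_mono_AE)
        show "AE t in M. ennreal \<bar>u t * g t\<bar> \<le> ennreal (c * C) * ennreal \<bar>g t\<bar>"
          using ae
        proof eventually_elim
          case (elim t)
          have "\<bar>u t * g t\<bar> \<le> c * C * \<bar>g t\<bar>" unfolding abs_mult using elim by (intro mult_right_mono) auto
          then have "ennreal \<bar>u t * g t\<bar> \<le> ennreal (c * C * \<bar>g t\<bar>)" by (rule ennreal_leI)
          then show ?case using c_pos C by (simp add: ennreal_mult)
        qed
      qed
      also have "\<dots> = ennreal C * real_modular M \<phi> g"
        using C c_pos by (simp add: nn_integral_cmult real_modular_linear ennreal_mult mult_ac)
      also have "\<dots> \<le> ennreal C * 1" using g by (intro mult_left_mono) auto
      finally show "(\<integral>\<^sup>+t. ennreal \<bar>u t * g t\<bar> \<partial>M) \<le> ennreal C" by simp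
    qed
    then show "orl.nrm u \<le> C" using orl_nrm_le_iff[OF u C] by simp
  qed
qed

end

context
  fixes \<beta>
  assumes bt: "bounded_type M \<phi> \<beta>"
begin

lemma \<beta>_pos: "0 < \<beta>" and b_eq: "b_of \<phi> = ennreal \<beta>"
  and phi_\<beta>: "\<phi> \<beta> * emeasure M (space M) \<le> 1"
  using bt by (auto simp: bounded_type_def)

lemma AE_le_if_modular_finite:
  assumes [measurable]: "g \<in> borel_measurable M" and g: "real_modular M \<phi> g < \<infinity>"
  shows "AE t in M. \<bar>g t\<bar> \<le> \<beta>"
proof -
  have "AE t in M. \<phi> \<bar>g t\<bar> \<noteq> \<infinity>"
    using g unfolding real_modular_def by (intro nn_integral_PInf_AE) auto
  then show ?thesis
  proof eventually_elim
    case (elim t)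
    show ?case
    proof (rule ccontr)
      assume "\<not> \<bar>g t\<bar> \<le> \<beta>"
      then have "b_of \<phi> < ennreal \<bar>g t\<bar>" using \<beta>_pos by (simp add: b_eq ennreal_less_iff)
      with elim show False using phi_eq_top_above_b by blast
    qed
  qed
qed

text \<open>
  This is where the bound \<open>\<phi> \<beta> * \<mu>(\<Omega>) \<le> 1\<close> enters: the modular ball contains every function
  bounded by \<open>\<beta>\<close>.
\<close>

lemma modular_le_1_if_AE:
  assumes "AE t in M. \<bar>g t\<bar> \<le> \<beta>"
  shows "real_modular M \<phi> g \<le> 1"
proof -
  have "real_modular M \<phi> g \<le> (\<integral>\<^sup>+t. \<phi> \<beta> \<partial>M)"
    unfolding real_modular_def using assms
    by (intro nn_integral_mono_AE) (auto elim!: eventually_mono intro: phi_mono)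
  also have "\<dots> \<le> 1" using phi_\<beta> by simp
  finally show ?thesis .
qed

lemma lux_V_bounded: "u \<in> lux.V \<longleftrightarrow> u \<in> borel_measurable M \<and> (\<exists>C. AE t in M. \<bar>u t\<bar> \<le> C)"
proof (intro iffI)
  assume "u \<in> lux.V"
  then obtain l where l: "0 < l" "real_modular M \<phi> (\<lambda>t. l * u t) < \<infinity>"
    and um [measurable]: "u \<in> borel_measurable M" unfolding lux_V by blast
  have "AE t in M. \<bar>l * u t\<bar> \<le> \<beta>" by (rule AE_le_if_modular_finite[OF _ l(2)]) measurable
  then have "AE t in M. \<bar>u t\<bar> \<le> \<beta> / l"
    by eventually_elim (use l in \<open>simp add: abs_mult field_simps\<close>)
  with um show "u \<in> borel_measurable M \<and> (\<exists>C. AE t in M. \<bar>u t\<bar> \<le> C)" by blast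
next
  assume u: "u \<in> borel_measurable M \<and> (\<exists>C. AE t in M. \<bar>u t\<bar> \<le> C)"
  then obtain C where C: "AE t in M. \<bar>u t\<bar> \<le> C" by blast
  define l where "l = \<beta> / (\<bar>C\<bar> + 1)"
  have l: "0 < l" using \<beta>_pos by (simp add: l_def)
  have lC: "l * \<bar>C\<bar> \<le> \<beta>" using \<beta>_pos by (simp add: l_def field_simps)
  have "AE t in M. \<bar>l * u t\<bar> \<le> \<beta>"
    using C
  proof eventually_elim
    case (elim t)
    have "l * \<bar>u t\<bar> \<le> l * \<bar>C\<bar>" using elim l by (intro mult_left_mono) auto
    then have "l * \<bar>u t\<bar> \<le> \<beta>" using lC by (rule order_trans)
    then show ?case using l by (simp add: abs_mult)
  qed
  then have "real_modular M \<phi> (\<lambda>t. l * u t) \<le> 1" by (rule modular_le_1_if_AE)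
  then have "real_modular M \<phi> (\<lambda>t. l * u t) < \<infinity>" by (rule le_less_trans) simp
  then show "u \<in> lux.V" unfolding lux_V using u l by blast
qed

lemma lux_nrm_bounded:
  assumes u: "u \<in> lux.V" and C: "0 \<le> C"
  shows "lux.nrm u \<le> C \<longleftrightarrow> (AE t in M. 1 / \<beta> * \<bar>u t\<bar> \<le> C)"
proof -
  have um [measurable]: "u \<in> borel_measurable M" using u by (simp add: lux_V)
  have iff: "\<bar>u t / l\<bar> \<le> \<beta> \<longleftrightarrow> 1 / \<beta> * \<bar>u t\<bar> \<le> l" if "0 < l" for l t
    using that \<beta>_pos by (simp add: field_simps)
  show ?thesis
  proof
    assume nC: "lux.nrm u \<le> C"
    show "AE t in M. 1 / \<beta> * \<bar>u t\<bar> \<le> C"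
    proof (rule AE_le_if_all_above)
      fix d :: real assume d: "0 < d"
      have "real_modular M \<phi> (\<lambda>t. u t / (C + d)) \<le> 1" using nC d by (intro lux_modular_le[OF u]) auto
      then have "real_modular M \<phi> (\<lambda>t. u t / (C + d)) < \<infinity>" by (rule le_less_trans) simp
      then have "AE t in M. \<bar>u t / (C + d)\<bar> \<le> \<beta>" by (rule AE_le_if_modular_finite[rotated]) measurable
      then show "AE t in M. 1 / \<beta> * \<bar>u t\<bar> \<le> C + d" using iff[of "C + d"] C d by simp
    qed
  next
    assume ae: "AE t in M. 1 / \<beta> * \<bar>u t\<bar> \<le> C"
    show "lux.nrm u \<le> C"
    proof (rule field_le_epsilon)
      fix d :: real assume d: "0 < d"
      have "AE t in M. \<bar>u t / (C + d)\<bar> \<le> \<beta>"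
        using ae
      proof eventually_elim
        case (elim t)
        then show ?case using iff[of "C + d" t] C d by simp
      qed
      then show "lux.nrm u \<le> C + d" using C d by (intro lux_nrm_le modular_le_1_if_AE) auto
    qed
  qed
qed

lemma orlicz_sup_bounded:
  assumes [measurable]: "u \<in> borel_measurable M"
  shows "orlicz_sup u = (\<integral>\<^sup>+t. ennreal (\<beta> * \<bar>u t\<bar>) \<partial>M)"
proof (rule antisym)
  show "orlicz_sup u \<le> (\<integral>\<^sup>+t. ennreal (\<beta> * \<bar>u t\<bar>) \<partial>M)"
    unfolding orlicz_sup_def
  proof (rule SUP_least, safe)
    fix g assume gm: "g \<in> borel_measurable M" and g: "real_modular M \<phi> g \<le> 1"
    have "real_modular M \<phi> g < \<infinity>" using g by (rule le_less_trans) simp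
    from AE_le_if_modular_finite[OF gm this]
    have "AE t in M. ennreal \<bar>u t * g t\<bar> \<le> ennreal (\<beta> * \<bar>u t\<bar>)"
    proof eventually_elim
      case (elim t)
      then have "\<bar>g t\<bar> * \<bar>u t\<bar> \<le> \<beta> * \<bar>u t\<bar>" by (intro mult_right_mono) auto
      then show ?case by (intro ennreal_leI) (simp add: abs_mult mult.commute)
    qed
    then show "(\<integral>\<^sup>+t. ennreal \<bar>u t * g t\<bar> \<partial>M) \<le> (\<integral>\<^sup>+t. ennreal (\<beta> * \<bar>u t\<bar>) \<partial>M)"
      by (rule nn_integral_mono_AE)
  qed
  have "(\<integral>\<^sup>+t. ennreal \<bar>u t * \<beta>\<bar> \<partial>M) \<le> orlicz_sup u"
    using \<beta>_pos by (intro orlicz_sup_upper modular_le_1_if_AE) auto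
  then show "(\<integral>\<^sup>+t. ennreal (\<beta> * \<bar>u t\<bar>) \<partial>M) \<le> orlicz_sup u"
    using \<beta>_pos by (simp add: abs_mult mult.commute)
qed

text \<open>
  Integrability is read off from the Orlicz norm rather than from a formula for \<open>\<psi>\<close>: the constant
  \<open>\<beta>\<close> is an admissible test function. Conversely \<open>\<psi> v \<le> \<beta> * v\<close>, since only \<open>w \<le> \<beta>\<close> matter in the
  supremum that defines \<open>\<psi>\<close>.
\<close>

lemma orl_V_bounded: "u \<in> orl.V \<longleftrightarrow> integrable M u"
proof
  assume u: "u \<in> orl.V"
  then have [measurable]: "u \<in> borel_measurable M" by (simp add: orl_V)
  have "(\<integral>\<^sup>+t. ennreal (\<beta> * \<bar>u t\<bar>) \<partial>M) < \<infinity>"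
    using orlicz_sup_finite[OF u] by (simp add: orlicz_sup_bounded)
  then have "integrable M (\<lambda>t. \<beta> * u t)"
    using \<beta>_pos by (intro integrableI_bounded) (auto simp: abs_mult)
  then show "integrable M u" using \<beta>_pos by simp
next
  assume u: "integrable M u"
  have psi_\<beta>: "\<psi> v \<le> ennreal (\<beta> * v)" if v: "0 \<le> v" for v
  proof (rule psi_le[OF v])
    fix w :: real assume w: "0 < w"
    show "ennreal (v * w) \<le> \<phi> w + ennreal (\<beta> * v)"
    proof (cases "w \<le> \<beta>")
      case True
      then have "v * w \<le> \<beta> * v" using v by (subst mult.commute) (rule mult_right_mono)
      then show ?thesis by (intro add_increasing ennreal_leI) auto
    next
      case False
      then have "\<phi> w = \<infinity>" using \<beta>_pos by (intro phi_eq_top_above_b) (auto simp: b_eq ennreal_less_iff)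
      then show ?thesis by simp
    qed
  qed (use v \<beta>_pos in auto)
  have "real_modular M \<psi> (\<lambda>t. 1 * u t) \<le> (\<integral>\<^sup>+t. ennreal (\<beta> * \<bar>u t\<bar>) \<partial>M)"
    unfolding real_modular_def by (intro nn_integral_mono) (auto intro: psi_\<beta>)
  also have "\<dots> = ennreal (\<integral>t. \<beta> * \<bar>u t\<bar> \<partial>M)"
    using u \<beta>_pos by (intro nn_integral_eq_integral) auto
  also have "\<dots> < \<infinity>" by simp
  finally show "u \<in> orl.V" unfolding orl_V using u by (intro conjI exI[of _ 1]) auto
qed

lemma orl_nrm_bounded:
  assumes u: "integrable M u"
  shows "orl.nrm u = \<beta> * (\<integral>t. \<bar>u t\<bar> \<partial>M)"
proof -
  have "orlicz_sup u = ennreal (\<integral>t. \<beta> * \<bar>u t\<bar> \<partial>M)"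
    unfolding orlicz_sup_bounded[OF borel_measurable_integrable[OF u]]
    using u \<beta>_pos by (intro nn_integral_eq_integral) auto
  then show ?thesis using \<beta>_pos by (simp add: orl_nrm)
qed

end

end

section \<open>Equivalence of the four conditions\<close>

lemma L1_weighted_eq:
  "L1_weighted M c = class_space M (L1_class M) (\<lambda>f. enn2real (\<integral>\<^sup>+t. c * e2ennreal \<bar>f t\<bar> \<partial>M))"
  by (simp add: L1_weighted_def L1_class_def)

lemma Linf_weighted_eq:
  "Linf_weighted M c = class_space M (Linf_class M) (\<lambda>f. enn2real (esssup M (\<lambda>t. c * e2ennreal \<bar>f t\<bar>)))"
  by (simp add: Linf_weighted_def Linf_class_def)

lemma integrable_indicator_real:
  assumes "A \<in> sets M" "emeasure M A = ennreal m" "0 \<le> m"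
  shows "integrable M (indicat_real A)" "(\<integral>t. \<bar>indicat_real A t\<bar> \<partial>M) = m"
proof -
  show "integrable M (indicat_real A)" using assms by simp
  have "measure M (A \<inter> space M) = m"
    using assms sets.sets_into_space[OF assms(1)] by (simp add: measure_def Int_absorb2)
  then show "(\<integral>t. \<bar>indicat_real A t\<bar> \<partial>M) = m" by simp
qed

lemma Linf_indicator_norm:
  assumes A: "A \<in> sets M" "0 < emeasure M A" and c: "0 < c"
  shows "(\<lambda>t. ereal (indicator A t)) \<in> Linf_class M"
    "enn2real (esssup M (\<lambda>t. ennreal c * e2ennreal \<bar>ereal (indicator A t)\<bar>)) = c"
proof -
  show V: "(\<lambda>t. ereal (indicator A t)) \<in> Linf_class M"
    unfolding Linf_class_real using A by (intro conjI exI[of _ 1]) (auto simp: indicator_def)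
  show "enn2real (esssup M (\<lambda>t. ennreal c * e2ennreal \<bar>ereal (indicator A t)\<bar>)) = c"
  proof (rule eq_if_same_upper_bounds)
    fix C :: real assume C: "0 \<le> C"
    have "(AE t in M. c * \<bar>indicator A t\<bar> \<le> C) \<longleftrightarrow> c \<le> C"
    proof
      assume ae: "AE t in M. c * \<bar>indicator A t\<bar> \<le> C"
      show "c \<le> C"
      proof (rule ccontr)
        assume "\<not> c \<le> C"
        then have "AE t in M. t \<notin> A" using ae by (auto elim!: eventually_mono)
        then have "emeasure M A = 0"
          using AE_iff_measurable[OF A(1), of "\<lambda>t. t \<notin> A"] sets.sets_into_space[OF A(1)] by auto
        with A(2) show False by simp
      qed
    next
      assume "c \<le> C"
      then show "AE t in M. c * \<bar>indicator A t\<bar> \<le> C" using C by (auto simp: indicator_def)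
    qed
    then show "enn2real (esssup M (\<lambda>t. ennreal c * e2ennreal \<bar>ereal (indicator A t)\<bar>)) \<le> C \<longleftrightarrow> c \<le> C"
      using Linf_norm_real[OF V c C] by simp
  qed (use c in auto)
qed

context ae_space
begin

lemma same_space_L1:
  assumes c: "0 < c" and V_iff: "\<And>u. u \<in> V \<longleftrightarrow> integrable M u"
    and nrm_eq: "\<And>u. u \<in> V \<Longrightarrow> nrm u = c * (\<integral>t. \<bar>u t\<bar> \<partial>M)"
  shows "same_space X (L1_weighted M (ennreal c))"
  unfolding L1_weighted_eq
proof (rule same_space_if_real[OF ae_space_axioms ae_space_L1])
  fix u :: "'a \<Rightarrow> real" assume "u \<in> borel_measurable M"
  then show "(\<lambda>t. ereal (u t)) \<in> F \<longleftrightarrow> (\<lambda>t. ereal (u t)) \<in> L1_class M"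
    using V_iff[of u] by (simp add: V_def L1_class_real)
next
  fix u :: "'a \<Rightarrow> real" assume "(\<lambda>t. ereal (u t)) \<in> F"
  then have u: "u \<in> V" using meas by (auto simp: V_def borel_measurable_ereal_iff[symmetric])
  then show "N (\<lambda>t. ereal (u t)) = enn2real (\<integral>\<^sup>+t. ennreal c * e2ennreal \<bar>ereal (u t)\<bar> \<partial>M)"
    using nrm_eq[OF u] c V_iff by (simp add: nrm_def L1_norm_real del: abs_ereal.simps)
qed

lemma same_space_Linf:
  assumes c: "0 < c"
    and V_iff: "\<And>u. u \<in> V \<longleftrightarrow> u \<in> borel_measurable M \<and> (\<exists>C. AE t in M. \<bar>u t\<bar> \<le> C)"
    and nrm_pos: "\<And>u. u \<in> V \<Longrightarrow> 0 \<le> nrm u"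
    and nrm_le: "\<And>u C. u \<in> V \<Longrightarrow> 0 \<le> C \<Longrightarrow> nrm u \<le> C \<longleftrightarrow> (AE t in M. c * \<bar>u t\<bar> \<le> C)"
  shows "same_space X (Linf_weighted M (ennreal c))"
  unfolding Linf_weighted_eq
proof (rule same_space_if_real[OF ae_space_axioms ae_space_Linf])
  fix u :: "'a \<Rightarrow> real" assume "u \<in> borel_measurable M"
  then show "(\<lambda>t. ereal (u t)) \<in> F \<longleftrightarrow> (\<lambda>t. ereal (u t)) \<in> Linf_class M"
    using V_iff[of u] by (simp add: V_def Linf_class_real)
next
  fix u :: "'a \<Rightarrow> real" assume "(\<lambda>t. ereal (u t)) \<in> F"
  then have u: "u \<in> V" using meas by (auto simp: V_def borel_measurable_ereal_iff[symmetric])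
  then have uL: "(\<lambda>t. ereal (u t)) \<in> Linf_class M" by (simp add: V_iff Linf_class_real)
  show "N (\<lambda>t. ereal (u t)) = enn2real (esssup M (\<lambda>t. ennreal c * e2ennreal \<bar>ereal (u t)\<bar>))"
    using nrm_pos[OF u] nrm_le[OF u] Linf_norm_real[OF uL c]
    by (intro eq_if_same_upper_bounds) (simp_all add: nrm_def)
qed

end

context orlicz_setting
begin

lemma linear_type_imp:
  assumes lin: "linear_type \<phi> c"
  shows "same_space (L_luxemburg M \<phi>) (L1_weighted M (ennreal c))"
    and "same_space (L_orlicz M \<phi> \<psi>) (Linf_weighted M (ennreal (1 / c)))"
    and "daugavet_property (L_luxemburg M \<phi>)"
    and "daugavet_property (L_orlicz M \<phi> \<psi>)"
proof -
  have c: "0 < c" "0 < 1 / c" using c_pos[OF lin] by auto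
  have nrm: "u \<in> lux.V \<Longrightarrow> lux.nrm u = c * (\<integral>t. \<bar>u t\<bar> \<partial>M)" for u
    by (simp add: lux_V_linear[OF lin] lux_nrm_linear[OF lin])
  have pos: "0 \<le> orl.nrm u" for u by (simp add: orl_nrm)
  note L1 = c(1) lux_V_linear[OF lin] nrm
  note Linf = c(2) orl_V_linear[OF lin] pos orl_nrm_linear[OF lin]
  show "same_space (L_luxemburg M \<phi>) (L1_weighted M (ennreal c))"
    unfolding L_luxemburg_def by (rule lux.same_space_L1[OF L1])
  show "same_space (L_orlicz M \<phi> \<psi>) (Linf_weighted M (ennreal (1 / c)))"
    unfolding L_orlicz_def by (rule orl.same_space_Linf[OF Linf])
  show "daugavet_property (L_luxemburg M \<phi>)"
    unfolding L_luxemburg_def by (rule lux.daugavet_L1[OF nonatomic L1])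
  show "daugavet_property (L_orlicz M \<phi> \<psi>)"
    unfolding L_orlicz_def by (rule orl.daugavet_Linf[OF nonatomic Linf nontriv])
qed

lemma bounded_type_imp:
  assumes bt: "bounded_type M \<phi> \<beta>"
  shows "same_space (L_luxemburg M \<phi>) (Linf_weighted M (ennreal (1 / \<beta>)))"
    and "same_space (L_orlicz M \<phi> \<psi>) (L1_weighted M (ennreal \<beta>))"
    and "daugavet_property (L_luxemburg M \<phi>)"
    and "daugavet_property (L_orlicz M \<phi> \<psi>)"
proof -
  have \<beta>: "0 < \<beta>" "0 < 1 / \<beta>" using \<beta>_pos[OF bt] by auto
  have nrm: "u \<in> orl.V \<Longrightarrow> orl.nrm u = \<beta> * (\<integral>t. \<bar>u t\<bar> \<partial>M)" for u
    by (simp add: orl_V_bounded[OF bt] orl_nrm_bounded[OF bt])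
  note L1 = \<beta>(1) orl_V_bounded[OF bt] nrm
  note Linf = \<beta>(2) lux_V_bounded[OF bt] lux_nrm_nonneg lux_nrm_bounded[OF bt]
  show "same_space (L_luxemburg M \<phi>) (Linf_weighted M (ennreal (1 / \<beta>)))"
    unfolding L_luxemburg_def by (rule lux.same_space_Linf[OF Linf])
  show "same_space (L_orlicz M \<phi> \<psi>) (L1_weighted M (ennreal \<beta>))"
    unfolding L_orlicz_def by (rule orl.same_space_L1[OF L1])
  show "daugavet_property (L_luxemburg M \<phi>)"
    unfolding L_luxemburg_def by (rule lux.daugavet_Linf[OF nonatomic Linf nontriv])
  show "daugavet_property (L_orlicz M \<phi> \<psi>)"
    unfolding L_orlicz_def by (rule orl.daugavet_L1[OF nonatomic L1])
qed

text \<open>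
  Slightly smaller multiples \<open>v\<close> of \<open>\<one>\<^sub>A\<close> have norm below \<open>1\<close>, hence \<open>\<phi> v * m \<le> 1\<close>; then pass to
  the limit from the left.
\<close>

lemma lux_indicator_norm_imp:
  assumes A: "A \<in> sets M" "emeasure M A = ennreal m" "0 < m"
    and L: "lux.nrm (indicator A) = L" "0 < L"
  shows "\<phi> (1 / L) \<le> ennreal (1 / m)"
proof (rule phi_le_from_left)
  fix v :: real assume v: "0 < v" "v < 1 / L"
  have "L < 1 / v" using v L by (simp add: field_simps)
  moreover have "indicator A \<in> lux.V" using A by (intro lux_indicator_V) auto
  ultimately have "real_modular M \<phi> (\<lambda>t. indicator A t / (1 / v)) \<le> 1"
    using L by (intro lux_modular_le) auto
  then have "real_modular M \<phi> (\<lambda>t. v * indicator A t) \<le> 1" by (simp add: mult.commute)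
  then have "\<phi> v * ennreal m \<le> 1" using v A by (simp add: real_modular_indicator)
  then show "\<phi> v \<le> ennreal (1 / m)"
    using A by (subst (asm) ennreal_mult_le_1_iff) (auto simp: one_divide_ennreal)
qed (use L in auto)

text \<open>
  If \<open>\<phi> v * m > 1\<close> for some \<open>v < L / m\<close>, then the integral over \<open>A\<close> of every test function is at most
  \<open>v * m < L\<close>, either by Jensen's inequality or, for \<open>v \<ge> b_of \<phi>\<close>, because test functions are bounded
  by \<open>v\<close>. This contradicts the value of the norm.
\<close>

lemma orl_indicator_norm_imp:
  assumes A [measurable]: "A \<in> sets M" and m: "emeasure M A = ennreal m" "0 < m"
    and L: "orl.nrm (indicator A) = L" "0 < L"
  shows "\<phi> (L / m) \<le> ennreal (1 / m)"
proof (rule phi_le_from_left)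
  fix v :: real assume v: "0 < v" "v < L / m"
  show "\<phi> v \<le> ennreal (1 / m)"
  proof (rule ccontr)
    assume "\<not> \<phi> v \<le> ennreal (1 / m)"
    then have "\<not> \<phi> v * emeasure M A \<le> 1"
      using m by (subst ennreal_mult_le_1_iff) (auto simp: one_divide_ennreal)
    then have ge: "1 \<le> \<phi> v * emeasure M A" by simp
    have "orlicz_sup (indicator A) \<le> ennreal (v * m)"
      unfolding orlicz_sup_def
    proof (rule SUP_least, safe)
      fix g assume gm [measurable]: "g \<in> borel_measurable M" and g: "real_modular M \<phi> g \<le> 1"
      have "(\<integral>\<^sup>+t. ennreal \<bar>indicator A t * g t\<bar> \<partial>M) = (\<integral>\<^sup>+t. ennreal \<bar>g t\<bar> * indicator A t \<partial>M)"
        by (intro nn_integral_cong) (auto simp: indicator_def)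
      also have "\<dots> \<le> ennreal v * emeasure M A"
      proof (cases "ennreal v < b_of \<phi>")
        case True
        show ?thesis using m v True ge g by (intro average_le) auto
      next
        case False
        have "AE t in M. \<phi> \<bar>g t\<bar> \<noteq> \<infinity>"
          using g unfolding real_modular_def by (intro nn_integral_PInf_AE) (auto simp: top_unique)
        then have "AE t in M. ennreal \<bar>g t\<bar> * indicator A t \<le> ennreal v * indicator A t"
        proof eventually_elim
          case (elim t)
          have "\<bar>g t\<bar> \<le> v"
          proof (rule ccontr)
            assume "\<not> \<bar>g t\<bar> \<le> v"
            then have "ennreal v < ennreal \<bar>g t\<bar>" using v by (simp add: ennreal_less_iff)
            with False have "b_of \<phi> < ennreal \<bar>g t\<bar>" by (simp add: not_less)
            with elim show False using phi_eq_top_above_b by blast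
          qed
          then show ?case by (intro mult_right_mono ennreal_leI) auto
        qed
        then have "(\<integral>\<^sup>+t. ennreal \<bar>g t\<bar> * indicator A t \<partial>M) \<le> (\<integral>\<^sup>+t. ennreal v * indicator A t \<partial>M)"
          by (rule nn_integral_mono_AE)
        then show ?thesis by (simp add: nn_integral_cmult_indicator)
      qed
      also have "\<dots> = ennreal (v * m)" using m v by (simp add: ennreal_mult)
      finally show "(\<integral>\<^sup>+t. ennreal \<bar>indicator A t * g t\<bar> \<partial>M) \<le> ennreal (v * m)" .
    qed
    then have "L \<le> v * m" using L m v unfolding orl_nrm by (metis enn2real_leI mult_nonneg_nonneg less_imp_le)
    then show False using v m by (simp add: field_simps)
  qed
qed (use L m in auto)

text \<open>
  By \<open>\<sigma>\<close>-finiteness there is a set of finite positive measure, which is then halved repeatedly.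
\<close>

lemma small_set_exists: "\<exists>A\<in>sets M. \<exists>m. emeasure M A = ennreal m \<and> 0 < m \<and> m \<le> \<epsilon>" if \<epsilon>: "0 < \<epsilon>"
proof -
  have "0 < emeasure M (space M)" using nontriv by (simp add: zero_less_iff_neq_zero)
  from finite_subset_large[OF sets.top this] obtain A
    where A: "A \<in> sets M" "emeasure M A < \<infinity>" "0 < emeasure M A" .
  then have pos: "0 < measure M A" by (simp add: emeasure_eq_ennreal_measure less_top[symmetric])
  obtain n where "measure M A / \<epsilon> < 2 ^ n" using real_arch_pow[of 2] by fastforce
  then have n: "measure M A / 2 ^ n \<le> \<epsilon>" using \<epsilon> by (simp add: field_simps)
  obtain B where B: "B \<in> sets M" "B \<subseteq> A" "0 < measure M B" "measure M B \<le> measure M A / 2 ^ n"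
    using nonatomic_small_subset[OF nonatomic A(1,2) pos, of n] by blast
  have "emeasure M B \<noteq> \<infinity>" using emeasure_mono[OF B(2) A(1)] A(2) by (auto simp: top_unique)
  then have "emeasure M B = ennreal (measure M B)" by (simp add: emeasure_eq_ennreal_measure)
  then show ?thesis using B n by (intro bexI[of _ B] exI[of _ "measure M B"]) auto
qed

text \<open>
  The value of \<open>a_of \<psi>\<close> is the slope of \<open>\<phi>\<close> at \<open>0\<close>, which makes \<open>c * u\<close> a lower bound of \<open>\<phi>\<close>. Sets of
  small measure provide arbitrarily large points where it is also an upper bound, and the
  upper bound carries over to smaller arguments because the slope increases.
\<close>

lemma linear_typeI_pointwise:
  assumes a: "a_of \<psi> = ennreal c" "0 < c"
    and pt: "\<And>A m. A \<in> sets M \<Longrightarrow> emeasure M A = ennreal m \<Longrightarrow> 0 < m \<Longrightarrow> \<phi> (1 / (c * m)) \<le> ennreal (1 / m)"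
  shows "linear_type \<phi> c"
  unfolding linear_type_def
proof (intro conjI allI impI)
  fix u :: real assume u: "0 \<le> u"
  show "\<phi> u = ennreal (c * u)"
  proof (cases "u = 0")
    case False
    then have u0: "0 < u" using u by simp
    show ?thesis
    proof (rule antisym)
      obtain A m where A: "A \<in> sets M" "emeasure M A = ennreal m" "0 < m" "m \<le> 1 / (c * u)"
        using small_set_exists[of "1 / (c * u)"] a u0 by auto
      have cum: "0 \<le> c * u * m" "c * u * m \<le> 1" using A a u0 by (auto simp: field_simps)
      have "\<phi> (c * u * m * (1 / (c * m))) \<le> ennreal (c * u * m) * \<phi> (1 / (c * m))"
        using cum a A by (intro phi_scale) auto
      also have "\<dots> \<le> ennreal (c * u * m) * ennreal (1 / m)"
        using pt[OF A(1-3)] by (intro mult_left_mono) auto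
      also have "\<dots> = ennreal (c * u)"
        using cum A by (simp add: ennreal_mult[symmetric])
      finally show "\<phi> u \<le> ennreal (c * u)" using a A by simp
      show "ennreal (c * u) \<le> \<phi> u"
      proof (rule ccontr)
        assume "\<not> ?thesis"
        then have lt: "\<phi> u < ennreal (c * u)" by simp
        then obtain p where p: "\<phi> u = ennreal p" "0 \<le> p" by (cases "\<phi> u") (auto simp: top_unique)
        then have "p < c * u" using lt by (simp add: ennreal_less_iff)
        then have "p / u < c" using u0 by (simp add: field_simps)
        moreover have "0 \<le> p / u" using p u0 by simp
        ultimately have "ennreal (p / u) < a_of \<psi>" using a by (simp add: ennreal_less_iff)
        then obtain x where x: "0 \<le> x" "\<psi> x = 0" "ennreal (p / u) < ennreal x"
          unfolding a_of_def less_Sup_iff by auto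
        then have "p / u < x" using p u0 by (simp add: ennreal_less_iff)
        then have "p < x * u" using u0 by (simp add: field_simps)
        moreover have "ennreal (x * u) \<le> \<phi> u + \<psi> x" using x u by (intro young) auto
        then have "x * u \<le> p" using x p by simp
        ultimately show False by simp
      qed
    qed
  qed simp
qed (rule a(2))

lemma bounded_typeI_pointwise:
  assumes b: "b_of \<phi> = ennreal \<beta>" "0 < \<beta>"
    and pt: "\<And>A m. A \<in> sets M \<Longrightarrow> emeasure M A = ennreal m \<Longrightarrow> 0 < m \<Longrightarrow> \<phi> \<beta> \<le> ennreal (1 / m)"
  shows "bounded_type M \<phi> \<beta>"
  unfolding bounded_type_def
proof (intro conjI b)
  show "\<phi> \<beta> * emeasure M (space M) \<le> 1"
  proof (rule ccontr)
    assume gt: "\<not> \<phi> \<beta> * emeasure M (space M) \<le> 1"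
    then have p0: "\<phi> \<beta> \<noteq> 0" by auto
    have "\<not> emeasure M (space M) * \<phi> \<beta> \<le> 1"
      using gt unfolding mult.commute[of "\<phi> \<beta>"] .
    then have "1 / \<phi> \<beta> < emeasure M (space M)" by (simp only: ennreal_mult_le_1_iff[OF p0] not_le)
    from finite_subset_large[OF sets.top this] obtain A
      where A: "A \<in> sets M" "emeasure M A < \<infinity>" "1 / \<phi> \<beta> < emeasure M A" .
    obtain m where m: "emeasure M A = ennreal m" "0 \<le> m" using A by (cases "emeasure M A") auto
    have "m \<noteq> 0"
    proof
      assume "m = 0"
      with A(3) m(1) show False by simp
    qed
    then have m0: "0 < m" using m by simp
    have "\<not> ennreal m * \<phi> \<beta> \<le> 1"
      unfolding ennreal_mult_le_1_iff[OF p0] using A(3) m(1) by (simp only: not_le)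
    moreover have "\<phi> \<beta> \<le> 1 / ennreal m" using pt[OF A(1) m(1) m0] m0 by (simp only: one_divide_ennreal)
    then have "\<phi> \<beta> * ennreal m \<le> 1" using m0 by (subst ennreal_mult_le_1_iff) auto
    ultimately show False unfolding mult.commute[of "\<phi> \<beta>"] by simp
  qed
qed

lemma indicator_of_L1:
  assumes same: "same_space (class_space M F N) (L1_weighted M (ennreal c))" and ae: "ae_space M F N" and c: "0 < c"
    and A: "A \<in> sets M" "emeasure M A = ennreal m" "0 < m"
  shows "N (\<lambda>t. ereal (indicator A t)) = c * m"
proof -
  have i: "integrable M (indicat_real A)" "(\<integral>t. \<bar>indicat_real A t\<bar> \<partial>M) = m"
    using integrable_indicator_real[of A M m] A by auto
  have "N (\<lambda>t. ereal (indicator A t)) = enn2real (\<integral>\<^sup>+t. ennreal c * e2ennreal \<bar>ereal (indicator A t)\<bar> \<partial>M)"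
    by (rule real_if_same_space(2)[OF ae ae_space_L1 same[unfolded L1_weighted_eq]]) (simp only: L1_class_real i)
  also have "\<dots> = c * m" using L1_norm_real[OF i(1), of c] c i(2) by simp
  finally show ?thesis .
qed

lemma indicator_of_Linf:
  assumes same: "same_space (class_space M F N) (Linf_weighted M (ennreal c))" and ae: "ae_space M F N" and c: "0 < c"
    and A: "A \<in> sets M" "emeasure M A = ennreal m" "0 < m"
  shows "N (\<lambda>t. ereal (indicator A t)) = c"
proof -
  have "0 < emeasure M A" using A by simp
  note i = Linf_indicator_norm[OF A(1) this c]
  have "N (\<lambda>t. ereal (indicator A t)) = enn2real (esssup M (\<lambda>t. ennreal c * e2ennreal \<bar>ereal (indicator A t)\<bar>))"
    by (rule real_if_same_space(2)[OF ae ae_space_Linf same[unfolded Linf_weighted_eq] i(1)])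
  then show ?thesis by (simp only: i(2))
qed

end

theorem corollary4p15:
  fixes M :: "'a measure" and \<phi> \<psi> :: "real \<Rightarrow> ennreal"
  assumes "sigma_finite_measure M" and "complete_measure M" and "nonatomic M"
    and "emeasure M (space M) \<noteq> 0"
    and "orlicz_function \<phi>"
    and "\<And>u. 0 \<le> u \<Longrightarrow> \<psi> u = complementary \<phi> u"
  defines "i \<equiv> daugavet_property (L_luxemburg M \<phi>)"
    and "ii \<equiv>
      (0 < a_of \<psi> \<and> a_of \<psi> < \<infinity> \<and>
        same_space (L_luxemburg M \<phi>) (L1_weighted M (a_of \<psi>))) \<or>
      (0 < 1 / b_of \<phi> \<and> 1 / b_of \<phi> < \<infinity> \<and>
        same_space (L_luxemburg M \<phi>) (Linf_weighted M (1 / b_of \<phi>)))"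
    and "iii \<equiv>
      (0 < 1 / a_of \<psi> \<and> 1 / a_of \<psi> < \<infinity> \<and>
        same_space (L_orlicz M \<phi> \<psi>) (Linf_weighted M (1 / a_of \<psi>))) \<or>
      (0 < b_of \<phi> \<and> b_of \<phi> < \<infinity> \<and>
        same_space (L_orlicz M \<phi> \<psi>) (L1_weighted M (b_of \<phi>)))"
    and "iv \<equiv> daugavet_property (L_orlicz M \<phi> \<psi>)"
  shows "(i \<longleftrightarrow> ii) \<and> (ii \<longleftrightarrow> iii) \<and> (iii \<longleftrightarrow> iv)"
proof -
  interpret orlicz_setting \<phi> M \<psi>
    using assms(1,3-6) by (simp add: orlicz_setting_def orlicz_def orlicz_setting_axioms_def)
  define C where "C \<longleftrightarrow> (\<exists>c. linear_type \<phi> c) \<or> (\<exists>\<beta>. bounded_type M \<phi> \<beta>)"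
  have "C \<Longrightarrow> i" "C \<Longrightarrow> iv"
    unfolding C_def i_def iv_def using linear_type_imp(3,4) bounded_type_imp(3,4) by blast+
  moreover have "i \<Longrightarrow> C" "iv \<Longrightarrow> C"
    unfolding C_def i_def iv_def using lux_daugavet_imp orl_daugavet_imp by blast+
  moreover have "C \<Longrightarrow> ii \<and> iii"
  proof -
    assume C
    then consider c where "linear_type \<phi> c" | \<beta> where "bounded_type M \<phi> \<beta>" unfolding C_def by blast
    then show "ii \<and> iii"
    proof cases
      case 1
      have c: "0 < c" "a_of \<psi> = ennreal c" using c_pos[OF 1] a_of_linear[OF 1] by auto
      then show ?thesis
        unfolding ii_def iii_def using linear_type_imp(1,2)[OF 1] by (simp add: one_divide_ennreal)
    next
      case 2
      have b: "0 < \<beta>" "b_of \<phi> = ennreal \<beta>" using \<beta>_pos[OF 2] b_eq[OF 2] by auto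
      then show ?thesis
        unfolding ii_def iii_def using bounded_type_imp(1,2)[OF 2] by (simp add: one_divide_ennreal)
    qed
  qed
  moreover have "C" if ii
    using that unfolding ii_def
  proof (elim disjE conjE)
    assume a: "0 < a_of \<psi>" "a_of \<psi> < \<infinity>" and same: "same_space (L_luxemburg M \<phi>) (L1_weighted M (a_of \<psi>))"
    from a obtain c where c: "a_of \<psi> = ennreal c" "0 < c" by (rule ennreal_pos_finite_cases)
    have "linear_type \<phi> c"
    proof (rule linear_typeI_pointwise[OF c])
      fix A m assume A: "A \<in> sets M" "emeasure M A = ennreal m" "0 < m"
      have "lux.nrm (indicator A) = c * m"
        unfolding lux.nrm_def
        by (rule indicator_of_L1[OF same[unfolded L_luxemburg_def c(1)] ae_space_lux c(2) A])
      then show "\<phi> (1 / (c * m)) \<le> ennreal (1 / m)" using c A by (intro lux_indicator_norm_imp[OF A]) auto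
    qed
    then show C unfolding C_def by blast
  next
    assume b: "0 < 1 / b_of \<phi>" "1 / b_of \<phi> < \<infinity>" and same: "same_space (L_luxemburg M \<phi>) (Linf_weighted M (1 / b_of \<phi>))"
    from b obtain \<beta> where \<beta>: "b_of \<phi> = ennreal \<beta>" "0 < \<beta>" by (rule one_divide_pos_finite_cases)
    have same': "same_space (L_luxemburg M \<phi>) (Linf_weighted M (ennreal (1 / \<beta>)))"
      using same \<beta> by (simp add: one_divide_ennreal)
    have "bounded_type M \<phi> \<beta>"
    proof (rule bounded_typeI_pointwise[OF \<beta>])
      fix A m assume A: "A \<in> sets M" "emeasure M A = ennreal m" "0 < m"
      have "lux.nrm (indicator A) = 1 / \<beta>"
        unfolding lux.nrm_def
        by (rule indicator_of_Linf[OF same'[unfolded L_luxemburg_def] ae_space_lux _ A]) (use \<beta> in simp)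
      then have "\<phi> (1 / (1 / \<beta>)) \<le> ennreal (1 / m)" using \<beta> by (intro lux_indicator_norm_imp[OF A]) auto
      then show "\<phi> \<beta> \<le> ennreal (1 / m)" by simp
    qed
    then show C unfolding C_def by blast
  qed
  moreover have "C" if iii
    using that unfolding iii_def
  proof (elim disjE conjE)
    assume a: "0 < 1 / a_of \<psi>" "1 / a_of \<psi> < \<infinity>" and same: "same_space (L_orlicz M \<phi> \<psi>) (Linf_weighted M (1 / a_of \<psi>))"
    from a obtain c where c: "a_of \<psi> = ennreal c" "0 < c" by (rule one_divide_pos_finite_cases)
    have same': "same_space (L_orlicz M \<phi> \<psi>) (Linf_weighted M (ennreal (1 / c)))"
      using same c by (simp add: one_divide_ennreal)
    have "linear_type \<phi> c"
    proof (rule linear_typeI_pointwise[OF c])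
      fix A m assume A: "A \<in> sets M" "emeasure M A = ennreal m" "0 < m"
      have "orl.nrm (indicator A) = 1 / c"
        unfolding orl.nrm_def
        by (rule indicator_of_Linf[OF same'[unfolded L_orlicz_def] ae_space_orl _ A]) (use c in simp)
      then have "\<phi> (1 / c / m) \<le> ennreal (1 / m)" using c by (intro orl_indicator_norm_imp[OF A]) auto
      then show "\<phi> (1 / (c * m)) \<le> ennreal (1 / m)" by (simp add: divide_divide_eq_left)
    qed
    then show C unfolding C_def by blast
  next
    assume b: "0 < b_of \<phi>" "b_of \<phi> < \<infinity>" and same: "same_space (L_orlicz M \<phi> \<psi>) (L1_weighted M (b_of \<phi>))"
    from b obtain \<beta> where \<beta>: "b_of \<phi> = ennreal \<beta>" "0 < \<beta>" by (rule ennreal_pos_finite_cases)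
    have "bounded_type M \<phi> \<beta>"
    proof (rule bounded_typeI_pointwise[OF \<beta>])
      fix A m assume A: "A \<in> sets M" "emeasure M A = ennreal m" "0 < m"
      have "orl.nrm (indicator A) = \<beta> * m"
        unfolding orl.nrm_def
        by (rule indicator_of_L1[OF same[unfolded L_orlicz_def \<beta>(1)] ae_space_orl \<beta>(2) A])
      then have "\<phi> (\<beta> * m / m) \<le> ennreal (1 / m)" using \<beta> A by (intro orl_indicator_norm_imp[OF A]) auto
      then show "\<phi> \<beta> \<le> ennreal (1 / m)" using A by simp
    qed
    then show C unfolding C_def by blast
  qed
  ultimately show ?thesis by blast
qed

end
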